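(* Let $\mathfrak k$ be an abelian bundle of ideals of a Lie algebroid $A\Rightarrow M$ and let $B=A/\mathfrak k$. Then $\mathfrak k$ admits a primitive IM connection if and only if there exists a flat linear connection $\nabla$ on $\mathfrak k$ which induces $\nabla^B$ and satisfies $$c(A)\in\mathrm{im}\,(\rho_B)^*_{tc,\nabla}.$$ Moreover, there is a bijective correspondence, $((\mathcal C,v),F)\mapsto(v,\mathcal C|_{\mathfrak k},F)$, between primitive IM connections for $\mathfrak k$ with a choice of curving, and triples $(v,\nabla,F)$ where $v\colon A\to\mathfrak k$ is a splitting (vector bundle map with $v|_{\mathfrak k}=\mathrm{id}$), $\nabla$ is a flat connection on $\mathfrak k$ inducing $\nabla^B$, and $F\in\Omega^2_{tc,\nabla}(M;\mathfrak k)$ satisfies $F^v=(\rho_B)^*F$.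
   Context: $\rho$ is the anchor of $A$. A bundle of ideals is a vector subbundle $\mathfrak k\subset\ker\rho\subset A$ with $[\Gamma(A),\Gamma(\mathfrak k)]\subset\Gamma(\mathfrak k)$; abelian means its fibrewise bracket vanishes. $B=A/\mathfrak k$ inherits a Lie algebroid structure with anchor $\rho_B$. Since $\mathfrak k$ is abelian, $B$ has a representation on $\mathfrak k$, $\nabla^B_\alpha\xi=[\tilde\alpha,\xi]$, with $\tilde\alpha\in\Gamma(A)$ any lift of $\alpha\in\Gamma(B)$ along $A\to B$. A connection $\nabla$ on $\mathfrak k$ induces $\nabla^B$ if $\nabla^B_\alpha=\nabla_{\rho_B(\alpha)}$ for all $\alpha$. Put $T\mathcal F=\mathrm{im}\,\rho=\mathrm{im}\,\rho_B\subset TM$ and $$\Omega^2_{tc,\nabla}(M;\mathfrak k)=\{F\in\Omega^2(M;\mathfrak k):\iota_X\mathrm d^\nabla F=0\text{ for all }X\in T\mathcal F\}.$$ For flat $\nabla$ inducing $\nabla^B$, pullback along $\rho_B$ gives $(\rho_B)^*\colon\Omega^2_{tc,\nabla}(M;\mathfrak k)\to Z^2(B;\mathfrak k)$ (2-cocycles for $\mathrm d^{\nabla^B}$), and $(\rho_B)^*_{tc,\nabla}\colon\Omega^2_{tc,\nabla}(M;\mathfrak k)\to H^2(B;\mathfrak k)$ is the induced map to Lie algebroid cohomology. For a splitting $v\colon A\to\mathfrak k$, with associated lift $\sigma\colon B\to A$ (image $\ker v$), $F^v\in\Omega^2(B;\mathfrak k)$, $F^v(\alpha,\beta)=\sigma[\alpha,\beta]_B-[\sigma\alpha,\sigma\beta]_A$;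 the class $c(A)=[F^v]\in H^2(B;\mathfrak k)$ does not depend on $v$. An IM connection for $\mathfrak k$ is a pair $(\mathcal C,v)$ with $\mathcal C\colon\Gamma(A)\to\Omega^1(M;\mathfrak k)$ $\mathbb R$-linear, $v\colon A\to\mathfrak k$ a vector bundle map, $v|_{\mathfrak k}=\mathrm{id}$, $\mathcal C(f\alpha)=f\mathcal C(\alpha)+\mathrm df\otimes v(\alpha)$, and, for $\alpha,\beta\in\Gamma(A)$, $\mathcal C[\alpha,\beta]=\mathcal L^A_\alpha\mathcal C(\beta)-\mathcal L^A_\beta\mathcal C(\alpha)$ and $v[\alpha,\beta]=[\alpha,v(\beta)]-\iota_{\rho(\beta)}\mathcal C(\alpha)$, where $(\mathcal L^A_\alpha\gamma)(\underline X)=[\alpha,\gamma(\underline X)]-\sum_j\gamma(\dots,[\rho(\alpha),X_j],\dots)$. With $h=\mathrm{id}_A-v$ and $\nabla=\mathcal C|_{\mathfrak k}$ (i.e. $\nabla_X\xi=\mathcal C(\xi)(X)$), its curvature is $\Omega^{(\mathcal C,v)}(\alpha)=(\mathrm d^\nabla\mathcal C(\alpha),\mathcal C(h\alpha))$. It is primitive if there is $F\in\Omega^2(M;\mathfrak k)$, called a curving, with $\Omega^{(\mathcal C,v)}(\alpha)=(\mathcal L^A_\alpha F,\iota_{\rho(\alpha)}F)$ for all $\alpha\in\Gamma(A)$. *)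

theory Defs
  imports
    "HOL-Analysis.Analysis"
    "HOL-Library.Set_Algebras"
    "HOL-Library.Function_Algebras"
begin

text \<open>
  Pointwise real vector space structure on functions.  It is used for sections
  (\<open>'m \<Rightarrow> 'v\<close>), for tangent vectors (derivations, \<open>('m \<Rightarrow> real) \<Rightarrow> real\<close>) and for
  forms.
\<close>

instantiation "fun" :: (type, real_vector) real_vector
begin

definition scaleR_fun_def: "scaleR c f = (\<lambda>x. c *\<^sub>R f x)"

instance
  by standard (auto simp: scaleR_fun_def plus_fun_def fun_eq_iff algebra_simps)

end


section \<open>Smooth maps and manifolds\<close>

primrec Ck_on :: "nat \<Rightarrow> 'a::euclidean_space set \<Rightarrow> ('a \<Rightarrow> 'b::real_normed_vector) \<Rightarrow> bool" where
  "Ck_on 0 S f \<longleftrightarrow> continuous_on S f"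
| "Ck_on (Suc n) S f \<longleftrightarrow>
     (\<forall>x\<in>S. f differentiable (at x)) \<and> (\<forall>w. Ck_on n S (\<lambda>x. frechet_derivative f (at x) w))"

text \<open>
  Smoothness on an arbitrary subset \<open>S\<close>: local extendability to smooth maps on open sets.
  For open \<open>S\<close> this is ordinary smoothness, and for \<open>S\<close> relatively open in a linear
  subspace it is smoothness along that subspace.
\<close>

definition smooth_on :: "'a::euclidean_space set \<Rightarrow> ('a \<Rightarrow> 'b::real_normed_vector) \<Rightarrow> bool" where
  "smooth_on S f \<longleftrightarrow>
     (\<forall>x\<in>S. \<exists>W g. open W \<and> x \<in> W \<and> (\<forall>n. Ck_on n W g) \<and> (\<forall>y\<in>W \<inter> S. g y = f y))"

text \<open>
  The underlying set of a manifold is a whole (Hausdorff, second countable) type \<open>'m\<close>.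
  Charts take values in a linear subspace \<open>model\<close> of a Euclidean space, not in the
  Euclidean space itself, since Euclidean spaces are positive-dimensional in the library
  and zero-dimensional manifolds (Lie algebras!) must be included.
\<close>

record ('m, 'e) manifold =
  model :: "'e set"
  atlas :: "('m set \<times> ('m \<Rightarrow> 'e)) set"

definition smooth_manifold ::
  "('m::{t2_space,second_countable_topology}, 'e::euclidean_space) manifold \<Rightarrow> bool" where
  "smooth_manifold M \<longleftrightarrow>
     subspace (model M) \<and>
     (\<Union>(U, \<phi>)\<in>atlas M. U) = UNIV \<and>
     (\<forall>(U, \<phi>)\<in>atlas M. open U \<and> openin (top_of_set (model M)) (\<phi> ` U) \<and>
        homeomorphism U (\<phi> ` U) \<phi> (inv_into U \<phi>)) \<and>
     (\<forall>(U, \<phi>)\<in>atlas M. \<forall>(V, \<psi>)\<in>atlas M. smooth_on (\<phi> ` (U \<inter> V)) (\<psi> \<circ> inv_into U \<phi>))"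

definition smooth_fun ::
  "('m::topological_space, 'e::euclidean_space) manifold \<Rightarrow> 'm set \<Rightarrow> ('m \<Rightarrow> real) \<Rightarrow> bool" where
  "smooth_fun M W f \<longleftrightarrow> (\<forall>(U, \<phi>)\<in>atlas M. smooth_on (\<phi> ` (U \<inter> W)) (f \<circ> inv_into U \<phi>))"

definition Cinf ::
  "('m::topological_space, 'e::euclidean_space) manifold \<Rightarrow> ('m \<Rightarrow> real) set" where
  "Cinf M = {f. smooth_fun M UNIV f}"


subsection \<open>Tangent vectors and vector fields\<close>

type_synonym 'm tvector = "('m \<Rightarrow> real) \<Rightarrow> real"
type_synonym 'm vfield = "'m \<Rightarrow> 'm tvector"

text \<open>
  Derivations of \<open>Cinf M\<close> at \<open>p\<close>; the value \<open>0\<close> on non-smooth functions makes equality of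
  tangent vectors equality of functions.
\<close>

definition tangent_space ::
  "('m::topological_space, 'e::euclidean_space) manifold \<Rightarrow> 'm \<Rightarrow> 'm tvector set" where
  "tangent_space M p = {D.
     (\<forall>f\<in>Cinf M. \<forall>g\<in>Cinf M. D (f + g) = D f + D g) \<and>
     (\<forall>c. \<forall>f\<in>Cinf M. D (c *\<^sub>R f) = c * D f) \<and>
     (\<forall>f\<in>Cinf M. \<forall>g\<in>Cinf M. D (f * g) = f p * D g + g p * D f) \<and>
     (\<forall>f. f \<notin> Cinf M \<longrightarrow> D f = 0)}"

definition vfields ::
  "('m::topological_space, 'e::euclidean_space) manifold \<Rightarrow> 'm vfield set" where
  "vfields M = {X. (\<forall>p. X p \<in> tangent_space M p) \<and> (\<forall>f\<in>Cinf M. (\<lambda>p. X p f) \<in> Cinf M)}"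

definition vf_bracket :: "'m vfield \<Rightarrow> 'm vfield \<Rightarrow> 'm vfield" where
  "vf_bracket X Y = (\<lambda>p f. X p (\<lambda>q. Y q f) - Y p (\<lambda>q. X q f))"


section \<open>Vector bundles\<close>

text \<open>
  A vector bundle is given by its fibres, which are subspaces of one real vector space
  \<open>'v\<close> (any family of vector spaces embeds fibrewise into its direct sum), and by an atlas of
  local trivialisations, each recorded as the local frame it determines.
\<close>

record ('m, 'v) vbundle =
  fib :: "'m \<Rightarrow> 'v set"
  frames :: "('m set \<times> ('m \<Rightarrow> 'v) list) set"

definition frame_on :: "'m set \<Rightarrow> ('m \<Rightarrow> 'v::real_vector set) \<Rightarrow> ('m \<Rightarrow> 'v) list \<Rightarrow> bool" where
  "frame_on U F es \<longleftrightarrow> (\<forall>x\<in>U. distinct (map (\<lambda>e. e x) es) \<and>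
      independent (set (map (\<lambda>e. e x) es)) \<and> span (set (map (\<lambda>e. e x) es)) = F x)"

definition smul :: "('m \<Rightarrow> real) \<Rightarrow> ('m \<Rightarrow> 'v::real_vector) \<Rightarrow> 'm \<Rightarrow> 'v" where
  "smul f s = (\<lambda>x. f x *\<^sub>R s x)"

definition local_sections ::
  "('m::topological_space, 'e::euclidean_space) manifold \<Rightarrow> ('m, 'v::real_vector, 'z) vbundle_scheme
    \<Rightarrow> 'm set \<Rightarrow> ('m \<Rightarrow> 'v) set" where
  "local_sections M E U = {s. (\<forall>x\<in>U. s x \<in> fib E x) \<and>
     (\<forall>(V, es)\<in>frames E. \<exists>c. (\<forall>i<length es. smooth_fun M (U \<inter> V) (c i)) \<and>
        (\<forall>x\<in>U \<inter> V. s x = (\<Sum>i<length es. c i x *\<^sub>R (es ! i) x)))}"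

abbreviation sections ::
  "('m::topological_space, 'e::euclidean_space) manifold \<Rightarrow> ('m, 'v::real_vector, 'z) vbundle_scheme
    \<Rightarrow> ('m \<Rightarrow> 'v) set" where
  "sections M E \<equiv> local_sections M E UNIV"

text \<open>The last clause is smoothness of the transition functions.\<close>

definition vector_bundle ::
  "('m::topological_space, 'e::euclidean_space) manifold \<Rightarrow> ('m, 'v::real_vector, 'z) vbundle_scheme
    \<Rightarrow> bool" where
  "vector_bundle M E \<longleftrightarrow>
     (\<Union>(U, es)\<in>frames E. U) = UNIV \<and>
     (\<forall>(U, es)\<in>frames E. open U \<and> frame_on U (fib E) es \<and> set es \<subseteq> local_sections M E U)"

text \<open>
  A subbundle is given by its fibres; its smooth sections are the smooth sections of the
  ambient bundle with values in it.
\<close>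

definition subbundle ::
  "('m::topological_space, 'e::euclidean_space) manifold \<Rightarrow> ('m, 'v::real_vector, 'z) vbundle_scheme
    \<Rightarrow> ('m \<Rightarrow> 'v set) \<Rightarrow> bool" where
  "subbundle M E k \<longleftrightarrow>
     (\<forall>x. subspace (k x) \<and> k x \<subseteq> fib E x) \<and>
     (\<forall>x. \<exists>U es. open U \<and> x \<in> U \<and> set es \<subseteq> local_sections M E U \<and> frame_on U k es)"

definition sub_sections ::
  "('m::topological_space, 'e::euclidean_space) manifold \<Rightarrow> ('m, 'v::real_vector, 'z) vbundle_scheme
    \<Rightarrow> ('m \<Rightarrow> 'v set) \<Rightarrow> ('m \<Rightarrow> 'v) set" where
  "sub_sections M E k = {s \<in> sections M E. \<forall>x. s x \<in> k x}"

definition fibre_linear :: "'v::real_vector set \<Rightarrow> ('v \<Rightarrow> 'w::real_vector) \<Rightarrow> bool" where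
  "fibre_linear V f \<longleftrightarrow>
     (\<forall>a\<in>V. \<forall>b\<in>V. f (a + b) = f a + f b) \<and> (\<forall>c. \<forall>a\<in>V. f (c *\<^sub>R a) = c *\<^sub>R f a)"

text \<open>
  The action on sections of a fibrewise map covering the identity.
\<close>

definition act :: "('m \<Rightarrow> 'v \<Rightarrow> 'w) \<Rightarrow> ('m \<Rightarrow> 'v) \<Rightarrow> 'm \<Rightarrow> 'w" where
  "act \<phi> s = (\<lambda>x. \<phi> x (s x))"


section \<open>Lie algebroids\<close>

record ('m, 'v) lie_algebroid = "('m, 'v) vbundle" +
  anchor :: "'m \<Rightarrow> 'v \<Rightarrow> 'm tvector"
  bracket :: "('m \<Rightarrow> 'v) \<Rightarrow> ('m \<Rightarrow> 'v) \<Rightarrow> 'm \<Rightarrow> 'v"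

definition anchor_bundle_map ::
  "('m::topological_space, 'e::euclidean_space) manifold \<Rightarrow> ('m, 'v::real_vector) lie_algebroid
    \<Rightarrow> bool" where
  "anchor_bundle_map M A \<longleftrightarrow>
     (\<forall>x. fibre_linear (fib A x) (anchor A x) \<and> anchor A x ` fib A x \<subseteq> tangent_space M x) \<and>
     (\<forall>U. \<forall>s\<in>local_sections M A U. open U \<longrightarrow>
        (\<forall>f\<in>Cinf M. smooth_fun M U (\<lambda>x. anchor A x (s x) f)))"

text \<open>
  Compatibility of the anchor with the brackets follows from the other axioms, but is
  customarily listed.
\<close>

definition is_lie_algebroid ::
  "('m::topological_space, 'e::euclidean_space) manifold \<Rightarrow> ('m, 'v::real_vector) lie_algebroid
    \<Rightarrow> bool" where
  "is_lie_algebroid M A \<longleftrightarrow>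
     vector_bundle M A \<and> anchor_bundle_map M A \<and>
     (\<forall>\<alpha>\<in>sections M A. \<forall>\<beta>\<in>sections M A.
        bracket A \<alpha> \<beta> \<in> sections M A \<and>
        bracket A \<alpha> \<beta> = - bracket A \<beta> \<alpha> \<and>
        (\<forall>c. bracket A (c *\<^sub>R \<alpha>) \<beta> = c *\<^sub>R bracket A \<alpha> \<beta>) \<and>
        act (anchor A) (bracket A \<alpha> \<beta>) =
          vf_bracket (act (anchor A) \<alpha>) (act (anchor A) \<beta>) \<and>
        (\<forall>f\<in>Cinf M. bracket A \<alpha> (smul f \<beta>) =
           smul f (bracket A \<alpha> \<beta>) + smul (\<lambda>x. anchor A x (\<alpha> x) f) \<beta>)) \<and>
     (\<forall>\<alpha>\<in>sections M A. \<forall>\<beta>\<in>sections M A. \<forall>\<gamma>\<in>sections M A.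
        bracket A (\<alpha> + \<beta>) \<gamma> = bracket A \<alpha> \<gamma> + bracket A \<beta> \<gamma> \<and>
        bracket A \<alpha> (bracket A \<beta> \<gamma>) + bracket A \<beta> (bracket A \<gamma> \<alpha>) +
          bracket A \<gamma> (bracket A \<alpha> \<beta>) = 0)"

definition bundle_of_ideals ::
  "('m::topological_space, 'e::euclidean_space) manifold \<Rightarrow> ('m, 'v::real_vector) lie_algebroid
    \<Rightarrow> ('m \<Rightarrow> 'v set) \<Rightarrow> bool" where
  "bundle_of_ideals M A k \<longleftrightarrow>
     subbundle M A k \<and>
     (\<forall>x. \<forall>a\<in>k x. anchor A x a = 0) \<and>
     (\<forall>\<alpha>\<in>sections M A. \<forall>\<xi>\<in>sub_sections M A k. bracket A \<alpha> \<xi> \<in> sub_sections M A k)"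

definition abelian_bundle_of_ideals ::
  "('m::topological_space, 'e::euclidean_space) manifold \<Rightarrow> ('m, 'v::real_vector) lie_algebroid
    \<Rightarrow> ('m \<Rightarrow> 'v set) \<Rightarrow> bool" where
  "abelian_bundle_of_ideals M A k \<longleftrightarrow>
     bundle_of_ideals M A k \<and>
     (\<forall>\<xi>\<in>sub_sections M A k. \<forall>\<eta>\<in>sub_sections M A k. bracket A \<xi> \<eta> = 0)"


section \<open>Forms with values in \<open>k\<close>\<close>

text \<open>
  The data on sections of a Lie algebroid that enter the Cartan calculus.  It is used for
  the two Lie algebroids \<open>TM\<close> and \<open>B = A/k\<close>; addition of sections is the pointwise one
  (for \<open>B\<close>, whose fibres consist of cosets, pointwise Minkowski addition).
\<close>

record ('m, 's) section_space =
  carr :: "'s set"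
  fmult :: "('m \<Rightarrow> real) \<Rightarrow> 's \<Rightarrow> 's"
  brk :: "'s \<Rightarrow> 's \<Rightarrow> 's"

text \<open>
  Forms are alternating \<open>Cinf M\<close>-multilinear maps on sections with values in a module \<open>K\<close> of
  sections.  They are extended by \<open>0\<close> outside their domain, so that equal forms are equal
  functions.
\<close>

definition forms1 ::
  "('m::topological_space, 'e::euclidean_space) manifold \<Rightarrow> ('m, 's::plus) section_space
    \<Rightarrow> ('m \<Rightarrow> 'v::real_vector) set \<Rightarrow> ('s \<Rightarrow> 'm \<Rightarrow> 'v) set" where
  "forms1 M L K = {\<omega>.
     (\<forall>X\<in>carr L. \<omega> X \<in> K) \<and>
     (\<forall>X. X \<notin> carr L \<longrightarrow> \<omega> X = 0) \<and>
     (\<forall>X\<in>carr L. \<forall>Y\<in>carr L. \<omega> (X + Y) = \<omega> X + \<omega> Y) \<and>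
     (\<forall>f\<in>Cinf M. \<forall>X\<in>carr L. \<omega> (fmult L f X) = smul f (\<omega> X))}"

definition forms2 ::
  "('m::topological_space, 'e::euclidean_space) manifold \<Rightarrow> ('m, 's::plus) section_space
    \<Rightarrow> ('m \<Rightarrow> 'v::real_vector) set \<Rightarrow> ('s \<Rightarrow> 's \<Rightarrow> 'm \<Rightarrow> 'v) set" where
  "forms2 M L K = {\<omega>.
     (\<forall>X\<in>carr L. \<omega> X \<in> forms1 M L K) \<and>
     (\<forall>X\<in>carr L. (\<lambda>Y. \<omega> Y X) \<in> forms1 M L K) \<and>
     (\<forall>X. X \<notin> carr L \<longrightarrow> \<omega> X = 0) \<and>
     (\<forall>X\<in>carr L. \<omega> X X = 0)}"

text \<open>
  Koszul formulas for a connection or representation \<open>D X \<xi>\<close>, in degrees 1 and 2.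
\<close>

definition diff1 ::
  "('m, 's) section_space \<Rightarrow> ('s \<Rightarrow> ('m \<Rightarrow> 'v) \<Rightarrow> 'm \<Rightarrow> 'v::real_vector)
    \<Rightarrow> ('s \<Rightarrow> 'm \<Rightarrow> 'v) \<Rightarrow> 's \<Rightarrow> 's \<Rightarrow> 'm \<Rightarrow> 'v" where
  "diff1 L D \<omega> X Y =
     (if X \<in> carr L \<and> Y \<in> carr L then D X (\<omega> Y) - D Y (\<omega> X) - \<omega> (brk L X Y) else 0)"

definition diff2 ::
  "('m, 's) section_space \<Rightarrow> ('s \<Rightarrow> ('m \<Rightarrow> 'v) \<Rightarrow> 'm \<Rightarrow> 'v::real_vector)
    \<Rightarrow> ('s \<Rightarrow> 's \<Rightarrow> 'm \<Rightarrow> 'v) \<Rightarrow> 's \<Rightarrow> 's \<Rightarrow> 's \<Rightarrow> 'm \<Rightarrow> 'v" where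
  "diff2 L D \<omega> X Y Z =
     (if X \<in> carr L \<and> Y \<in> carr L \<and> Z \<in> carr L then
        D X (\<omega> Y Z) - D Y (\<omega> X Z) + D Z (\<omega> X Y)
        - \<omega> (brk L X Y) Z + \<omega> (brk L X Z) Y - \<omega> (brk L Y Z) X
      else 0)"

text \<open>
  The class \<open>\<omega> + d(\<Omega>\<^sup>1)\<close> in second cohomology, a coset of the coboundaries.  It is applied only to the
  forms \<open>split_form\<close> and \<open>pullback_B\<close> below, which are cocycles for the data considered here.
\<close>

definition class2 ::
  "('m::topological_space, 'e::euclidean_space) manifold \<Rightarrow> ('m, 's::plus) section_space
    \<Rightarrow> ('m \<Rightarrow> 'v::real_vector) set \<Rightarrow> ('s \<Rightarrow> ('m \<Rightarrow> 'v) \<Rightarrow> 'm \<Rightarrow> 'v)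
    \<Rightarrow> ('s \<Rightarrow> 's \<Rightarrow> 'm \<Rightarrow> 'v) \<Rightarrow> ('s \<Rightarrow> 's \<Rightarrow> 'm \<Rightarrow> 'v) set" where
  "class2 M L K D \<omega> = {\<omega> + diff1 L D \<eta> |\<eta>. \<eta> \<in> forms1 M L K}"

definition TM :: "('m::topological_space, 'e::euclidean_space) manifold
    \<Rightarrow> ('m, 'm vfield) section_space" where
  "TM M = \<lparr>carr = vfields M, fmult = smul, brk = vf_bracket\<rparr>"


section \<open>The quotient \<open>B = A/k\<close>\<close>

text \<open>
  The fibre of \<open>B\<close> at \<open>x\<close> consists of the cosets \<open>a +o k x\<close> of elements of \<open>fib A x\<close>.  A section
  of \<open>B\<close> is smooth if and only if it lifts locally to smooth sections of \<open>A\<close>.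
\<close>

definition proj :: "('m \<Rightarrow> 'v::real_vector set) \<Rightarrow> ('m \<Rightarrow> 'v) \<Rightarrow> 'm \<Rightarrow> 'v set" where
  "proj k \<alpha> = (\<lambda>x. \<alpha> x +o k x)"

definition B_sections ::
  "('m::topological_space, 'e::euclidean_space) manifold \<Rightarrow> ('m, 'v::real_vector) lie_algebroid
    \<Rightarrow> ('m \<Rightarrow> 'v set) \<Rightarrow> ('m \<Rightarrow> 'v set) set" where
  "B_sections M A k = {\<beta>. \<forall>x. \<exists>U. open U \<and> x \<in> U \<and>
      (\<exists>\<alpha>\<in>local_sections M A U. \<forall>y\<in>U. \<beta> y = proj k \<alpha> y)}"

definition B_smul :: "('m \<Rightarrow> 'v::real_vector set) \<Rightarrow> ('m \<Rightarrow> real) \<Rightarrow> ('m \<Rightarrow> 'v set) \<Rightarrow> 'm \<Rightarrow> 'v set"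
  where "B_smul k f \<beta> = (\<lambda>x. (\<lambda>a. f x *\<^sub>R a) ` \<beta> x + k x)"

definition lift ::
  "('m::topological_space, 'e::euclidean_space) manifold \<Rightarrow> ('m, 'v::real_vector) lie_algebroid
    \<Rightarrow> ('m \<Rightarrow> 'v set) \<Rightarrow> ('m \<Rightarrow> 'v set) \<Rightarrow> 'm \<Rightarrow> 'v" where
  "lift M A k \<beta> = (SOME \<alpha>. \<alpha> \<in> sections M A \<and> proj k \<alpha> = \<beta>)"

definition B_bracket ::
  "('m::topological_space, 'e::euclidean_space) manifold \<Rightarrow> ('m, 'v::real_vector) lie_algebroid
    \<Rightarrow> ('m \<Rightarrow> 'v set) \<Rightarrow> ('m \<Rightarrow> 'v set) \<Rightarrow> ('m \<Rightarrow> 'v set) \<Rightarrow> 'm \<Rightarrow> 'v set" where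
  "B_bracket M A k \<beta> \<gamma> = proj k (bracket A (lift M A k \<beta>) (lift M A k \<gamma>))"

definition B_anchor :: "('m, 'v::real_vector) lie_algebroid \<Rightarrow> 'm \<Rightarrow> 'v set \<Rightarrow> 'm tvector" where
  "B_anchor A x b = anchor A x (SOME a. a \<in> b)"

definition B_space ::
  "('m::topological_space, 'e::euclidean_space) manifold \<Rightarrow> ('m, 'v::real_vector) lie_algebroid
    \<Rightarrow> ('m \<Rightarrow> 'v set) \<Rightarrow> ('m, 'm \<Rightarrow> 'v set) section_space" where
  "B_space M A k = \<lparr>carr = B_sections M A k, fmult = B_smul k, brk = B_bracket M A k\<rparr>"

definition B_rep ::
  "('m::topological_space, 'e::euclidean_space) manifold \<Rightarrow> ('m, 'v::real_vector) lie_algebroid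
    \<Rightarrow> ('m \<Rightarrow> 'v set) \<Rightarrow> ('m \<Rightarrow> 'v set) \<Rightarrow> ('m \<Rightarrow> 'v) \<Rightarrow> 'm \<Rightarrow> 'v" where
  "B_rep M A k \<beta> \<xi> = bracket A (lift M A k \<beta>) \<xi>"


section \<open>Splittings and the extension class\<close>

text \<open>As for forms, bundle maps out of \<open>A\<close> are extended by \<open>0\<close> off the fibres.\<close>

definition splitting ::
  "('m::topological_space, 'e::euclidean_space) manifold \<Rightarrow> ('m, 'v::real_vector) lie_algebroid
    \<Rightarrow> ('m \<Rightarrow> 'v set) \<Rightarrow> ('m \<Rightarrow> 'v \<Rightarrow> 'v) \<Rightarrow> bool" where
  "splitting M A k v \<longleftrightarrow>
     (\<forall>x. fibre_linear (fib A x) (v x) \<and> v x ` fib A x \<subseteq> k x \<and>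
        (\<forall>a. a \<notin> fib A x \<longrightarrow> v x a = 0) \<and> (\<forall>a\<in>k x. v x a = a)) \<and>
     (\<forall>U. open U \<longrightarrow> act v ` local_sections M A U \<subseteq> local_sections M A U)"

definition hor :: "('m \<Rightarrow> 'v \<Rightarrow> 'v) \<Rightarrow> 'm \<Rightarrow> 'v::real_vector \<Rightarrow> 'v" where
  "hor v x a = a - v x a"

text \<open>The lift \<open>B \<rightarrow> A\<close> with image \<open>ker v\<close>.\<close>

definition hlift :: "('m \<Rightarrow> 'v \<Rightarrow> 'v::real_vector) \<Rightarrow> 'm \<Rightarrow> 'v set \<Rightarrow> 'v" where
  "hlift v x b = (THE a. a \<in> b \<and> v x a = 0)"

definition split_form ::
  "('m::topological_space, 'e::euclidean_space) manifold \<Rightarrow> ('m, 'v::real_vector) lie_algebroid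
    \<Rightarrow> ('m \<Rightarrow> 'v set) \<Rightarrow> ('m \<Rightarrow> 'v \<Rightarrow> 'v) \<Rightarrow> ('m \<Rightarrow> 'v set) \<Rightarrow> ('m \<Rightarrow> 'v set) \<Rightarrow> 'm \<Rightarrow> 'v" where
  "split_form M A k v \<beta> \<gamma> =
     (if \<beta> \<in> B_sections M A k \<and> \<gamma> \<in> B_sections M A k then
        act (hlift v) (B_bracket M A k \<beta> \<gamma>) - bracket A (act (hlift v) \<beta>) (act (hlift v) \<gamma>)
      else 0)"

text \<open>
  The classes of \<open>split_form M A k v\<close> coincide for all splittings \<open>v\<close>; their union is
  that common class.
\<close>

definition ext_class ::
  "('m::topological_space, 'e::euclidean_space) manifold \<Rightarrow> ('m, 'v::real_vector) lie_algebroid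
    \<Rightarrow> ('m \<Rightarrow> 'v set) \<Rightarrow> (('m \<Rightarrow> 'v set) \<Rightarrow> ('m \<Rightarrow> 'v set) \<Rightarrow> 'm \<Rightarrow> 'v) set" where
  "ext_class M A k = (\<Union>v\<in>{v. splitting M A k v}.
     class2 M (B_space M A k) (sub_sections M A k) (B_rep M A k) (split_form M A k v))"


section \<open>Connections on \<open>k\<close>\<close>

type_synonym ('m, 'v) form_op = "('m \<Rightarrow> 'v) \<Rightarrow> 'm vfield \<Rightarrow> 'm \<Rightarrow> 'v"

text \<open>
  A connection maps a section \<open>\<xi>\<close> of \<open>k\<close> to the 1-form \<open>D \<xi>\<close>, so \<open>D \<xi> X\<close> is the covariant
  derivative of \<open>\<xi>\<close> along \<open>X\<close>.
\<close>

definition connection ::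
  "('m::topological_space, 'e::euclidean_space) manifold \<Rightarrow> ('m, 'v::real_vector) lie_algebroid
    \<Rightarrow> ('m \<Rightarrow> 'v set) \<Rightarrow> ('m, 'v) form_op \<Rightarrow> bool" where
  "connection M A k D \<longleftrightarrow>
     (\<forall>\<xi>\<in>sub_sections M A k. D \<xi> \<in> forms1 M (TM M) (sub_sections M A k)) \<and>
     (\<forall>\<xi>. \<xi> \<notin> sub_sections M A k \<longrightarrow> D \<xi> = 0) \<and>
     (\<forall>\<xi>\<in>sub_sections M A k. \<forall>\<eta>\<in>sub_sections M A k. D (\<xi> + \<eta>) = D \<xi> + D \<eta>) \<and>
     (\<forall>c. \<forall>\<xi>\<in>sub_sections M A k. D (c *\<^sub>R \<xi>) = c *\<^sub>R D \<xi>) \<and>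
     (\<forall>f\<in>Cinf M. \<forall>\<xi>\<in>sub_sections M A k. \<forall>X\<in>vfields M.
        D (smul f \<xi>) X = smul f (D \<xi> X) + smul (\<lambda>x. X x f) \<xi>)"

definition flat ::
  "('m::topological_space, 'e::euclidean_space) manifold \<Rightarrow> ('m, 'v::real_vector) lie_algebroid
    \<Rightarrow> ('m \<Rightarrow> 'v set) \<Rightarrow> ('m, 'v) form_op \<Rightarrow> bool" where
  "flat M A k D \<longleftrightarrow> (\<forall>X\<in>vfields M. \<forall>Y\<in>vfields M. \<forall>\<xi>\<in>sub_sections M A k.
     D (D \<xi> Y) X - D (D \<xi> X) Y - D \<xi> (vf_bracket X Y) = 0)"

definition induces_B_rep ::
  "('m::topological_space, 'e::euclidean_space) manifold \<Rightarrow> ('m, 'v::real_vector) lie_algebroid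
    \<Rightarrow> ('m \<Rightarrow> 'v set) \<Rightarrow> ('m, 'v) form_op \<Rightarrow> bool" where
  "induces_B_rep M A k D \<longleftrightarrow> (\<forall>\<beta>\<in>B_sections M A k. \<forall>\<xi>\<in>sub_sections M A k.
     B_rep M A k \<beta> \<xi> = D \<xi> (act (B_anchor A) \<beta>))"

text \<open>
  The 2-forms \<open>F\<close> such that the exterior covariant derivative of \<open>F\<close> vanishes when
  contracted with any tangent vector in the image of the anchor.  The value of the 3-form at
  \<open>p\<close> on tangent vectors is computed through vector fields extending them.
\<close>

definition forms2_tc ::
  "('m::topological_space, 'e::euclidean_space) manifold \<Rightarrow> ('m, 'v::real_vector) lie_algebroid
    \<Rightarrow> ('m \<Rightarrow> 'v set) \<Rightarrow> ('m, 'v) form_op \<Rightarrow> ('m vfield \<Rightarrow> 'm vfield \<Rightarrow> 'm \<Rightarrow> 'v) set" where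
  "forms2_tc M A k D = {F \<in> forms2 M (TM M) (sub_sections M A k).
     \<forall>p. \<forall>X\<in>vfields M. \<forall>Y\<in>vfields M. \<forall>Z\<in>vfields M. X p \<in> anchor A p ` fib A p \<longrightarrow>
       diff2 (TM M) (\<lambda>X \<xi>. D \<xi> X) F X Y Z p = 0}"

definition pullback_B ::
  "('m::topological_space, 'e::euclidean_space) manifold \<Rightarrow> ('m, 'v::real_vector) lie_algebroid
    \<Rightarrow> ('m \<Rightarrow> 'v set) \<Rightarrow> ('m vfield \<Rightarrow> 'm vfield \<Rightarrow> 'm \<Rightarrow> 'v)
    \<Rightarrow> ('m \<Rightarrow> 'v set) \<Rightarrow> ('m \<Rightarrow> 'v set) \<Rightarrow> 'm \<Rightarrow> 'v" where
  "pullback_B M A k F \<beta> \<gamma> =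
     (if \<beta> \<in> B_sections M A k \<and> \<gamma> \<in> B_sections M A k then
        F (act (B_anchor A) \<beta>) (act (B_anchor A) \<gamma>) else 0)"

definition pullback_tc ::
  "('m::topological_space, 'e::euclidean_space) manifold \<Rightarrow> ('m, 'v::real_vector) lie_algebroid
    \<Rightarrow> ('m \<Rightarrow> 'v set) \<Rightarrow> ('m vfield \<Rightarrow> 'm vfield \<Rightarrow> 'm \<Rightarrow> 'v)
    \<Rightarrow> (('m \<Rightarrow> 'v set) \<Rightarrow> ('m \<Rightarrow> 'v set) \<Rightarrow> 'm \<Rightarrow> 'v) set" where
  "pullback_tc M A k F =
     class2 M (B_space M A k) (sub_sections M A k) (B_rep M A k) (pullback_B M A k F)"


section \<open>IM connections\<close>

definition Lie1 :: "('m::topological_space, 'e::euclidean_space) manifold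
    \<Rightarrow> ('m, 'v::real_vector) lie_algebroid
    \<Rightarrow> ('m \<Rightarrow> 'v) \<Rightarrow> ('m vfield \<Rightarrow> 'm \<Rightarrow> 'v) \<Rightarrow> 'm vfield \<Rightarrow> 'm \<Rightarrow> 'v" where
  "Lie1 M A \<alpha> \<omega> X = (if X \<in> vfields M then
     bracket A \<alpha> (\<omega> X) - \<omega> (vf_bracket (act (anchor A) \<alpha>) X) else 0)"

definition Lie2 :: "('m::topological_space, 'e::euclidean_space) manifold
    \<Rightarrow> ('m, 'v::real_vector) lie_algebroid
    \<Rightarrow> ('m \<Rightarrow> 'v) \<Rightarrow> ('m vfield \<Rightarrow> 'm vfield \<Rightarrow> 'm \<Rightarrow> 'v)
    \<Rightarrow> 'm vfield \<Rightarrow> 'm vfield \<Rightarrow> 'm \<Rightarrow> 'v" where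
  "Lie2 M A \<alpha> \<omega> X Y = (if X \<in> vfields M \<and> Y \<in> vfields M then
     bracket A \<alpha> (\<omega> X Y) - \<omega> (vf_bracket (act (anchor A) \<alpha>) X) Y
       - \<omega> X (vf_bracket (act (anchor A) \<alpha>) Y) else 0)"

definition IM_connection ::
  "('m::topological_space, 'e::euclidean_space) manifold \<Rightarrow> ('m, 'v::real_vector) lie_algebroid
    \<Rightarrow> ('m \<Rightarrow> 'v set) \<Rightarrow> ('m, 'v) form_op \<times> ('m \<Rightarrow> 'v \<Rightarrow> 'v) \<Rightarrow> bool" where
  "IM_connection M A k = (\<lambda>(C, v).
     splitting M A k v \<and>
     (\<forall>\<alpha>\<in>sections M A. C \<alpha> \<in> forms1 M (TM M) (sub_sections M A k)) \<and>
     (\<forall>\<alpha>. \<alpha> \<notin> sections M A \<longrightarrow> C \<alpha> = 0) \<and>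
     (\<forall>\<alpha>\<in>sections M A. \<forall>\<beta>\<in>sections M A. C (\<alpha> + \<beta>) = C \<alpha> + C \<beta>) \<and>
     (\<forall>c. \<forall>\<alpha>\<in>sections M A. C (c *\<^sub>R \<alpha>) = c *\<^sub>R C \<alpha>) \<and>
     (\<forall>f\<in>Cinf M. \<forall>\<alpha>\<in>sections M A. \<forall>X\<in>vfields M.
        C (smul f \<alpha>) X = smul f (C \<alpha> X) + smul (\<lambda>x. X x f) (act v \<alpha>)) \<and>
     (\<forall>\<alpha>\<in>sections M A. \<forall>\<beta>\<in>sections M A.
        C (bracket A \<alpha> \<beta>) = Lie1 M A \<alpha> (C \<beta>) - Lie1 M A \<beta> (C \<alpha>) \<and>
        act v (bracket A \<alpha> \<beta>) = bracket A \<alpha> (act v \<beta>) - C \<alpha> (act (anchor A) \<beta>)))"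

definition restr ::
  "('m::topological_space, 'e::euclidean_space) manifold \<Rightarrow> ('m, 'v::real_vector) lie_algebroid
    \<Rightarrow> ('m \<Rightarrow> 'v set) \<Rightarrow> ('m, 'v) form_op \<Rightarrow> ('m, 'v) form_op" where
  "restr M A k C = (\<lambda>\<xi>. if \<xi> \<in> sub_sections M A k then C \<xi> else 0)"

definition IM_curvature ::
  "('m::topological_space, 'e::euclidean_space) manifold \<Rightarrow> ('m, 'v::real_vector) lie_algebroid
    \<Rightarrow> ('m \<Rightarrow> 'v set) \<Rightarrow> ('m, 'v) form_op \<times> ('m \<Rightarrow> 'v \<Rightarrow> 'v) \<Rightarrow> ('m \<Rightarrow> 'v)
    \<Rightarrow> ('m vfield \<Rightarrow> 'm vfield \<Rightarrow> 'm \<Rightarrow> 'v) \<times> ('m vfield \<Rightarrow> 'm \<Rightarrow> 'v)" where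
  "IM_curvature M A k = (\<lambda>(C, v) \<alpha>.
     (diff1 (TM M) (\<lambda>X \<xi>. restr M A k C \<xi> X) (C \<alpha>), C (act (hor v) \<alpha>)))"

definition curving ::
  "('m::topological_space, 'e::euclidean_space) manifold \<Rightarrow> ('m, 'v::real_vector) lie_algebroid
    \<Rightarrow> ('m \<Rightarrow> 'v set) \<Rightarrow> ('m, 'v) form_op \<times> ('m \<Rightarrow> 'v \<Rightarrow> 'v)
    \<Rightarrow> ('m vfield \<Rightarrow> 'm vfield \<Rightarrow> 'm \<Rightarrow> 'v) \<Rightarrow> bool" where
  "curving M A k Cv F \<longleftrightarrow>
     F \<in> forms2 M (TM M) (sub_sections M A k) \<and>
     (\<forall>\<alpha>\<in>sections M A. IM_curvature M A k Cv \<alpha> = (Lie2 M A \<alpha> F, F (act (anchor A) \<alpha>)))"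

definition primitive ::
  "('m::topological_space, 'e::euclidean_space) manifold \<Rightarrow> ('m, 'v::real_vector) lie_algebroid
    \<Rightarrow> ('m \<Rightarrow> 'v set) \<Rightarrow> ('m, 'v) form_op \<times> ('m \<Rightarrow> 'v \<Rightarrow> 'v) \<Rightarrow> bool" where
  "primitive M A k Cv \<longleftrightarrow> (\<exists>F. curving M A k Cv F)"

end

(*
  In an IM connection (C, v) with curving F, the condition C (h a) = F (rho a) forces
  C a = D (v a) + F (rho a), where D is the restriction of C to k; so ((C, v), F) is determined by
  (v, D, F).  The remaining axioms translate one by one: the bracket condition on v says that D
  induces the representation of B and that F^v is the pullback of F, while the one on C and the
  first curvature condition say that D is flat and that the contraction of the exterior covariant
  derivative of F with rho a vanishes for all sections a.  Passing from such contractions to the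
  pointwise condition defining tangential closedness uses that a Cinf-linear map on vector fields
  vanishes at p on every field vanishing at p, hence cutoffs and Hadamard's lemma.

  For the existence statement, changing v by a form eta on B changes F^v by the coboundary of eta,
  so equality of classes can be improved to equality of forms by modifying the splitting.
*)
theory Submission
  imports Defs
begin

section \<open>Calculus of \<open>Ck_on\<close> and \<open>smooth_on\<close>\<close>

section \<open>Smooth maps between Euclidean spaces\<close>

text \<open>Forms and connections are maps on global sections, whereas splittings and tangential
  closedness are fibrewise. Besides tensoriality over vector fields, a second tensoriality, for
  sections of \<open>A\<close>, is therefore needed: it turns a form \<open>\<eta>\<close> on B into
  the bundle map by which a splitting is changed. Tangent vectors are derivations of
  \<open>Cinf M\<close>, so no local frame of vector fields is given; Hadamard's lemma is what
  produces the coordinate expansion.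

  No splitting is assumed to exist. Sections of B are lifted along a splitting that is at hand: an
  IM connection contains one, and \<open>ext_class\<close> is a union over splittings, which would
  be empty without them, while the class of a pullback is inhabited.

  In the algebra, a bracket with a section of \<open>k\<close> becomes a covariant derivative along
  the anchor, and flatness reorders second derivatives. After that, the bracket axiom for C and the
  first curvature condition express the vanishing of the same contraction
  \<open>dform D F (\<rho> \<alpha>)\<close>, tested on \<open>\<rho> \<beta>\<close> and X in one
  case and on arbitrary Y and Z in the other.\<close>

lemma Ck_on_cong:
  assumes "open S" "\<And>x. x \<in> S \<Longrightarrow> f x = g x"
  shows "Ck_on n S f \<longleftrightarrow> Ck_on n S g"
  using assms(2)
proof (induction n arbitrary: f g)
  case 0
  then show ?case by (simp cong: continuous_on_cong)
next
  case (Suc n)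
  have d: "g differentiable at x" if "f differentiable at x" "x \<in> S" "\<And>x. x \<in> S \<Longrightarrow> f x = g x"
    for x and f g :: "'a \<Rightarrow> 'b"
    using that has_derivative_transform_within_open[OF _ assms(1), of f _ x UNIV g]
    unfolding differentiable_def by blast
  have imp: "Ck_on (Suc n) S g" if f: "Ck_on (Suc n) S f" and eq: "\<And>x. x \<in> S \<Longrightarrow> f x = g x"
    for f g :: "'a \<Rightarrow> 'b"
  proof -
    have "frechet_derivative f (at x) w = frechet_derivative g (at x) w" if "x \<in> S" for x w
      using frechet_derivative_transform_within_open[OF _ assms(1) that, of f g] f eq that by simp
    then have "Ck_on n S (\<lambda>x. frechet_derivative f (at x) w) \<longleftrightarrow>
        Ck_on n S (\<lambda>x. frechet_derivative g (at x) w)" for w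
      by (rule Suc.IH)
    then show ?thesis using f d[of f _ g] eq by simp
  qed
  show ?case
    by (rule iffI; erule imp) (simp_all add: Suc.prems)
qed

text \<open>Lets any explicit derivative stand in for \<open>frechet_derivative\<close>; the closure
  properties of \<open>Ck_on\<close> then become inductions on the order.\<close>

lemma Ck_on_SucI:
  assumes "open S" "\<And>x. x \<in> S \<Longrightarrow> (f has_derivative f' x) (at x)"
    and "\<And>w. Ck_on n S (\<lambda>x. f' x w)"
  shows "Ck_on (Suc n) S f"
proof -
  have "Ck_on n S (\<lambda>x. frechet_derivative f (at x) w)" for w
    using assms Ck_on_cong[OF assms(1), of "\<lambda>x. frechet_derivative f (at x) w" "\<lambda>x. f' x w" n]
    by (metis frechet_derivative_at)
  then show ?thesis using assms(2) by (auto simp: differentiable_def)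
qed

lemma Ck_on_Suc_has_derivative:
  assumes "Ck_on (Suc n) S f" "x \<in> S"
  shows "(f has_derivative frechet_derivative f (at x)) (at x)"
  using assms frechet_derivative_works by auto

lemma Ck_on_Suc_Ck_on: "Ck_on (Suc n) S f \<Longrightarrow> Ck_on n S f"
proof (induction n arbitrary: f)
  case 0
  then show ?case
    by (auto intro!: differentiable_imp_continuous_on differentiable_at_imp_differentiable_on)
next
  case (Suc n)
  from Suc.prems have "Ck_on (Suc n) S (\<lambda>x. frechet_derivative f (at x) w)" for w
    by (metis Ck_on.simps(2))
  then have "Ck_on n S (\<lambda>x. frechet_derivative f (at x) w)" for w
    using Suc.IH by blast
  then show ?case using Suc.prems by simp
qed

lemma Ck_on_subset: "Ck_on n S f \<Longrightarrow> T \<subseteq> S \<Longrightarrow> Ck_on n T f"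
  by (induction n arbitrary: f) (auto intro: continuous_on_subset)

text \<open>\<open>smooth_on\<close> is phrased through local extensions; this glues their orders of
  differentiability over an open set.\<close>

lemma Ck_on_local:
  assumes "open S" "\<And>x. x \<in> S \<Longrightarrow> \<exists>W. open W \<and> x \<in> W \<and> Ck_on n W f"
  shows "Ck_on n S f"
  using assms(2)
proof (induction n arbitrary: f)
  case 0
  then have "continuous (at x) f" if "x \<in> S" for x
    using that by (metis Ck_on.simps(1) continuous_on_eq_continuous_at)
  then show ?case using assms(1) by (simp add: continuous_at_imp_continuous_on)
next
  case (Suc n)
  have "Ck_on n S (\<lambda>x. frechet_derivative f (at x) w)" for w
  proof (rule Suc.IH)
    fix x assume "x \<in> S"
    then show "\<exists>W. open W \<and> x \<in> W \<and> Ck_on n W (\<lambda>x. frechet_derivative f (at x) w)"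
      using Suc.prems by (metis Ck_on.simps(2))
  qed
  moreover have "f differentiable at x" if "x \<in> S" for x
    using Suc.prems[OF that] by auto
  ultimately show ?case by simp
qed

lemma Ck_on_const: "Ck_on n S (\<lambda>x. c)"
proof (induction n arbitrary: c)
  case 0 then show ?case by simp
next
  case (Suc n)
  then show ?case by simp
qed

lemma Ck_on_bounded_linear:
  assumes "bounded_linear f" "open S"
  shows "Ck_on n S f"
proof (cases n)
  case 0 then show ?thesis using assms linear_continuous_on by auto
next
  case (Suc m)
  show ?thesis unfolding Suc
    by (rule Ck_on_SucI[OF assms(2), of _ "\<lambda>_. f"])
      (use assms in \<open>auto intro: Ck_on_const bounded_linear_imp_has_derivative\<close>)
qed

lemma Ck_on_add:
  assumes "open S" "Ck_on n S f" "Ck_on n S g"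
  shows "Ck_on n S (\<lambda>x. f x + g x)"
  using assms(2,3)
proof (induction n arbitrary: f g)
  case 0 then show ?case by (auto intro: continuous_on_add)
next
  case (Suc n)
  show ?case
    by (rule Ck_on_SucI[OF assms(1), where
          f' = "\<lambda>x w. frechet_derivative f (at x) w + frechet_derivative g (at x) w"])
      (use Suc in \<open>auto intro!: has_derivative_add intro: Ck_on_Suc_has_derivative[OF Suc.prems(1)] Ck_on_Suc_has_derivative[OF Suc.prems(2)]\<close>)
qed

lemma Ck_on_sum:
  assumes "open S" "finite I" "\<And>i. i \<in> I \<Longrightarrow> Ck_on n S (f i)"
  shows "Ck_on n S (\<lambda>x. \<Sum>i\<in>I. f i x)"
  using assms(2,3)
  by (induction I rule: finite_induct) (auto intro: Ck_on_const Ck_on_add[OF assms(1)])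

lemma Ck_on_bilinear:
  assumes "bounded_bilinear p" "open S" "Ck_on n S f" "Ck_on n S g"
  shows "Ck_on n S (\<lambda>x. p (f x) (g x))"
  using assms(3,4)
proof (induction n arbitrary: f g)
  case 0 then show ?case by (auto intro: bounded_bilinear.continuous_on[OF assms(1)])
next
  case (Suc n)
  show ?case
  proof (rule Ck_on_SucI[OF assms(2)])
    fix x assume "x \<in> S"
    then show "((\<lambda>x. p (f x) (g x)) has_derivative
      (\<lambda>w. p (f x) (frechet_derivative g (at x) w) + p (frechet_derivative f (at x) w) (g x))) (at x)"
      using Suc.prems by (intro bounded_bilinear.FDERIV[OF assms(1)] Ck_on_Suc_has_derivative)
  next
    fix w
    \<comment> \<open>The product rule leaves one factor undifferentiated; its order is lowered from
      \<open>Suc n\<close> to \<open>n\<close> before the induction hypothesis applies.\<close>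
    show "Ck_on n S (\<lambda>x. p (f x) (frechet_derivative g (at x) w) +
      p (frechet_derivative f (at x) w) (g x))"
      using Suc.prems Ck_on_Suc_Ck_on[OF Suc.prems(1)] Ck_on_Suc_Ck_on[OF Suc.prems(2)]
      by (intro Ck_on_add[OF assms(2)] Suc.IH) auto
  qed
qed

text \<open>\<open>Ck_on\<close> tests derivatives in fixed directions only, but in the chain rule
  the outer derivative is taken in a direction that moves with the point. The expansion separates
  the two dependences into a sum of products.\<close>

lemma frechet_derivative_basis_expansion:
  assumes "f differentiable at (x :: 'a::euclidean_space)"
  shows "frechet_derivative f (at x) w = (\<Sum>b\<in>Basis. (w \<bullet> b) *\<^sub>R frechet_derivative f (at x) b)"
proof -
  interpret linear "frechet_derivative f (at x)"
    using assms by (rule linear_frechet_derivative)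
  have "frechet_derivative f (at x) (\<Sum>b\<in>Basis. (w \<bullet> b) *\<^sub>R b)
      = (\<Sum>b\<in>Basis. (w \<bullet> b) *\<^sub>R frechet_derivative f (at x) b)"
    by (simp add: sum scaleR)
  then show ?thesis by (simp add: euclidean_representation)
qed

lemma Ck_on_compose:
  fixes f :: "'a::euclidean_space \<Rightarrow> 'b::euclidean_space" and g :: "'b \<Rightarrow> 'c::real_normed_vector"
  assumes "open S" "open T" "f ` S \<subseteq> T" "Ck_on n S f" "Ck_on n T g"
  shows "Ck_on n S (\<lambda>x. g (f x))"
  using assms(4,5)
proof (induction n arbitrary: g)
  case 0 then show ?case using assms(3) by (auto intro: continuous_on_compose2)
next
  case (Suc n)
  show ?case
  proof (rule Ck_on_SucI[OF assms(1)])
    fix x assume x: "x \<in> S"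
    then have fx: "f x \<in> T" using assms(3) by auto
    have "((\<lambda>x. g (f x)) has_derivative
      (\<lambda>w. frechet_derivative g (at (f x)) (frechet_derivative f (at x) w))) (at x)"
      using x fx Suc.prems
      by (intro has_derivative_compose[of f _ x UNIV g] Ck_on_Suc_has_derivative)
    moreover have "frechet_derivative g (at (f x)) (frechet_derivative f (at x) w) =
      (\<Sum>b\<in>Basis. (frechet_derivative f (at x) w \<bullet> b) *\<^sub>R frechet_derivative g (at (f x)) b)" for w
      using fx Suc.prems by (intro frechet_derivative_basis_expansion) auto
    ultimately show "((\<lambda>x. g (f x)) has_derivative
      (\<lambda>w. \<Sum>b\<in>Basis. (frechet_derivative f (at x) w \<bullet> b) *\<^sub>R frechet_derivative g (at (f x)) b)) (at x)"
      by simp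
  next
    fix w
    have f: "Ck_on n S f" by (rule Ck_on_Suc_Ck_on) (fact Suc.prems(1))
    show "Ck_on n S (\<lambda>x. \<Sum>b\<in>Basis. (frechet_derivative f (at x) w \<bullet> b) *\<^sub>R frechet_derivative g (at (f x)) b)"
    proof (intro Ck_on_sum[OF assms(1)] Ck_on_bilinear[OF bounded_bilinear_scaleR assms(1)]
          Ck_on_bilinear[OF bounded_bilinear_inner assms(1)] Ck_on_const finite_Basis)
      show "Ck_on n S (\<lambda>x. frechet_derivative f (at x) w)" using Suc.prems(1) by simp
      show "Ck_on n S (\<lambda>x. frechet_derivative g (at (f x)) b)" for b
        using Suc.prems(2) by (intro Suc.IH f) simp
    qed
  qed
qed

text \<open>The derivative is a constant times the square of the function itself, so the induction
  feeds on its own hypothesis.\<close>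

lemma Ck_on_inverse_real: "Ck_on n (- {0::real}) inverse"
proof (induction n)
  case 0 then show ?case by (auto intro!: continuous_intros)
next
  case (Suc n)
  have o: "open (- {0::real})" by (simp add: open_Compl)
  show ?case
  proof (rule Ck_on_SucI[OF o])
    fix x :: real assume "x \<in> - {0}"
    then show "(inverse has_derivative (\<lambda>w. - (inverse x * w * inverse x))) (at x)"
      by (intro has_derivative_inverse') auto
  next
    fix w :: real
    have "Ck_on n (- {0::real}) (\<lambda>x. (- w) * (inverse x * inverse x))"
      by (intro Ck_on_bilinear[OF bounded_bilinear_mult o] Ck_on_const Suc)
    then show "Ck_on n (- {0::real}) (\<lambda>x. - (inverse x * w * inverse x))"
      by (simp add: mult_ac)
  qed
qed

subsection \<open>Smoothness on arbitrary subsets\<close>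

lemma smooth_on_subset:
  assumes "smooth_on S f" "T \<subseteq> S"
  shows "smooth_on T f"
  unfolding smooth_on_def
proof
  fix x assume "x \<in> T"
  then have "x \<in> S" using assms(2) by auto
  then obtain W g where "open W" "x \<in> W" "\<forall>n. Ck_on n W g" "\<forall>y\<in>W \<inter> S. g y = f y"
    using assms(1) unfolding smooth_on_def by blast
  then show "\<exists>W g. open W \<and> x \<in> W \<and> (\<forall>n. Ck_on n W g) \<and> (\<forall>y\<in>W \<inter> T. g y = f y)"
    using assms(2) by (intro exI[of _ W] exI[of _ g]) auto
qed

lemma smooth_on_cong: "(\<And>x. x \<in> S \<Longrightarrow> f x = g x) \<Longrightarrow> smooth_on S f \<longleftrightarrow> smooth_on S g"
  unfolding smooth_on_def by auto

lemma smooth_on_Ck_on: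
  assumes "open S" "smooth_on S f"
  shows "Ck_on n S f"
proof (rule Ck_on_local[OF assms(1)])
  fix x assume "x \<in> S"
  then obtain W g where W: "open W" "x \<in> W" "\<forall>n. Ck_on n W g" "\<forall>y\<in>W \<inter> S. g y = f y"
    using assms unfolding smooth_on_def by blast
  then have "Ck_on n (W \<inter> S) f"
    using assms(1) Ck_on_cong[of "W \<inter> S" g f n] Ck_on_subset[of n W g "W \<inter> S"] by auto
  then show "\<exists>W. open W \<and> x \<in> W \<and> Ck_on n W f"
    using W assms(1) \<open>x \<in> S\<close> by blast
qed

lemma Ck_on_smooth_on: "open S \<Longrightarrow> (\<And>n. Ck_on n S f) \<Longrightarrow> smooth_on S f"
  unfolding smooth_on_def by auto

lemma smooth_on_local:
  assumes "\<And>x. x \<in> S \<Longrightarrow> \<exists>W. open W \<and> x \<in> W \<and> smooth_on (S \<inter> W) f"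
  shows "smooth_on S f"
  unfolding smooth_on_def
proof
  fix x assume x: "x \<in> S"
  then obtain W where W: "open W" "x \<in> W" "smooth_on (S \<inter> W) f" using assms by blast
  then obtain W' g where "open W'" "x \<in> W'" "\<forall>n. Ck_on n W' g" "\<forall>y\<in>W' \<inter> (S \<inter> W). g y = f y"
    using x unfolding smooth_on_def by blast
  then show "\<exists>W g. open W \<and> x \<in> W \<and> (\<forall>n. Ck_on n W g) \<and> (\<forall>y\<in>W \<inter> S. g y = f y)"
    using W by (intro exI[of _ "W \<inter> W'"] exI[of _ g]) (auto intro: Ck_on_subset)
qed

lemma smooth_on_const: "smooth_on S (\<lambda>x. c)"
  unfolding smooth_on_def by (auto intro!: exI[of _ UNIV] exI[of _ "\<lambda>x. c"] Ck_on_const)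

lemma smooth_on_bounded_linear: "bounded_linear f \<Longrightarrow> smooth_on S f"
  by (meson Ck_on_bounded_linear Ck_on_smooth_on open_UNIV smooth_on_subset subset_UNIV)

lemma smooth_on_compose:
  assumes "smooth_on S f" "smooth_on T g" "f ` S \<subseteq> T"
  shows "smooth_on S (\<lambda>x. g (f x))"
  unfolding smooth_on_def
proof
  fix x assume x: "x \<in> S"
  obtain W f' where W: "open W" "x \<in> W" "\<forall>n. Ck_on n W f'" "\<forall>y\<in>W \<inter> S. f' y = f y"
    using assms(1) x unfolding smooth_on_def by blast
  have "f x \<in> T" using assms(3) x by auto
  then obtain V g' where V: "open V" "f x \<in> V" "\<forall>n. Ck_on n V g'" "\<forall>y\<in>V \<inter> T. g' y = g y"
    using assms(2) unfolding smooth_on_def by blast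
  \<comment> \<open>The extension of f may leave \<open>V\<close> at points outside
    \<open>S\<close>, hence the restriction to the preimage of \<open>V\<close> under the
    extension.\<close>
  let ?N = "W \<inter> f' -` V"
  have "continuous_on W f'" using W(3) by (metis Ck_on.simps(1))
  then have N: "open ?N" using W(1) V(1) by (rule continuous_open_preimage)
  show "\<exists>W g'. open W \<and> x \<in> W \<and> (\<forall>n. Ck_on n W g') \<and> (\<forall>y\<in>W \<inter> S. g' y = g (f y))"
  proof (intro exI conjI allI)
    show "Ck_on n ?N (\<lambda>x. g' (f' x))" for n
    proof (rule Ck_on_compose[OF N V(1)])
      show "f' ` ?N \<subseteq> V" by auto
      show "Ck_on n ?N f'" using W(3) Ck_on_subset[of n W f' ?N] by simp
      show "Ck_on n V g'" using V(3) by simp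
    qed
    show "\<forall>y\<in>?N \<inter> S. g' (f' y) = g (f y)" using W V assms(3) by auto
  qed (use N W V x in auto)
qed

lemma smooth_on_bilinear:
  assumes "bounded_bilinear p" "smooth_on S f" "smooth_on S g"
  shows "smooth_on S (\<lambda>x. p (f x) (g x))"
  unfolding smooth_on_def
proof
  fix x assume x: "x \<in> S"
  obtain W f' where W: "open W" "x \<in> W" "\<forall>n. Ck_on n W f'" "\<forall>y\<in>W \<inter> S. f' y = f y"
    using assms(2) x unfolding smooth_on_def by blast
  obtain V g' where V: "open V" "x \<in> V" "\<forall>n. Ck_on n V g'" "\<forall>y\<in>V \<inter> S. g' y = g y"
    using assms(3) x unfolding smooth_on_def by blast
  show "\<exists>W g'. open W \<and> x \<in> W \<and> (\<forall>n. Ck_on n W g') \<and> (\<forall>y\<in>W \<inter> S. g' y = p (f y) (g y))"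
    using W V by (intro exI[of _ "W \<inter> V"] exI[of _ "\<lambda>x. p (f' x) (g' x)"])
      (auto intro!: Ck_on_bilinear[OF assms(1)] intro: Ck_on_subset)
qed

lemma smooth_on_mult: "smooth_on S f \<Longrightarrow> smooth_on S g \<Longrightarrow> smooth_on S (\<lambda>x. f x * g x :: real)"
  by (rule smooth_on_bilinear[OF bounded_bilinear_mult])

lemma smooth_on_add:
  assumes "smooth_on S f" "smooth_on S g"
  shows "smooth_on S (\<lambda>x. f x + g x)"
  unfolding smooth_on_def
proof
  fix x assume x: "x \<in> S"
  obtain W f' where W: "open W" "x \<in> W" "\<forall>n. Ck_on n W f'" "\<forall>y\<in>W \<inter> S. f' y = f y"
    using assms(1) x unfolding smooth_on_def by blast
  obtain V g' where V: "open V" "x \<in> V" "\<forall>n. Ck_on n V g'" "\<forall>y\<in>V \<inter> S. g' y = g y"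
    using assms(2) x unfolding smooth_on_def by blast
  show "\<exists>W g'. open W \<and> x \<in> W \<and> (\<forall>n. Ck_on n W g') \<and> (\<forall>y\<in>W \<inter> S. g' y = f y + g y)"
    using W V by (intro exI[of _ "W \<inter> V"] exI[of _ "\<lambda>x. f' x + g' x"])
      (auto intro!: Ck_on_add intro: Ck_on_subset)
qed

lemma smooth_on_inverse:
  fixes f :: "'a::euclidean_space \<Rightarrow> real"
  assumes "smooth_on S f" "\<And>x. x \<in> S \<Longrightarrow> f x \<noteq> 0"
  shows "smooth_on S (\<lambda>x. inverse (f x))"
  using assms by (intro smooth_on_compose[of S f "- {0}" inverse])
    (auto intro: Ck_on_smooth_on Ck_on_inverse_real)

section \<open>Bump functions built from exp(-1/t)\<close>

subsection \<open>A smooth cutoff\<close>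

text \<open>\<open>m = 0\<close> is the classical flat function. Powers of 1/t are included because
  differentiation maps the family into combinations of its members, which makes smoothness a single
  induction over all \<open>m\<close>.\<close>

definition flat_exp :: "nat \<Rightarrow> real \<Rightarrow> real" where
  "flat_exp m t = (if t > 0 then inverse t ^ m * exp (- inverse t) else 0)"

text \<open>With s = 1/t, this is the decay of s^m / exp s at infinity.\<close>

lemma flat_exp_tendsto_0: "(flat_exp m \<longlongrightarrow> 0) (at 0)"
proof -
  have "((\<lambda>t. inverse t ^ m / exp (inverse t)) \<longlongrightarrow> 0) (at_right (0::real))"
    by (rule filterlim_compose[OF tendsto_power_div_exp_0 filterlim_inverse_at_top_right])
  then have "(flat_exp m \<longlongrightarrow> 0) (at_right 0)"
    by (rule Lim_transform_eventually)
      (auto simp: eventually_at_filter flat_exp_def exp_minus divide_inverse)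
  moreover have "(flat_exp m \<longlongrightarrow> 0) (at_left 0)"
    by (rule Lim_transform_eventually[OF tendsto_const])
      (auto simp: eventually_at_filter flat_exp_def)
  ultimately show ?thesis by (simp add: filterlim_at_split)
qed

lemma flat_exp_has_derivative:
  "(flat_exp m has_real_derivative flat_exp (m + 2) t - m * flat_exp (m + 1) t) (at t)"
proof (cases t "0 :: real" rule: linorder_cases)
  case less
  have "((\<lambda>_. 0) has_real_derivative 0) (at t)" by simp
  then have "(flat_exp m has_real_derivative 0) (at t)"
    by (rule DERIV_cong_ev[THEN iffD1, rotated -1])
      (use less in \<open>auto simp: flat_exp_def eventually_at intro!: eventually_mono[OF eventually_nhds_in_open[of "{..<0}" t]]\<close>)
  then show ?thesis using less by (simp add: flat_exp_def)
next
  case equal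
  \<comment> \<open>The difference quotient at 0 is again a member of the family,
    \<open>flat_exp (Suc m)\<close>, whose limit is known.\<close>
  have "((\<lambda>h. (flat_exp m (0 + h) - flat_exp m 0) / h) \<longlongrightarrow> 0) (at 0)"
    by (rule Lim_transform_eventually[OF flat_exp_tendsto_0[of "Suc m"]])
      (auto simp: flat_exp_def eventually_at_filter divide_inverse)
  then show ?thesis unfolding equal DERIV_def by (simp add: flat_exp_def)
next
  case greater
  have "((\<lambda>t. inverse t ^ m * exp (- inverse t)) has_real_derivative
      inverse t ^ (m + 2) * exp (- inverse t) - m * (inverse t ^ (m + 1) * exp (- inverse t))) (at t)"
    using greater
    by (cases m)
      (auto intro!: derivative_eq_intros simp: power2_eq_square algebra_simps, metis One_nat_def power_eq_if)
  then have "(flat_exp m has_real_derivative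
      inverse t ^ (m + 2) * exp (- inverse t) - m * (inverse t ^ (m + 1) * exp (- inverse t))) (at t)"
    by (rule DERIV_cong_ev[THEN iffD1, rotated -1])
      (use greater in \<open>auto simp: flat_exp_def intro!: eventually_mono[OF eventually_nhds_in_open[of "{0<..}" t]]\<close>)
  then show ?thesis using greater by (simp add: flat_exp_def)
qed

lemma Ck_on_flat_exp: "Ck_on n UNIV (flat_exp m)"
proof (induction n arbitrary: m)
  case 0
  then show ?case
    using DERIV_isCont[OF flat_exp_has_derivative] by (simp add: continuous_at_imp_continuous_on)
next
  case (Suc n)
  show ?case
  proof (rule Ck_on_SucI[OF open_UNIV])
    fix t show "(flat_exp m has_derivative (\<lambda>w. (flat_exp (m + 2) t + (- real m) * flat_exp (m + 1) t) * w)) (at t)"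
      using flat_exp_has_derivative[of m t] by (simp add: has_field_derivative_def)
  next
    fix w
    show "Ck_on n UNIV (\<lambda>t. (flat_exp (m + 2) t + (- real m) * flat_exp (m + 1) t) * w)"
      by (intro Ck_on_bilinear[OF bounded_bilinear_mult] Ck_on_add Ck_on_const Suc open_UNIV)
  qed
qed

lemma smooth_on_flat_exp: "smooth_on UNIV (flat_exp m)"
  by (simp add: Ck_on_flat_exp Ck_on_smooth_on)

lemma smooth_cutoff:
  fixes c :: "'a::euclidean_space"
  assumes "r > 0"
  obtains H :: "'a \<Rightarrow> real" where "smooth_on UNIV H"
    "\<And>x. dist c x < r \<Longrightarrow> H x = 1" "\<And>x. dist c x > 2 * r \<Longrightarrow> H x = 0"
proof -
  \<comment> \<open>\<open>q\<close> exceeds 1 inside radius r and is negative outside radius 2r.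
    The quotient \<open>H\<close> is 1 where \<open>q\<close> is at least 1 and 0 where
    \<open>q\<close> is at most 0; its denominator never vanishes, since \<open>q\<close> and 1 -
    \<open>q\<close> cannot both be nonpositive.\<close>
  define q :: "'a \<Rightarrow> real" where "q x = 2 + (- inverse (r\<^sup>2)) * ((x - c) \<bullet> (x - c))" for x
  define H where "H x = flat_exp 0 (q x) * inverse (flat_exp 0 (q x) + flat_exp 0 (1 + (- 1) * q x))" for x
  have pos: "flat_exp 0 t > 0" if "t > 0" for t using that by (simp add: flat_exp_def)
  have nonneg: "flat_exp 0 t \<ge> 0" for t by (simp add: flat_exp_def)
  have den: "flat_exp 0 t + flat_exp 0 (1 + (- 1) * t) \<noteq> 0" for t
    using pos[of t] pos[of "1 + (- 1) * t"] nonneg[of t] nonneg[of "1 + (- 1) * t"]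
    by (cases "t > 0") auto
  have lin: "smooth_on UNIV (\<lambda>x::'a. x - c)"
    using smooth_on_add[OF smooth_on_bounded_linear[OF bounded_linear_ident] smooth_on_const[of _ "- c"]]
    by simp
  have q: "smooth_on UNIV q" unfolding q_def
    by (intro smooth_on_add smooth_on_mult smooth_on_const smooth_on_bilinear[OF bounded_bilinear_inner] lin)
  have "smooth_on UNIV H" unfolding H_def
    by (intro smooth_on_mult smooth_on_inverse smooth_on_add smooth_on_const q den
        smooth_on_compose[OF _ smooth_on_flat_exp]) auto
  moreover have "H x = 1" if "dist c x < r" for x
  proof -
    have "(x - c) \<bullet> (x - c) < r\<^sup>2"
      using that assms by (simp add: dot_square_norm dist_norm norm_minus_commute power_strict_mono)
    then have "q x > 1" unfolding q_def using assms by (simp add: field_simps)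
    then show ?thesis unfolding H_def using pos[of "q x"] by (simp add: flat_exp_def)
  qed
  moreover have "H x = 0" if "dist c x > 2 * r" for x
  proof -
    have "(2 * r)\<^sup>2 < (x - c) \<bullet> (x - c)"
      unfolding dot_square_norm using that assms
      by (intro power_strict_mono) (auto simp: dist_norm norm_minus_commute)
    moreover have "(2 * r)\<^sup>2 = 4 * r\<^sup>2" by (simp add: power_mult_distrib)
    ultimately have "2 * r\<^sup>2 < (x - c) \<bullet> (x - c)" using zero_le_power2[of r] by linarith
    then have "q x < 0" unfolding q_def using assms by (simp add: field_simps)
    then show ?thesis unfolding H_def by (simp add: flat_exp_def)
  qed
  ultimately show ?thesis using that by blast
qed

section \<open>First-order Taylor expansion with smooth coefficients\<close>

subsection \<open>Hadamard's lemma\<close>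

text \<open>The powers of \<open>t\<close> absorb the inner derivative, so that the family of these integrals
  is closed under differentiation.\<close>

lemma Ck_on_ray_integral:
  fixes h :: "'a::euclidean_space \<Rightarrow> real"
  assumes "\<And>n. Ck_on n (ball a r) h"
  shows "Ck_on n (ball a r) (\<lambda>y. integral {0..1} (\<lambda>t. t ^ m * h (a + t *\<^sub>R (y - a))))"
  using assms
proof (induction n arbitrary: m h)
  have ray: "a + t *\<^sub>R (y - a) \<in> ball a r" if "y \<in> ball a r" "t \<in> {0..1}" for y and t :: real
  proof -
    have "norm (t *\<^sub>R (y - a)) \<le> norm (y - a)" using that(2) by (simp add: mult_left_le_one_le)
    then show ?thesis using that(1) by (simp add: dist_norm norm_minus_commute)
  qed
  have cont: "continuous_on (ball a r \<times> {0..1}) (\<lambda>(y, t). t ^ m * h (a + t *\<^sub>R (y - a)))"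
    if "Ck_on 0 (ball a r) h" for h :: "'a \<Rightarrow> real" and m
  proof -
    have "continuous_on (ball a r \<times> {0..1}) (\<lambda>z. h (a + snd z *\<^sub>R (fst z - a)))"
    proof (rule continuous_on_compose2[of "ball a r" h])
      show "continuous_on (ball a r) h" using that by simp
      show "continuous_on (ball a r \<times> {0..1}) (\<lambda>z. a + snd z *\<^sub>R (fst z - a))"
        by (intro continuous_intros)
      show "(\<lambda>z. a + snd z *\<^sub>R (fst z - a)) ` (ball a r \<times> {0..1}) \<subseteq> ball a r"
        by (rule image_subsetI, rule ray) (simp_all add: mem_Times_iff)
    qed
    then show ?thesis unfolding split_beta by (intro continuous_intros)
  qed
  have cont': "continuous_on {0..1} (\<lambda>t. t ^ m * h (a + t *\<^sub>R (y - a)))"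
    if "Ck_on 0 (ball a r) h" "y \<in> ball a r" for h :: "'a \<Rightarrow> real" and m y
  proof -
    have "continuous_on {0..1::real} (Pair y)" by (intro continuous_intros)
    moreover have "Pair y ` {0..1::real} \<subseteq> ball a r \<times> {0..1}" using that(2) by blast
    ultimately show ?thesis
      using continuous_on_compose2[OF cont[OF that(1), of m], of "{0..1}" "Pair y"] by simp
  qed
  {
    case 0
    show ?case
      unfolding Ck_on.simps
      using integral_continuous_on_param[of "ball a r" 0 1 "\<lambda>y t. t ^ m * h (a + t *\<^sub>R (y - a))"]
        cont[OF 0] by (simp only: cbox_interval)
  next
    case (Suc n)
    have h': "\<And>n. Ck_on n (ball a r) (\<lambda>y. frechet_derivative h (at y) w)" for w
      using Suc.prems[of "Suc n" for n] by simp
    have dh: "(h has_derivative frechet_derivative h (at y)) (at y)" if "y \<in> ball a r" for y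
      using Suc.prems[of 1] that by (intro Ck_on_Suc_has_derivative[of 0]) auto
    \<comment> \<open>\<open>leibniz_rule\<close> wants the derivative as a bounded linear map
      depending continuously on the parameters. As a combination of coordinate functionals its
      continuity reduces to that of the partial derivatives. The exponent \<open>Suc m\<close>
      contains the factor t that the inner derivative of the ray contributes.\<close>
    define D where "D y t = (\<Sum>b\<in>Basis. (t ^ Suc m * frechet_derivative h (at (a + t *\<^sub>R (y - a))) b) *\<^sub>R
        blinfun_inner_left b)" for y t
    have D: "blinfun_apply (D y t) w = t ^ m * (t * frechet_derivative h (at (a + t *\<^sub>R (y - a))) w)"
      if "y \<in> ball a r" "t \<in> {0..1}" for y t w
    proof -
      have "frechet_derivative h (at (a + t *\<^sub>R (y - a))) w =
        (\<Sum>b\<in>Basis. (w \<bullet> b) *\<^sub>R frechet_derivative h (at (a + t *\<^sub>R (y - a))) b)"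
        using dh[OF ray[OF that]] by (intro frechet_derivative_basis_expansion) (auto simp: differentiable_def)
      then show ?thesis
        by (simp add: D_def blinfun.sum_left blinfun.scaleR_left sum_distrib_left mult_ac inner_commute)
    qed
    show ?case
    proof (rule Ck_on_SucI[OF open_ball])
      fix y assume y: "y \<in> ball a r"
      have "((\<lambda>y. integral {0..1} (\<lambda>t. t ^ m * h (a + t *\<^sub>R (y - a)))) has_derivative
        integral {0..1} (D y)) (at y within ball a r)"
      proof (rule leibniz_rule[where U = "ball a r" and a = "0::real" and b = 1 and
            f = "\<lambda>y t. t ^ m * h (a + t *\<^sub>R (y - a))", unfolded cbox_interval])
        fix z and t :: real assume z: "z \<in> ball a r" and t: "t \<in> {0..1}"
        have "((\<lambda>y. t ^ m * h (a + t *\<^sub>R (y - a))) has_derivative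
          (\<lambda>w. t ^ m * (frechet_derivative h (at (a + t *\<^sub>R (z - a))) (t *\<^sub>R w)))) (at z within ball a r)"
          by (intro has_derivative_mult_right has_derivative_compose[where g = h and f = "\<lambda>y. a + t *\<^sub>R (y - a)", OF _ dh[OF ray[OF z t]]])
            (auto intro!: derivative_eq_intros)
        also have "(\<lambda>w. t ^ m * (frechet_derivative h (at (a + t *\<^sub>R (z - a))) (t *\<^sub>R w))) = blinfun_apply (D z t)"
          using D[OF z t] has_derivative_linear[OF dh[OF ray[OF z t]]] dh[OF ray[OF z t]]
          by (auto simp: fun_eq_iff linear_cmul differentiable_def)
        finally show "((\<lambda>y. t ^ m * h (a + t *\<^sub>R (y - a))) has_derivative blinfun_apply (D z t)) (at z within ball a r)" .
      next
        fix z assume z: "z \<in> ball a r"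
        have "continuous_on {0..1} (\<lambda>t. t ^ m * h (a + t *\<^sub>R (z - a)))"
          using Suc.prems z by (rule cont')
        then show "(\<lambda>t. t ^ m * h (a + t *\<^sub>R (z - a))) integrable_on {0..1}"
          by (rule integrable_continuous_real)
      next
        have "continuous_on (ball a r \<times> {0..1})
          (\<lambda>z. \<Sum>b\<in>Basis. ((case z of (y, t) \<Rightarrow> t ^ Suc m * frechet_derivative h (at (a + t *\<^sub>R (y - a))) b)) *\<^sub>R
            blinfun_inner_left b)"
          by (intro continuous_intros cont[of "\<lambda>y. frechet_derivative h (at y) b" "Suc m" for b] h')
        then show "continuous_on (ball a r \<times> {0..1}) (\<lambda>(y, t). D y t)"
          by (simp add: D_def split_beta)
      qed (use y in auto)
      moreover have "D y integrable_on {0..1}"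
      proof (rule integrable_continuous_real)
        have "continuous_on {0..1} (\<lambda>t. t ^ Suc m * frechet_derivative h (at (a + t *\<^sub>R (y - a))) b)" for b
          using h' y by (rule cont')
        then show "continuous_on {0..1} (D y)" unfolding D_def
          by (intro continuous_on_sum continuous_on_scaleR continuous_on_const)
      qed
      then have "blinfun_apply (integral {0..1} (D y)) w =
          integral {0..1} (\<lambda>t. t ^ Suc m * frechet_derivative h (at (a + t *\<^sub>R (y - a))) w)" for w
        using D[OF y, of _ w] by (auto simp: blinfun_apply_integral mult_ac intro!: integral_cong)
      then have "blinfun_apply (integral {0..1} (D y)) =
          (\<lambda>w. integral {0..1} (\<lambda>t. t ^ Suc m * frechet_derivative h (at (a + t *\<^sub>R (y - a))) w))"
        by blast
      ultimately show "((\<lambda>y. integral {0..1} (\<lambda>t. t ^ m * h (a + t *\<^sub>R (y - a)))) has_derivative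
        (\<lambda>w. integral {0..1} (\<lambda>t. t ^ Suc m * frechet_derivative h (at (a + t *\<^sub>R (y - a))) w))) (at y)"
        using y by (simp add: at_within_open[OF _ open_ball])
    qed (use Suc.IH h' in blast)
  }
qed

text \<open>Integrate the derivative of \<open>u\<close> along the ray from \<open>a\<close> to
  \<open>y\<close>. The coefficients are smooth and not merely continuous, so that a derivation can
  later be applied to them.\<close>

lemma hadamard:
  fixes u :: "'a::euclidean_space \<Rightarrow> real"
  assumes "r > 0" "\<And>n. Ck_on n (ball a r) u"
  obtains g where "\<And>b. smooth_on (ball a r) (g b)"
    "\<And>b. g b a = frechet_derivative u (at a) b"
    "\<And>y. y \<in> ball a r \<Longrightarrow> u y = u a + (\<Sum>b\<in>Basis. ((y - a) \<bullet> b) * g b y)"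
proof -
  \<comment> \<open>The trivial factor \<open>t ^ 0\<close> makes this the case \<open>m = 0\<close>
    of the ray integrals above.\<close>
  define g where "g b y = integral {0..1} (\<lambda>t. t ^ 0 * frechet_derivative u (at (a + t *\<^sub>R (y - a))) b)" for b y
  have u': "Ck_on n (ball a r) (\<lambda>y. frechet_derivative u (at y) b)" for n b
    using assms(2)[of "Suc n"] by simp
  have "smooth_on (ball a r) (g b)" for b
    unfolding g_def by (intro Ck_on_smooth_on Ck_on_ray_integral u' open_ball)
  moreover have "g b a = frechet_derivative u (at a) b" for b
    by (simp add: g_def)
  moreover have "u y = u a + (\<Sum>b\<in>Basis. ((y - a) \<bullet> b) * g b y)" if y: "y \<in> ball a r" for y
  proof -
    have ray: "a + t *\<^sub>R (y - a) \<in> ball a r" if "t \<in> {0..1}" for t :: real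
    proof -
      have "norm (t *\<^sub>R (y - a)) \<le> norm (y - a)" using that by (simp add: mult_left_le_one_le)
      then show ?thesis using y by (simp add: dist_norm norm_minus_commute)
    qed
    have du: "(u has_derivative frechet_derivative u (at z)) (at z)" if "z \<in> ball a r" for z
      using assms(2)[of 1] that by (intro Ck_on_Suc_has_derivative[of 0]) auto
    have "((\<lambda>t. u (a + t *\<^sub>R (y - a))) has_vector_derivative
        frechet_derivative u (at (a + t *\<^sub>R (y - a))) (y - a)) (at t within {0..1})" if "t \<in> {0..1}" for t
    proof -
      have "((\<lambda>t. u (a + t *\<^sub>R (y - a))) has_derivative
          (\<lambda>s. frechet_derivative u (at (a + t *\<^sub>R (y - a))) (s *\<^sub>R (y - a)))) (at t within {0..1})"
        by (intro has_derivative_compose[where g = u and f = "\<lambda>t. a + t *\<^sub>R (y - a)", OF _ du[OF ray[OF that]]]) (auto intro!: derivative_eq_intros)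
      then show ?thesis
        using has_derivative_linear[OF du[OF ray[OF that]]] du[OF ray[OF that]]
        by (simp add: has_vector_derivative_def linear_cmul differentiable_def)
    qed
    from fundamental_theorem_of_calculus[OF _ this]
    have "((\<lambda>t. frechet_derivative u (at (a + t *\<^sub>R (y - a))) (y - a)) has_integral u y - u a) {0..1}"
      by simp
    then have "u y - u a = integral {0..1} (\<lambda>t. frechet_derivative u (at (a + t *\<^sub>R (y - a))) (y - a))"
      by (simp add: integral_unique)
    also have "\<dots> = integral {0..1} (\<lambda>t. \<Sum>b\<in>Basis. ((y - a) \<bullet> b) * frechet_derivative u (at (a + t *\<^sub>R (y - a))) b)"
    proof (rule integral_cong)
      fix t :: real assume "t \<in> {0..1}"
      then show "frechet_derivative u (at (a + t *\<^sub>R (y - a))) (y - a) =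
        (\<Sum>b\<in>Basis. ((y - a) \<bullet> b) * frechet_derivative u (at (a + t *\<^sub>R (y - a))) b)"
        using frechet_derivative_basis_expansion[of u "a + t *\<^sub>R (y - a)" "y - a"] du[OF ray]
        by (auto simp: differentiable_def)
    qed
    also have "\<dots> = (\<Sum>b\<in>Basis. ((y - a) \<bullet> b) * g b y)"
    proof -
      have "continuous_on {0..1} (\<lambda>t. frechet_derivative u (at (a + t *\<^sub>R (y - a))) b)" for b
      proof (rule continuous_on_compose2[of "ball a r" "\<lambda>z. frechet_derivative u (at z) b"])
        show "continuous_on (ball a r) (\<lambda>z. frechet_derivative u (at z) b)" using u'[of 0 b] by simp
        show "continuous_on {0..1} (\<lambda>t. a + t *\<^sub>R (y - a))" by (intro continuous_intros)
        show "(\<lambda>t. a + t *\<^sub>R (y - a)) ` {0..1} \<subseteq> ball a r" by (rule image_subsetI, rule ray)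
      qed
      then show ?thesis
        by (subst integral_sum) (auto simp: g_def intro!: integrable_continuous_real continuous_intros)
    qed
    finally show ?thesis by simp
  qed
  ultimately show ?thesis using that by blast
qed

section \<open>Smooth functions, derivations and the bracket of vector fields\<close>

section \<open>Smooth functions and vector fields on a manifold\<close>

lemma sum_fun_apply: "(\<Sum>i\<in>I. f i) x = (\<Sum>i\<in>I. f i x)"
  by (induction I rule: infinite_finite_induct) auto

lemma scaleR_fun_apply: "(c *\<^sub>R f) x = c *\<^sub>R f x"
  by (simp add: scaleR_fun_def)

lemma smul_apply: "smul f s x = f x *\<^sub>R s x"
  by (simp add: smul_def)

text \<open>For maps that are linear over functions on a set \<open>S\<close> of sections only, as
  forms are on their carrier. Homogeneity is demanded just for the summands at hand.\<close>

lemma smul_linear_sum: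
  fixes T :: "('m \<Rightarrow> 'a::real_vector) \<Rightarrow> 'm \<Rightarrow> 'b::real_vector"
  assumes "finite I" "0 \<in> S" "\<And>X Y. X \<in> S \<Longrightarrow> Y \<in> S \<Longrightarrow> X + Y \<in> S"
    and "\<And>X Y. X \<in> S \<Longrightarrow> Y \<in> S \<Longrightarrow> T (X + Y) = T X + T Y"
    and "\<And>i. i \<in> I \<Longrightarrow> smul (c i) (X i) \<in> S"
    and "\<And>i. i \<in> I \<Longrightarrow> T (smul (c i) (X i)) = smul (c i) (T (X i))"
  shows "T (\<Sum>i\<in>I. smul (c i) (X i)) = (\<Sum>i\<in>I. smul (c i) (T (X i)))"
proof -
  have T0: "T 0 = 0" using assms(4)[OF assms(2,2)] by simp
  \<comment> \<open>Membership in \<open>S\<close> travels with the equation, because additivity is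
    known only there.\<close>
  have "(\<Sum>i\<in>I. smul (c i) (X i)) \<in> S \<and>
    T (\<Sum>i\<in>I. smul (c i) (X i)) = (\<Sum>i\<in>I. smul (c i) (T (X i)))"
    using assms(1,5,6)
  proof induction
    case empty
    then show ?case using T0 assms(2) by (simp only: sum.empty)
  next
    case (insert i I)
    then have IH: "(\<Sum>i\<in>I. smul (c i) (X i)) \<in> S"
      "T (\<Sum>i\<in>I. smul (c i) (X i)) = (\<Sum>i\<in>I. smul (c i) (T (X i)))" and
      i: "smul (c i) (X i) \<in> S" "T (smul (c i) (X i)) = smul (c i) (T (X i))" by auto
    show ?case
      unfolding sum.insert[OF insert.hyps] assms(4)[OF i(1) IH(1)] i(2) IH(2)
      using assms(3)[OF i(1) IH(1)] by (rule conjI) (rule refl)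
  qed
  then show ?thesis ..
qed

lemma smooth_fun_subset: "smooth_fun M W f \<Longrightarrow> W' \<subseteq> W \<Longrightarrow> smooth_fun M W' f"
  unfolding smooth_fun_def by (force elim: smooth_on_subset)

lemma smooth_fun_const: "smooth_fun M W (\<lambda>x. c)"
  unfolding smooth_fun_def comp_def by (auto intro: smooth_on_const)

lemma smooth_fun_add: "smooth_fun M W f \<Longrightarrow> smooth_fun M W g \<Longrightarrow> smooth_fun M W (\<lambda>x. f x + g x)"
  unfolding smooth_fun_def comp_def by (auto intro!: smooth_on_add)

lemma smooth_fun_mult: "smooth_fun M W f \<Longrightarrow> smooth_fun M W g \<Longrightarrow> smooth_fun M W (\<lambda>x. f x * g x)"
  unfolding smooth_fun_def comp_def by (auto intro!: smooth_on_mult)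

lemma Cinf_smooth_fun: "f \<in> Cinf M \<Longrightarrow> smooth_fun M W f"
  unfolding Cinf_def by (auto intro: smooth_fun_subset)

lemma Cinf_const [simp]: "(\<lambda>x. c) \<in> Cinf M"
  unfolding Cinf_def by (simp add: smooth_fun_const)

lemma Cinf_add: "f \<in> Cinf M \<Longrightarrow> g \<in> Cinf M \<Longrightarrow> f + g \<in> Cinf M"
  unfolding Cinf_def plus_fun_def by (simp add: smooth_fun_add)

lemma Cinf_mult: "f \<in> Cinf M \<Longrightarrow> g \<in> Cinf M \<Longrightarrow> f * g \<in> Cinf M"
  unfolding Cinf_def times_fun_def by (simp add: smooth_fun_mult)

lemma Cinf_scaleR: "f \<in> Cinf M \<Longrightarrow> c *\<^sub>R f \<in> Cinf M"
  using Cinf_mult[of "\<lambda>x. c" M f] by (simp add: times_fun_def scaleR_fun_def)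

lemma Cinf_diff: "f \<in> Cinf M \<Longrightarrow> g \<in> Cinf M \<Longrightarrow> f - g \<in> Cinf M"
  using Cinf_add[of f M "(- 1) *\<^sub>R g"] Cinf_scaleR[of g M "- 1"] by simp

lemma Cinf_zero [simp]: "0 \<in> Cinf M"
  using Cinf_const[of 0] by (simp add: zero_fun_def)

lemma Cinf_sum: "(\<And>i. i \<in> I \<Longrightarrow> f i \<in> Cinf M) \<Longrightarrow> (\<Sum>i\<in>I. f i) \<in> Cinf M"
  by (induction I rule: infinite_finite_induct) (auto intro: Cinf_add)

lemma tangent_spaceD:
  assumes "D \<in> tangent_space M p"
  shows tangent_add: "f \<in> Cinf M \<Longrightarrow> g \<in> Cinf M \<Longrightarrow> D (f + g) = D f + D g"
    and tangent_scaleR: "f \<in> Cinf M \<Longrightarrow> D (c *\<^sub>R f) = c * D f"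
    and tangent_mult: "f \<in> Cinf M \<Longrightarrow> g \<in> Cinf M \<Longrightarrow> D (f * g) = f p * D g + g p * D f"
    and tangent_nonsmooth: "f \<notin> Cinf M \<Longrightarrow> D f = 0"
  using assms unfolding tangent_space_def by auto

lemma tangent_diff:
  assumes "D \<in> tangent_space M p" "f \<in> Cinf M" "g \<in> Cinf M"
  shows "D (f - g) = D f - D g"
  using tangent_add[OF assms(1,2) Cinf_scaleR[OF assms(3), of "- 1"]]
    tangent_scaleR[OF assms(1,3), of "- 1"] by simp

lemma tangent_zero: "D \<in> tangent_space M p \<Longrightarrow> D 0 = 0"
  using tangent_scaleR[of D M p 0 0] by simp

lemma tangent_const:
  assumes "D \<in> tangent_space M p"
  shows "D (\<lambda>x. c) = 0"
proof -
  have "D ((\<lambda>x. 1) * (\<lambda>x. 1)) = 1 * D (\<lambda>x. 1) + 1 * D (\<lambda>x. 1)"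
    by (rule tangent_mult[OF assms]) auto
  then have "D (\<lambda>x. 1) = 0" by (simp add: times_fun_def)
  then show ?thesis using tangent_scaleR[OF assms, of "\<lambda>x. 1" c] by (simp add: scaleR_fun_def)
qed

lemma tangent_sum:
  assumes "D \<in> tangent_space M p" "\<And>i. i \<in> I \<Longrightarrow> f i \<in> Cinf M"
  shows "D (\<Sum>i\<in>I. f i) = (\<Sum>i\<in>I. D (f i))"
  using assms(2)
  by (induction I rule: infinite_finite_induct)
    (auto simp: tangent_zero[OF assms(1)] tangent_add[OF assms(1)] Cinf_sum)

lemma vfields_tangent: "X \<in> vfields M \<Longrightarrow> X p \<in> tangent_space M p"
  unfolding vfields_def by auto

lemmas vfields_rules =
  tangent_add[OF vfields_tangent] tangent_scaleR[OF vfields_tangent]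
  tangent_mult[OF vfields_tangent] tangent_nonsmooth[OF vfields_tangent]

text \<open>Valid for every f: on a nonsmooth one tangent vectors take the default value 0, and the
  resulting function is constant.\<close>

lemma vfields_Cinf: "X \<in> vfields M \<Longrightarrow> (\<lambda>p. X p f) \<in> Cinf M"
  by (cases "f \<in> Cinf M") (auto simp: vfields_def vfields_rules(4)[of X M])

lemma vfieldsI:
  assumes "\<And>p f g. f \<in> Cinf M \<Longrightarrow> g \<in> Cinf M \<Longrightarrow> X p (f + g) = X p f + X p g"
    and "\<And>p c f. f \<in> Cinf M \<Longrightarrow> X p (c *\<^sub>R f) = c * X p f"
    and "\<And>p f g. f \<in> Cinf M \<Longrightarrow> g \<in> Cinf M \<Longrightarrow> X p (f * g) = f p * X p g + g p * X p f"
    and "\<And>p f. f \<notin> Cinf M \<Longrightarrow> X p f = 0"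
    and "\<And>f. f \<in> Cinf M \<Longrightarrow> (\<lambda>p. X p f) \<in> Cinf M"
  shows "X \<in> vfields M"
  using assms unfolding vfields_def tangent_space_def by auto

lemma vfields_add:
  assumes "X \<in> vfields M" "Y \<in> vfields M"
  shows "X + Y \<in> vfields M"
  using Cinf_add[OF vfields_Cinf[OF assms(1)] vfields_Cinf[OF assms(2)]]
  by (intro vfieldsI)
    (simp_all add: vfields_rules[OF assms(1)] vfields_rules[OF assms(2)] algebra_simps plus_fun_def[of "\<lambda>p. X p _"])

lemma vfields_smul:
  assumes "f \<in> Cinf M" "X \<in> vfields M"
  shows "smul f X \<in> vfields M"
  using Cinf_mult[OF assms(1) vfields_Cinf[OF assms(2)]]
  by (intro vfieldsI)
    (simp_all add: smul_def scaleR_fun_apply vfields_rules[OF assms(2)] algebra_simps times_fun_def[of f])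

lemma smul_const: "smul (\<lambda>x. c) s = c *\<^sub>R s"
  by (simp add: smul_def scaleR_fun_def)

lemma vfields_scaleR: "X \<in> vfields M \<Longrightarrow> c *\<^sub>R X \<in> vfields M"
  using vfields_smul[of "\<lambda>x. c" M X] by (simp add: smul_const)

lemma vfields_zero [simp]: "0 \<in> vfields M"
  by (rule vfieldsI) auto

lemma vfields_diff: "X \<in> vfields M \<Longrightarrow> Y \<in> vfields M \<Longrightarrow> X - Y \<in> vfields M"
  using vfields_add[of X M "(- 1) *\<^sub>R Y"] vfields_scaleR[of Y M "- 1"] by simp

lemma vf_bracket_vfields:
  assumes "X \<in> vfields M" "Y \<in> vfields M"
  shows "vf_bracket X Y \<in> vfields M"
proof (rule vfieldsI)
  note t = vfields_tangent[OF assms(1)] vfields_tangent[OF assms(2)]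
  note c = vfields_Cinf[OF assms(1)] vfields_Cinf[OF assms(2)]
  fix p f g c assume f: "f \<in> Cinf M" and g: "g \<in> Cinf M"
  have add: "(\<lambda>q. Z q (f + g)) = (\<lambda>q. Z q f) + (\<lambda>q. Z q g)" if "Z \<in> vfields M" for Z
    using tangent_add[OF vfields_tangent[OF that] f g] by (simp add: plus_fun_def[of "\<lambda>q. Z q f"])
  have scaleR: "(\<lambda>q. Z q (c *\<^sub>R f)) = c *\<^sub>R (\<lambda>q. Z q f)" if "Z \<in> vfields M" for Z
    using tangent_scaleR[OF vfields_tangent[OF that] f] by (simp add: scaleR_fun_def[of c "\<lambda>q. Z q f"])
  have mult: "(\<lambda>q. Z q (f * g)) = f * (\<lambda>q. Z q g) + g * (\<lambda>q. Z q f)" if "Z \<in> vfields M" for Z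
    using tangent_mult[OF vfields_tangent[OF that] f g] by (simp add: fun_eq_iff)
  show "vf_bracket X Y p (f + g) = vf_bracket X Y p f + vf_bracket X Y p g"
    unfolding vf_bracket_def add[OF assms(1)] add[OF assms(2)]
      tangent_add[OF t(1) c(2) c(2)] tangent_add[OF t(2) c(1) c(1)] by simp
  show "vf_bracket X Y p (c *\<^sub>R f) = c * vf_bracket X Y p f"
    unfolding vf_bracket_def scaleR[OF assms(1)] scaleR[OF assms(2)]
      tangent_scaleR[OF t(1) c(2)] tangent_scaleR[OF t(2) c(1)] by (simp add: right_diff_distrib)
  show "vf_bracket X Y p (f * g) = f p * vf_bracket X Y p g + g p * vf_bracket X Y p f"
    unfolding vf_bracket_def mult[OF assms(1)] mult[OF assms(2)]
      tangent_add[OF t(1) Cinf_mult[OF f c(2)] Cinf_mult[OF g c(2)]]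
      tangent_add[OF t(2) Cinf_mult[OF f c(1)] Cinf_mult[OF g c(1)]]
      tangent_mult[OF t(1) f c(2)] tangent_mult[OF t(1) g c(2)]
      tangent_mult[OF t(2) f c(1)] tangent_mult[OF t(2) g c(1)]
    by (simp add: algebra_simps)
next
  fix p f assume "f \<notin> Cinf M"
  then show "vf_bracket X Y p f = 0"
    by (simp add: vf_bracket_def vfields_rules(4)[OF assms(1)] vfields_rules(4)[OF assms(2)]
        tangent_const[OF vfields_tangent[OF assms(1)]] tangent_const[OF vfields_tangent[OF assms(2)]])
next
  fix f
  show "(\<lambda>p. vf_bracket X Y p f) \<in> Cinf M"
    using Cinf_diff[OF vfields_Cinf[OF assms(1), of "\<lambda>q. Y q f"] vfields_Cinf[OF assms(2), of "\<lambda>q. X q f"]]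
    by (simp add: vf_bracket_def fun_diff_def)
qed

section \<open>Charts, cutoffs and tangent vectors in local coordinates\<close>

locale smooth_mfd =
  fixes M :: "('m::{t2_space,second_countable_topology}, 'e::euclidean_space) manifold"
  assumes smooth_manifold: "smooth_manifold M"
begin

lemma chart_ex: obtains U \<phi> where "(U, \<phi>) \<in> atlas M" "p \<in> U"
proof -
  have "p \<in> (\<Union>(U, \<phi>)\<in>atlas M. U)" using smooth_manifold unfolding smooth_manifold_def by auto
  then show ?thesis using that by auto
qed

lemma chartD:
  assumes "(U, \<phi>) \<in> atlas M"
  shows chart_open: "open U"
    and chart_openin: "openin (top_of_set (model M)) (\<phi> ` U)"
    and chart_homeo: "homeomorphism U (\<phi> ` U) \<phi> (inv_into U \<phi>)"
  using assms smooth_manifold unfolding smooth_manifold_def by auto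

lemma chart_inv [simp]: "(U, \<phi>) \<in> atlas M \<Longrightarrow> x \<in> U \<Longrightarrow> inv_into U \<phi> (\<phi> x) = x"
  using chart_homeo by (auto simp: homeomorphism_def)

lemma chart_transition:
  assumes "(U, \<phi>) \<in> atlas M" "(V, \<psi>) \<in> atlas M"
  shows "smooth_on (\<phi> ` (U \<inter> V)) (\<lambda>y. \<psi> (inv_into U \<phi> y))"
proof -
  have "\<forall>(U, \<phi>)\<in>atlas M. \<forall>(V, \<psi>)\<in>atlas M. smooth_on (\<phi> ` (U \<inter> V)) (\<psi> \<circ> inv_into U \<phi>)"
    using smooth_manifold unfolding smooth_manifold_def by blast
  then show ?thesis using assms by (fastforce simp: comp_def)
qed

text \<open>Charts map onto relatively open subsets of \<open>model M\<close>, so an open set of the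
  ambient Euclidean space is available only up to intersection with the model.\<close>

lemma chart_image_open:
  assumes "(U, \<phi>) \<in> atlas M" "open N"
  obtains W where "open W" "\<phi> ` (U \<inter> N) = model M \<inter> W"
proof -
  have "openin (top_of_set (\<phi> ` U)) (\<phi> ` (U \<inter> N))"
    by (rule homeomorphism_imp_open_map[OF chart_homeo[OF assms(1)]])
      (use assms(2) in \<open>auto simp: openin_open\<close>)
  then have "openin (top_of_set (model M)) (\<phi> ` (U \<inter> N))"
    using chart_openin[OF assms(1)] openin_trans by blast
  then show ?thesis using that by (auto simp: openin_open)
qed

lemma smooth_fun_cong:
  assumes "\<And>x. x \<in> W \<Longrightarrow> f x = g x" "smooth_fun M W f"
  shows "smooth_fun M W g"
  unfolding smooth_fun_def
proof clarify
  fix U \<phi> assume U: "(U, \<phi>) \<in> atlas M"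
  have "smooth_on (\<phi> ` (U \<inter> W)) (f \<circ> inv_into U \<phi>)" using assms(2) U unfolding smooth_fun_def by auto
  then show "smooth_on (\<phi> ` (U \<inter> W)) (g \<circ> inv_into U \<phi>)"
    by (rule smooth_on_cong[THEN iffD1, rotated]) (use assms(1) U in auto)
qed

lemma smooth_fun_local:
  assumes "\<And>x. x \<in> W \<Longrightarrow> \<exists>N. open N \<and> x \<in> N \<and> smooth_fun M (W \<inter> N) f"
  shows "smooth_fun M W f"
  unfolding smooth_fun_def
proof clarify
  fix U \<phi> assume U: "(U, \<phi>) \<in> atlas M"
  show "smooth_on (\<phi> ` (U \<inter> W)) (f \<circ> inv_into U \<phi>)"
  proof (rule smooth_on_local)
    fix y assume "y \<in> \<phi> ` (U \<inter> W)"
    then obtain x where x: "x \<in> U" "x \<in> W" "y = \<phi> x" by auto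
    then obtain N where N: "open N" "x \<in> N" "smooth_fun M (W \<inter> N) f" using assms by blast
    obtain O' where O': "open O'" "\<phi> ` (U \<inter> N) = model M \<inter> O'"
      using chart_image_open[OF U N(1)] .
    have "\<phi> ` (U \<inter> W) \<inter> O' \<subseteq> \<phi> ` (U \<inter> (W \<inter> N))"
    proof
      fix z assume z: "z \<in> \<phi> ` (U \<inter> W) \<inter> O'"
      then obtain w where w: "w \<in> U" "w \<in> W" "z = \<phi> w" by auto
      then have "z \<in> model M" using openin_imp_subset[OF chart_openin[OF U]] by auto
      then have "z \<in> \<phi> ` (U \<inter> N)" using O' z by auto
      then obtain w' where "w' \<in> U" "w' \<in> N" "z = \<phi> w'" by auto
      then have "w = w'" using w chart_inv[OF U] by metis
      then show "z \<in> \<phi> ` (U \<inter> (W \<inter> N))" using w \<open>w' \<in> N\<close> by auto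
    qed
    moreover have "smooth_on (\<phi> ` (U \<inter> (W \<inter> N))) (f \<circ> inv_into U \<phi>)"
      using N(3) U unfolding smooth_fun_def by auto
    ultimately have "smooth_on (\<phi> ` (U \<inter> W) \<inter> O') (f \<circ> inv_into U \<phi>)"
      by (metis smooth_on_subset)
    moreover have "y \<in> O'" using O'(2) x N(2) by auto
    ultimately show "\<exists>W'. open W' \<and> y \<in> W' \<and> smooth_on (\<phi> ` (U \<inter> W) \<inter> W') (f \<circ> inv_into U \<phi>)"
      using O'(1) by blast
  qed
qed

text \<open>Smoothness in one chart passes to all others through the transition maps.\<close>

lemma smooth_fun_chart:
  assumes U: "(U, \<phi>) \<in> atlas M" and h: "smooth_on (\<phi> ` (U \<inter> W)) h"
  shows "smooth_fun M (U \<inter> W) (\<lambda>x. h (\<phi> x))"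
  unfolding smooth_fun_def
proof clarify
  fix V \<psi> assume V: "(V, \<psi>) \<in> atlas M"
  have "smooth_on (\<psi> ` (V \<inter> (U \<inter> W))) (\<lambda>y. \<phi> (inv_into V \<psi> y))"
    by (rule smooth_on_subset[OF chart_transition[OF V U]]) auto
  from smooth_on_compose[OF this h]
  show "smooth_on (\<psi> ` (V \<inter> (U \<inter> W))) ((\<lambda>x. h (\<phi> x)) \<circ> inv_into V \<psi>)"
    using V by (force simp: comp_def)
qed

text \<open>\<open>U\<close> and the complement of \<open>C\<close> form an open cover; the product
  is smooth on the first and zero on the second.\<close>

lemma Cinf_cutoff:
  assumes "open U" "smooth_fun M U f" "\<kappa> \<in> Cinf M" "closed C" "C \<subseteq> U" "\<And>x. x \<notin> C \<Longrightarrow> \<kappa> x = 0"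
  shows "(\<lambda>x. \<kappa> x * f x) \<in> Cinf M"
  unfolding Cinf_def mem_Collect_eq
proof (rule smooth_fun_local)
  fix x
  show "\<exists>N. open N \<and> x \<in> N \<and> smooth_fun M (UNIV \<inter> N) (\<lambda>x. \<kappa> x * f x)"
  proof (cases "x \<in> U")
    case True
    have "smooth_fun M U (\<lambda>x. \<kappa> x * f x)"
      by (intro smooth_fun_mult assms(2) Cinf_smooth_fun[OF assms(3)])
    then show ?thesis using True assms(1) by (intro exI[of _ U]) auto
  next
    case False
    have "smooth_fun M (- C) (\<lambda>x. \<kappa> x * f x)"
      by (rule smooth_fun_cong[OF _ smooth_fun_const[of _ _ 0]]) (use assms(6) in auto)
    then show ?thesis using False assms(4,5) by (intro exI[of _ "- C"]) auto
  qed
qed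

text \<open>\<open>C\<close> plays the part of the support: as it is a closed subset of
  \<open>N\<close>, objects defined on \<open>N\<close> can be multiplied by \<open>\<kappa>\<close>
  and extended by zero.\<close>

lemma bump:
  assumes "open N" "p \<in> N"
  obtains \<kappa> C N' where "\<kappa> \<in> Cinf M" "closed C" "C \<subseteq> N" "\<And>x. x \<notin> C \<Longrightarrow> \<kappa> x = 0"
    "open N'" "p \<in> N'" "N' \<subseteq> N" "\<And>x. x \<in> N' \<Longrightarrow> \<kappa> x = 1"
proof -
  obtain U \<phi> where U: "(U, \<phi>) \<in> atlas M" "p \<in> U" by (rule chart_ex)
  obtain W where W: "open W" "\<phi> ` (U \<inter> N) = model M \<inter> W" using chart_image_open[OF U(1) assms(1)] .
  have "\<phi> p \<in> W" using W(2) U(2) assms(2) by auto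
  then obtain s where s: "s > 0" "ball (\<phi> p) s \<subseteq> W" using W(1) by (meson open_contains_ball)
  \<comment> \<open>A third of \<open>s\<close>, so that the closed ball of radius 2r lies in the
    open ball of radius \<open>s\<close>.\<close>
  define r where "r = s / 3"
  have r: "r > 0" "2 * r < s" using s(1) by (auto simp: r_def)
  obtain H where H: "smooth_on UNIV H" "\<And>x. dist (\<phi> p) x < r \<Longrightarrow> H x = 1"
    "\<And>x. dist (\<phi> p) x > 2 * r \<Longrightarrow> H x = (0::real)" using smooth_cutoff[OF r(1), of "\<phi> p"] by metis
  define B where "B = model M \<inter> cball (\<phi> p) (2 * r)"
  have "subspace (model M)" using smooth_manifold unfolding smooth_manifold_def by auto
  then have "compact B" unfolding B_def by (intro closed_Int_compact closed_subspace compact_cball)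
  moreover have BU: "B \<subseteq> \<phi> ` (U \<inter> N)" using W(2) s(2) r by (force simp: B_def)
  have cont: "continuous_on (\<phi> ` U) (inv_into U \<phi>)" "continuous_on U \<phi>"
    using chart_homeo[OF U(1)] by (auto simp: homeomorphism_def)
  ultimately have "compact (inv_into U \<phi> ` B)"
    by (intro compact_continuous_image) (rule continuous_on_subset[OF cont(1)], use BU in auto)
  \<comment> \<open>Closedness in the manifold, and not only in the chart domain, comes from
    compactness and the Hausdorff property. It is what makes the extension by zero smooth across the
    boundary of the chart.\<close>
  then have C: "closed (inv_into U \<phi> ` B)" by (rule compact_imp_closed)
  have CN: "inv_into U \<phi> ` B \<subseteq> U \<inter> N"
  proof
    fix x assume "x \<in> inv_into U \<phi> ` B"
    then obtain y where "y \<in> U \<inter> N" "x = inv_into U \<phi> (\<phi> y)" using BU by blast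
    then show "x \<in> U \<inter> N" using U(1) by auto
  qed
  define \<kappa> where "\<kappa> x = (if x \<in> U then H (\<phi> x) else 0)" for x
  have zero: "\<kappa> x = 0" if "x \<notin> inv_into U \<phi> ` B" for x
  proof (cases "x \<in> U")
    case True
    have "\<phi> x \<in> model M" using True openin_imp_subset[OF chart_openin[OF U(1)]] by auto
    moreover have "\<phi> x \<notin> B" using that True U(1) by (metis chart_inv imageI)
    ultimately have "dist (\<phi> p) (\<phi> x) > 2 * r" by (auto simp: B_def)
    then show ?thesis using H(3) by (simp add: \<kappa>_def)
  qed (simp add: \<kappa>_def)
  have "smooth_fun M (U \<inter> UNIV) (\<lambda>x. H (\<phi> x))"
    by (rule smooth_fun_chart[OF U(1)]) (rule smooth_on_subset[OF H(1)], simp)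
  then have "smooth_fun M U (\<lambda>x. H (\<phi> x))" by simp
  then have sm: "smooth_fun M U \<kappa>"
    by (rule smooth_fun_cong[rotated]) (simp add: \<kappa>_def)
  have "\<kappa> \<in> Cinf M"
    unfolding Cinf_def mem_Collect_eq
  proof (rule smooth_fun_local)
    fix x
    show "\<exists>N. open N \<and> x \<in> N \<and> smooth_fun M (UNIV \<inter> N) \<kappa>"
    proof (cases "x \<in> U")
      case True
      then show ?thesis using sm chart_open[OF U(1)] by (intro exI[of _ U]) auto
    next
      case False
      have "smooth_fun M (- inv_into U \<phi> ` B) \<kappa>"
        by (rule smooth_fun_cong[OF _ smooth_fun_const[of _ _ 0]]) (use zero in auto)
      then show ?thesis using False C CN by (intro exI[of _ "- inv_into U \<phi> ` B"]) auto
    qed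
  qed
  moreover define N' where "N' = N \<inter> (U \<inter> \<phi> -` ball (\<phi> p) r)"
  have "open N'" unfolding N'_def
    by (intro open_Int assms(1) continuous_open_preimage[OF cont(2)] chart_open[OF U(1)] open_ball)
  moreover have "p \<in> N'" using U(2) assms(2) r(1) by (simp add: N'_def)
  moreover have "\<kappa> x = 1" if "x \<in> N'" for x using that H(2) by (auto simp: N'_def \<kappa>_def)
  moreover have "N' \<subseteq> N" by (auto simp: N'_def)
  ultimately show ?thesis using that[of \<kappa> "inv_into U \<phi> ` B" N'] C CN zero by blast
qed

text \<open>Leibniz on \<open>\<kappa> * (f - g) = 0\<close> with \<open>\<kappa> p = 1\<close>; the
  other term drops out because f and g agree at p.\<close>

lemma tangent_local:
  assumes D: "D \<in> tangent_space M p" and "f \<in> Cinf M" "g \<in> Cinf M"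
    and "open N" "p \<in> N" "\<And>x. x \<in> N \<Longrightarrow> f x = g x"
  shows "D f = D g"
proof -
  obtain \<kappa> C N' where \<kappa>: "\<kappa> \<in> Cinf M" "C \<subseteq> N" "\<And>x. x \<notin> C \<Longrightarrow> \<kappa> x = 0" "p \<in> N'"
    "\<And>x. x \<in> N' \<Longrightarrow> \<kappa> x = 1" using bump[OF assms(4,5)] by metis
  have fg: "f - g \<in> Cinf M" using assms(2,3) by (rule Cinf_diff)
  have "\<kappa> * (f - g) = 0" using \<kappa>(2,3) assms(6) by (fastforce simp: fun_eq_iff)
  then have "D (\<kappa> * (f - g)) = 0" using tangent_zero[OF D] by simp
  then have "\<kappa> p * D (f - g) + (f - g) p * D \<kappa> = 0" using tangent_mult[OF D \<kappa>(1) fg] by simp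
  then have "D (f - g) = 0" using \<kappa>(4,5) assms(5,6) by simp
  then show ?thesis using tangent_diff[OF D assms(2,3)] by simp
qed

text \<open>A smooth function on a chart is made a function on an open subset of the Euclidean space
  by composition with a linear projection onto the model space.\<close>

lemma chart_flat:
  assumes U: "(U, \<phi>) \<in> atlas M"
  obtains P S where "open S" "\<And>x. x \<in> U \<Longrightarrow> \<phi> x \<in> S" "\<And>x. x \<in> U \<Longrightarrow> P (\<phi> x) = \<phi> x"
    "\<And>f n. f \<in> Cinf M \<Longrightarrow> Ck_on n S (\<lambda>y. f (inv_into U \<phi> (P y)))"
proof -
  have sub: "subspace (model M)" using smooth_manifold unfolding smooth_manifold_def by auto
  obtain P where P: "range P \<subseteq> model M" "linear P" "\<And>y. y \<in> model M \<Longrightarrow> P y = y"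
    using linear_exists_left_inverse_on[OF linear_id sub inj_on_id] by auto
  have bl: "bounded_linear P" using P(2) by (simp add: linear_conv_bounded_linear)
  obtain W where W: "open W" "\<phi> ` (U \<inter> UNIV) = model M \<inter> W" using chart_image_open[OF U open_UNIV] .
  have cont: "continuous_on UNIV P" using bl by (rule linear_continuous_on)
  have S: "open (P -` W)" using W(1) cont by (simp add: open_vimage)
  have in_model: "\<phi> x \<in> model M \<inter> W" if "x \<in> U" for x using W(2) that by auto
  have "Ck_on n (P -` W) (\<lambda>y. f (inv_into U \<phi> (P y)))" if "f \<in> Cinf M" for f n
  proof (rule smooth_on_Ck_on[OF S], rule smooth_on_compose[OF smooth_on_bounded_linear[OF bl]])
    show "smooth_on (\<phi> ` (U \<inter> UNIV)) (\<lambda>y. f (inv_into U \<phi> y))"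
      using that U unfolding Cinf_def smooth_fun_def comp_def by auto
    show "P ` (P -` W) \<subseteq> \<phi> ` (U \<inter> UNIV)" unfolding W(2) using P(1) by auto
  qed
  then show ?thesis using that[of "P -` W" P] S in_model P(3) by auto
qed

text \<open>Hadamard's lemma writes f near q as a constant plus products of functions vanishing at q
  with smooth coefficients; the Leibniz rule then retains only the values of the coefficients at q.
  The chart data, \<open>N\<close> and the global coordinate functions \<open>x\<close> are
  hypotheses rather than choices, so that one choice serves all q in \<open>N\<close>.\<close>

lemma tangent_expansion:
  assumes U: "(U, \<phi>) \<in> atlas M" and S: "open S" "\<And>x. x \<in> U \<Longrightarrow> \<phi> x \<in> S" "\<And>x. x \<in> U \<Longrightarrow> P (\<phi> x) = \<phi> x"
    "\<And>f n. f \<in> Cinf M \<Longrightarrow> Ck_on n S (\<lambda>y. f (inv_into U \<phi> (P y)))"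
    and N: "open N" "N \<subseteq> U" "q \<in> N" and x: "\<And>b. x b \<in> Cinf M" "\<And>b z. z \<in> N \<Longrightarrow> x b z = \<phi> z \<bullet> b"
    and D: "D \<in> tangent_space M q" and f: "f \<in> Cinf M"
  shows "D f = (\<Sum>b\<in>Basis. D (x b) * frechet_derivative (\<lambda>y. f (inv_into U \<phi> (P y))) (at (\<phi> q)) b)"
proof -
  let ?u = "\<lambda>y. f (inv_into U \<phi> (P y))"
  have qU: "q \<in> U" using N by auto
  obtain r where r: "r > 0" "ball (\<phi> q) r \<subseteq> S" using S(1,2) qU by (meson open_contains_ball)
  obtain g where g: "\<And>b. smooth_on (ball (\<phi> q) r) (g b)"
    "\<And>b. g b (\<phi> q) = frechet_derivative ?u (at (\<phi> q)) b"
    "\<And>y. y \<in> ball (\<phi> q) r \<Longrightarrow> ?u y = ?u (\<phi> q) + (\<Sum>b\<in>Basis. ((y - \<phi> q) \<bullet> b) * g b y)"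
    using hadamard[OF r(1) Ck_on_subset[OF S(4)[OF f] r(2)]] by blast
  have cont: "continuous_on U \<phi>" using chart_homeo[OF U(1)] by (auto simp: homeomorphism_def)
  define V where "V = N \<inter> (U \<inter> \<phi> -` ball (\<phi> q) r)"
  have V: "open V" "q \<in> V" unfolding V_def
    by (intro open_Int N(1) continuous_open_preimage[OF cont] chart_open[OF U(1)] open_ball)
      (use N(3) qU r(1) in auto)
  obtain \<kappa> C N' where \<kappa>: "\<kappa> \<in> Cinf M" "closed C" "C \<subseteq> V" "\<And>x. x \<notin> C \<Longrightarrow> \<kappa> x = 0"
    "open N'" "q \<in> N'" "N' \<subseteq> V" "\<And>x. x \<in> N' \<Longrightarrow> \<kappa> x = 1" using bump[OF V] by metis
  \<comment> \<open>The Hadamard coefficients exist only near q. Cut off, they become global smooth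
    functions, and \<open>tangent_local\<close> shows that the derivation does not notice the
    change.\<close>
  define G where "G b = (\<lambda>z. \<kappa> z * g b (\<phi> z))" for b
  have "smooth_fun M (U \<inter> V) (\<lambda>z. g b (\<phi> z))" for b
    by (rule smooth_fun_chart[OF U]) (rule smooth_on_subset[OF g(1)], auto simp: V_def)
  moreover have "U \<inter> V = V" by (auto simp: V_def)
  ultimately have G: "G b \<in> Cinf M" for b
    unfolding G_def using \<kappa> V(1) by (intro Cinf_cutoff[of V]) auto
  define y where "y b = x b - (\<lambda>_. x b q)" for b
  have y: "y b \<in> Cinf M" "D (y b) = D (x b)" "y b q = 0" for b
    unfolding y_def using x(1) tangent_diff[OF D x(1) Cinf_const] tangent_const[OF D]
    by (auto intro: Cinf_diff)
  have eq: "f z = ((\<lambda>_. f q) + (\<Sum>b\<in>Basis. y b * G b)) z" if "z \<in> N'" for z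
  proof -
    have z: "z \<in> V" "z \<in> U" "z \<in> N" "\<phi> z \<in> ball (\<phi> q) r" using that \<kappa>(7) by (auto simp: V_def)
    have "f z = f q + (\<Sum>b\<in>Basis. ((\<phi> z - \<phi> q) \<bullet> b) * g b (\<phi> z))"
      using g(3)[OF z(4)] S(3) z(2) qU U by simp
    also have "\<dots> = f q + (\<Sum>b\<in>Basis. y b z * G b z)"
      using z(3) N(3) \<kappa>(8)[OF that] by (simp add: y_def G_def x(2) inner_diff_left)
    finally show ?thesis by (simp add: sum_fun_apply)
  qed
  have yG: "y b * G b \<in> Cinf M" for b by (intro Cinf_mult y G)
  have "D f = D ((\<lambda>_. f q) + (\<Sum>b\<in>Basis. y b * G b))"
    by (rule tangent_local[OF D f _ \<kappa>(5,6) eq]) (intro Cinf_add Cinf_sum yG Cinf_const)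
  also have "\<dots> = (\<Sum>b\<in>Basis. D (y b * G b))"
    by (subst tangent_add[OF D]) (auto simp: tangent_const[OF D] tangent_sum[OF D] yG intro: Cinf_sum)
  also have "\<dots> = (\<Sum>b\<in>Basis. D (x b) * g b (\<phi> q))"
    unfolding tangent_mult[OF D y(1) G] y(2,3) using \<kappa>(6,8) by (simp add: G_def mult.commute)
  finally show ?thesis by (simp add: g(2))
qed

text \<open>\<open>T\<close> sees only global fields, so the coordinate expansion of X is multiplied
  by a cutoff until it holds on the whole manifold. Its coefficients are values of X on coordinate
  functions and hence vanish at p.\<close>

lemma vfields_tensorial:
  fixes T :: "'m vfield \<Rightarrow> 'm \<Rightarrow> 'v::real_vector"
  assumes add: "\<And>X Y. X \<in> vfields M \<Longrightarrow> Y \<in> vfields M \<Longrightarrow> T (X + Y) = T X + T Y"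
    and smul: "\<And>f X. f \<in> Cinf M \<Longrightarrow> X \<in> vfields M \<Longrightarrow> T (smul f X) = smul f (T X)"
    and X: "X \<in> vfields M" "X p = 0"
  shows "T X p = 0"
proof -
  obtain U \<phi> where U: "(U, \<phi>) \<in> atlas M" "p \<in> U" by (rule chart_ex)
  obtain P S where S: "open S" "\<And>x. x \<in> U \<Longrightarrow> \<phi> x \<in> S" "\<And>x. x \<in> U \<Longrightarrow> P (\<phi> x) = \<phi> x"
    "\<And>f n. f \<in> Cinf M \<Longrightarrow> Ck_on n S (\<lambda>y. f (inv_into U \<phi> (P y)))"
    using chart_flat[OF U(1)] by metis
  obtain \<kappa> C N where \<kappa>: "\<kappa> \<in> Cinf M" "closed C" "C \<subseteq> U" "\<And>x. x \<notin> C \<Longrightarrow> \<kappa> x = 0"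
    "open N" "p \<in> N" "N \<subseteq> U" "\<And>x. x \<in> N \<Longrightarrow> \<kappa> x = 1"
    using bump[OF chart_open[OF U(1)] U(2)] by metis
  \<comment> \<open>Nested cutoffs: \<open>\<theta>\<close> lives inside \<open>N\<close>, where
    \<open>\<kappa>\<close> is 1, so that the global fields \<open>E b\<close> are the true
    coordinate derivatives wherever \<open>\<theta>\<close> is nonzero.\<close>
  obtain \<theta> C' N' where \<theta>: "\<theta> \<in> Cinf M" "C' \<subseteq> N" "\<And>x. x \<notin> C' \<Longrightarrow> \<theta> x = 0" "p \<in> N'"
    "\<And>x. x \<in> N' \<Longrightarrow> \<theta> x = 1"
    using bump[OF \<kappa>(5,6)] by metis
  let ?u = "\<lambda>f y. f (inv_into U \<phi> (P y))"
  have cutoff: "(\<lambda>z. \<kappa> z * h (\<phi> z)) \<in> Cinf M" if "smooth_on S h" for h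
  proof (rule Cinf_cutoff[OF chart_open[OF U(1)] _ \<kappa>(1-4)])
    have "smooth_fun M (U \<inter> UNIV) (\<lambda>z. h (\<phi> z))"
      by (rule smooth_fun_chart[OF U(1)]) (rule smooth_on_subset[OF that], use S(2) in auto)
    then show "smooth_fun M U (\<lambda>z. h (\<phi> z))" by simp
  qed
  have kU: "\<kappa> z = 0" if "z \<notin> U" for z using \<kappa>(3,4) that by auto
  define x where "x b = (\<lambda>z. \<kappa> z * (\<phi> z \<bullet> b))" for b
  have x: "x b \<in> Cinf M" for b
    unfolding x_def by (intro cutoff smooth_on_bounded_linear bounded_linear_inner_left)
  have x_N: "x b z = \<phi> z \<bullet> b" if "z \<in> N" for b z using that by (simp add: x_def \<kappa>(8))
  \<comment> \<open>The direction b need not be tangent to the model: \<open>?u f\<close> is smooth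
    on an open set of the ambient space, so its derivative along b makes sense. The fields
    \<open>E b\<close> may be linearly dependent; only spanning matters.\<close>
  define E where "E b z f = (if f \<in> Cinf M then \<kappa> z * frechet_derivative (?u f) (at (\<phi> z)) b else 0)" for b z f
  have der: "(?u f has_derivative frechet_derivative (?u f) (at (\<phi> z))) (at (\<phi> z))"
    if "f \<in> Cinf M" "z \<in> U" for f z
    using S(2)[OF that(2)] S(4)[OF that(1), of 1] by (intro Ck_on_Suc_has_derivative[of 0]) auto
  have u_z: "?u f (\<phi> z) = f z" if "z \<in> U" for f :: "'m \<Rightarrow> real" and z using that S(3) U(1) by simp
  have E: "E b \<in> vfields M" for b
  proof (rule vfieldsI)
    fix z f g c assume f: "f \<in> Cinf M" and g: "g \<in> Cinf M"
    show "E b z (f + g) = E b z f + E b z g"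
    proof (cases "z \<in> U")
      case True
      have "(?u (f + g) has_derivative (\<lambda>w. frechet_derivative (?u f) (at (\<phi> z)) w +
          frechet_derivative (?u g) (at (\<phi> z)) w)) (at (\<phi> z))"
        using has_derivative_add[OF der[OF f True] der[OF g True]] by simp
      then show ?thesis
        using f g by (simp add: E_def Cinf_add frechet_derivative_at[symmetric] algebra_simps)
    qed (use kU[of z] in \<open>simp add: E_def\<close>)
    show "E b z (c *\<^sub>R f) = c * E b z f"
    proof (cases "z \<in> U")
      case True
      have "(?u (c *\<^sub>R f) has_derivative (\<lambda>w. c * frechet_derivative (?u f) (at (\<phi> z)) w)) (at (\<phi> z))"
        using has_derivative_mult_right[OF der[OF f True], of c] by (simp add: scaleR_fun_def)
      then show ?thesis
        using f by (simp add: E_def Cinf_scaleR frechet_derivative_at[symmetric])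
    qed (use kU[of z] in \<open>simp add: E_def\<close>)
    show "E b z (f * g) = f z * E b z g + g z * E b z f"
    proof (cases "z \<in> U")
      case True
      have "(?u (f * g) has_derivative (\<lambda>w. f z * frechet_derivative (?u g) (at (\<phi> z)) w +
          frechet_derivative (?u f) (at (\<phi> z)) w * g z)) (at (\<phi> z))"
        using has_derivative_mult[OF der[OF f True] der[OF g True]] by (simp add: u_z[OF True])
      then show ?thesis
        using f g by (simp add: E_def Cinf_mult frechet_derivative_at[symmetric] algebra_simps)
    qed (use kU[of z] in \<open>simp add: E_def\<close>)
  next
    fix f assume f: "f \<in> Cinf M"
    have "smooth_on S (\<lambda>y. frechet_derivative (?u f) (at y) b)"
      using S(4)[OF f, of "Suc n" for n] by (intro Ck_on_smooth_on S(1)) simp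
    then show "(\<lambda>z. E b z f) \<in> Cinf M" using cutoff f by (simp add: E_def)
  qed (simp add: E_def)
  define c where "c b = \<theta> * (\<lambda>z. X z (x b))" for b
  have c: "c b \<in> Cinf M" for b unfolding c_def by (intro Cinf_mult \<theta>(1) vfields_Cinf X(1))
  have "smul \<theta> X z f = (\<Sum>b\<in>Basis. smul (c b) (E b)) z f" for z f
  proof (cases "z \<in> N \<and> f \<in> Cinf M")
    case True
    then have "X z f = (\<Sum>b\<in>Basis. X z (x b) * frechet_derivative (?u f) (at (\<phi> z)) b)"
      by (intro tangent_expansion[OF U(1) S \<kappa>(5,7) _ x x_N vfields_tangent[OF X(1)]]) auto
    then show ?thesis
      using True by (simp add: sum_fun_apply smul_def scaleR_fun_def E_def c_def \<kappa>(8) sum_distrib_left mult.assoc)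
  next
    case False
    then have "\<theta> z = 0 \<or> f \<notin> Cinf M" using \<theta>(2,3) by auto
    then show ?thesis
      using tangent_nonsmooth[OF vfields_tangent[OF X(1)]]
      by (auto simp: sum_fun_apply smul_def scaleR_fun_def E_def c_def)
  qed
  then have exp: "smul \<theta> X = (\<Sum>b\<in>Basis. smul (c b) (E b))" by (intro ext)
  have "T (\<Sum>b\<in>Basis. smul (c b) (E b)) = (\<Sum>b\<in>Basis. smul (c b) (T (E b)))"
    by (rule smul_linear_sum[where S = "vfields M"]) (simp_all only: finite_Basis vfields_zero vfields_add add vfields_smul c E smul)
  then have "T (smul \<theta> X) = (\<Sum>b\<in>Basis. smul (c b) (T (E b)))" by (simp add: exp)
  then have "smul \<theta> (T X) p = (\<Sum>b\<in>Basis. smul (c b) (T (E b)) p)"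
    by (simp add: smul \<theta>(1) X(1) sum_fun_apply)
  then show ?thesis using \<theta>(4,5) X(2) by (simp add: smul_def c_def)
qed

end

section \<open>Frames, extension of local sections and tensoriality\<close>

section \<open>Sections of a vector bundle\<close>

lemma set_frame_values: "set (map (\<lambda>e. e x) es) = (\<lambda>i. (es ! i) x) ` {..<length es}"
  by (force simp: in_set_conv_nth)

lemma frame_on_inj_on:
  assumes "frame_on V F es" "x \<in> V"
  shows "inj_on (\<lambda>i. (es ! i) x) {..<length es}"
proof -
  have "distinct (map (\<lambda>e. e x) es)" using assms unfolding frame_on_def by auto
  then show ?thesis by (auto simp: inj_on_def distinct_conv_nth)
qed

lemma frame_on_unique:
  assumes "frame_on V F es" "x \<in> V"
    and "(\<Sum>i<length es. a i *\<^sub>R (es ! i) x) = (\<Sum>i<length es. b i *\<^sub>R (es ! i) x)"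
    and "i < length es"
  shows "a i = b i"
proof -
  define e where "e j = (es ! j) x" for j
  have ind: "independent (set (map (\<lambda>e. e x) es))"
    using assms(1,2) unfolding frame_on_def by auto
  have inj: "inj_on e {..<length es}"
    using frame_on_inj_on[OF assms(1,2)] unfolding e_def .
  have set: "set (map (\<lambda>e. e x) es) = e ` {..<length es}"
    unfolding set_frame_values e_def ..
  \<comment> \<open>Independence speaks of coefficients indexed by vectors, so the coefficients
    indexed by position are moved along the bijection \<open>e\<close>.\<close>
  define u where "u w = a (inv_into {..<length es} e w) - b (inv_into {..<length es} e w)" for w
  have "(\<Sum>w\<in>e ` {..<length es}. u w *\<^sub>R w) = (\<Sum>j<length es. (a j - b j) *\<^sub>R e j)"
    by (subst sum.reindex[OF inj]) (auto simp: u_def inv_into_f_f[OF inj])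
  also have "\<dots> = 0"
    using assms(3) by (simp add: e_def scaleR_left_diff_distrib sum_subtractf)
  finally have "u (e i) = 0"
    using independentD[OF ind[unfolded set], of "e ` {..<length es}" u "e i"] assms(4) by auto
  then show ?thesis using assms(4) by (simp add: u_def inv_into_f_f[OF inj])
qed

lemma local_sectionsD:
  assumes "s \<in> local_sections M E U" "(V, es) \<in> frames E"
  obtains c where "\<And>i. i < length es \<Longrightarrow> smooth_fun M (U \<inter> V) (c i)"
    "\<And>x. x \<in> U \<Longrightarrow> x \<in> V \<Longrightarrow> s x = (\<Sum>i<length es. c i x *\<^sub>R (es ! i) x)"
proof -
  have "\<exists>c. (\<forall>i<length es. smooth_fun M (U \<inter> V) (c i)) \<and>
      (\<forall>x\<in>U \<inter> V. s x = (\<Sum>i<length es. c i x *\<^sub>R (es ! i) x))"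
    using assms unfolding local_sections_def by fast
  then show ?thesis using that by blast
qed

lemma local_sectionsI:
  assumes "\<And>x. x \<in> U \<Longrightarrow> s x \<in> fib E x"
    and "\<And>V es. (V, es) \<in> frames E \<Longrightarrow> \<exists>c. (\<forall>i<length es. smooth_fun M (U \<inter> V) (c i)) \<and>
      (\<forall>x\<in>U \<inter> V. s x = (\<Sum>i<length es. c i x *\<^sub>R (es ! i) x))"
  shows "s \<in> local_sections M E U"
  unfolding local_sections_def using assms by fast

lemma local_sections_fib: "s \<in> local_sections M E U \<Longrightarrow> x \<in> U \<Longrightarrow> s x \<in> fib E x"
  unfolding local_sections_def by auto

lemma local_sections_subset:
  assumes "s \<in> local_sections M E U" "U' \<subseteq> U"
  shows "s \<in> local_sections M E U'"
proof (rule local_sectionsI)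
  fix V es assume V: "(V, es) \<in> frames E"
  obtain c where c: "\<And>i. i < length es \<Longrightarrow> smooth_fun M (U \<inter> V) (c i)"
    "\<And>x. x \<in> U \<Longrightarrow> x \<in> V \<Longrightarrow> s x = (\<Sum>i<length es. c i x *\<^sub>R (es ! i) x)"
    by (rule local_sectionsD[OF assms(1) V]) blast
  have "smooth_fun M (U' \<inter> V) (c i)" if "i < length es" for i
    by (rule smooth_fun_subset[OF c(1)[OF that]]) (use assms(2) in auto)
  then show "\<exists>c. (\<forall>i<length es. smooth_fun M (U' \<inter> V) (c i)) \<and>
      (\<forall>x\<in>U' \<inter> V. s x = (\<Sum>i<length es. c i x *\<^sub>R (es ! i) x))"
    using c(2) assms(2) by (intro exI[of _ c]) auto
qed (use local_sections_fib[OF assms(1)] assms(2) in auto)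

lemma local_sections_cong:
  assumes "s \<in> local_sections M E U" "\<And>x. x \<in> U \<Longrightarrow> s x = t x"
  shows "t \<in> local_sections M E U"
proof (rule local_sectionsI)
  fix V es assume V: "(V, es) \<in> frames E"
  obtain c where c: "\<And>i. i < length es \<Longrightarrow> smooth_fun M (U \<inter> V) (c i)"
    "\<And>x. x \<in> U \<Longrightarrow> x \<in> V \<Longrightarrow> s x = (\<Sum>i<length es. c i x *\<^sub>R (es ! i) x)"
    by (rule local_sectionsD[OF assms(1) V]) blast
  then show "\<exists>c. (\<forall>i<length es. smooth_fun M (U \<inter> V) (c i)) \<and>
      (\<forall>x\<in>U \<inter> V. t x = (\<Sum>i<length es. c i x *\<^sub>R (es ! i) x))"
    using assms(2) by (intro exI[of _ c]) auto
qed (use local_sections_fib[OF assms(1)] assms(2) in force)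

locale smooth_bundle = smooth_mfd M
  for M :: "('m::{t2_space,second_countable_topology}, 'e::euclidean_space) manifold" +
  fixes E :: "('m, 'v::real_vector, 'z) vbundle_scheme"
  assumes vector_bundle: "vector_bundle M E"
begin

lemma frame_ex:
  obtains V es where "(V, es) \<in> frames E" "x \<in> V"
proof -
  have "x \<in> (\<Union>(U, es)\<in>frames E. U)" using vector_bundle unfolding vector_bundle_def by auto
  then show ?thesis using that by auto
qed

lemma frameD:
  assumes "(V, es) \<in> frames E"
  shows frame_open: "open V" and frame_frame_on: "frame_on V (fib E) es"
    and frame_local_sections: "i < length es \<Longrightarrow> es ! i \<in> local_sections M E V"
proof -
  have *: "open V \<and> frame_on V (fib E) es \<and> set es \<subseteq> local_sections M E V"
    using assms vector_bundle unfolding vector_bundle_def by fast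
  then show "open V" "frame_on V (fib E) es" by auto
  show "es ! i \<in> local_sections M E V" if "i < length es"
    using * that nth_mem by blast
qed

lemma subspace_fib: "subspace (fib E x)"
proof -
  obtain V es where "(V, es) \<in> frames E" "x \<in> V" by (rule frame_ex)
  then have "span (set (map (\<lambda>e. e x) es)) = fib E x"
    using frame_frame_on unfolding frame_on_def by blast
  then show ?thesis by (metis subspace_span)
qed

lemma local_sections_add:
  assumes "s \<in> local_sections M E U" "t \<in> local_sections M E U"
  shows "s + t \<in> local_sections M E U"
proof (rule local_sectionsI)
  fix x assume "x \<in> U"
  then show "(s + t) x \<in> fib E x"
    using subspace_add[OF subspace_fib local_sections_fib[OF assms(1)] local_sections_fib[OF assms(2)]] by simp
next
  fix V es assume V: "(V, es) \<in> frames E"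
  obtain c where c: "\<And>i. i < length es \<Longrightarrow> smooth_fun M (U \<inter> V) (c i)"
    "\<And>x. x \<in> U \<Longrightarrow> x \<in> V \<Longrightarrow> s x = (\<Sum>i<length es. c i x *\<^sub>R (es ! i) x)"
    by (rule local_sectionsD[OF assms(1) V]) blast
  obtain d where d: "\<And>i. i < length es \<Longrightarrow> smooth_fun M (U \<inter> V) (d i)"
    "\<And>x. x \<in> U \<Longrightarrow> x \<in> V \<Longrightarrow> t x = (\<Sum>i<length es. d i x *\<^sub>R (es ! i) x)"
    by (rule local_sectionsD[OF assms(2) V]) blast
  show "\<exists>c. (\<forall>i<length es. smooth_fun M (U \<inter> V) (c i)) \<and>
      (\<forall>x\<in>U \<inter> V. (s + t) x = (\<Sum>i<length es. c i x *\<^sub>R (es ! i) x))"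
    by (intro exI[of _ "\<lambda>i x. c i x + d i x"])
      (auto intro!: smooth_fun_add c(1) d(1) simp: c(2) d(2) scaleR_left_distrib sum.distrib)
qed

lemma local_sections_smul:
  assumes "smooth_fun M U f" "s \<in> local_sections M E U"
  shows "smul f s \<in> local_sections M E U"
proof (rule local_sectionsI)
  fix x assume "x \<in> U"
  then show "smul f s x \<in> fib E x"
    using subspace_scale[OF subspace_fib local_sections_fib[OF assms(2)]] by (simp add: smul_def)
next
  fix V es assume V: "(V, es) \<in> frames E"
  obtain c where c: "\<And>i. i < length es \<Longrightarrow> smooth_fun M (U \<inter> V) (c i)"
    "\<And>x. x \<in> U \<Longrightarrow> x \<in> V \<Longrightarrow> s x = (\<Sum>i<length es. c i x *\<^sub>R (es ! i) x)"
    by (rule local_sectionsD[OF assms(2) V]) blast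
  show "\<exists>c. (\<forall>i<length es. smooth_fun M (U \<inter> V) (c i)) \<and>
      (\<forall>x\<in>U \<inter> V. smul f s x = (\<Sum>i<length es. c i x *\<^sub>R (es ! i) x))"
    by (intro exI[of _ "\<lambda>i x. f x * c i x"])
      (auto intro!: smooth_fun_mult c(1) smooth_fun_subset[OF assms(1)] simp: c(2) smul_def scaleR_sum_right)
qed

lemma local_sections_zero: "0 \<in> local_sections M E U"
  unfolding local_sections_def
  by (auto simp: subspace_0[OF subspace_fib] intro!: exI[of _ "\<lambda>i x. 0"] smooth_fun_const)

lemma local_sections_scaleR: "s \<in> local_sections M E U \<Longrightarrow> c *\<^sub>R s \<in> local_sections M E U"
  using local_sections_smul[OF smooth_fun_const, of s U c] by (simp add: smul_const)

lemma local_sections_diff: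
  "s \<in> local_sections M E U \<Longrightarrow> t \<in> local_sections M E U \<Longrightarrow> s - t \<in> local_sections M E U"
  using local_sections_add[of s U "(- 1) *\<^sub>R t"] local_sections_scaleR[of t U "- 1"] by simp

lemma local_sections_sum:
  "(\<And>i. i \<in> I \<Longrightarrow> s i \<in> local_sections M E U) \<Longrightarrow> (\<Sum>i\<in>I. s i) \<in> local_sections M E U"
  by (induction I rule: infinite_finite_induct) (auto intro: local_sections_zero local_sections_add)

text \<open>Coefficients in a frame are unique, so those found on small sets are restrictions of one
  function, which is then smooth locally.\<close>

lemma local_sections_local:
  assumes "\<And>x. x \<in> U \<Longrightarrow> \<exists>N. open N \<and> x \<in> N \<and> s \<in> local_sections M E (U \<inter> N)"
  shows "s \<in> local_sections M E U"
proof (rule local_sectionsI)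
  fix x assume "x \<in> U"
  then show "s x \<in> fib E x" using assms local_sections_fib by blast
next
  fix V es assume V: "(V, es) \<in> frames E"
  have "\<exists>c. s x = (\<Sum>i<length es. c i *\<^sub>R (es ! i) x)" if x: "x \<in> U \<inter> V" for x
  proof -
    obtain N where N: "x \<in> N" "s \<in> local_sections M E (U \<inter> N)" using assms x by blast
    obtain c where "\<And>i. i < length es \<Longrightarrow> smooth_fun M (U \<inter> N \<inter> V) (c i)"
      "\<And>x. x \<in> U \<inter> N \<Longrightarrow> x \<in> V \<Longrightarrow> s x = (\<Sum>i<length es. c i x *\<^sub>R (es ! i) x)"
      by (rule local_sectionsD[OF N(2) V]) blast
    then show ?thesis using x N(1) by (intro exI[of _ "\<lambda>i. c i x"]) auto
  qed
  then obtain c where c: "\<And>x. x \<in> U \<inter> V \<Longrightarrow> s x = (\<Sum>i<length es. c x i *\<^sub>R (es ! i) x)" by metis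
  have "smooth_fun M (U \<inter> V) (\<lambda>x. c x i)" if i: "i < length es" for i
  proof (rule smooth_fun_local)
    fix x assume x: "x \<in> U \<inter> V"
    then obtain N where N: "open N" "x \<in> N" "s \<in> local_sections M E (U \<inter> N)" using assms by blast
    obtain d where d: "\<And>i. i < length es \<Longrightarrow> smooth_fun M ((U \<inter> N) \<inter> V) (d i)"
      "\<And>x. x \<in> U \<inter> N \<Longrightarrow> x \<in> V \<Longrightarrow> s x = (\<Sum>i<length es. d i x *\<^sub>R (es ! i) x)"
      by (rule local_sectionsD[OF N(3) V]) blast
    have "d i y = c y i" if y: "y \<in> U \<inter> N \<inter> V" for y
      by (rule frame_on_unique[OF frame_frame_on[OF V] _ _ i, of y "\<lambda>i. d i y"])
        (use y c[of y] d(2)[of y] in auto)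
    then have "smooth_fun M (U \<inter> N \<inter> V) (\<lambda>x. c x i)"
      by (rule smooth_fun_cong[OF _ d(1)[OF i]])
    moreover have "U \<inter> N \<inter> V = U \<inter> V \<inter> N" by auto
    ultimately show "\<exists>N. open N \<and> x \<in> N \<and> smooth_fun M (U \<inter> V \<inter> N) (\<lambda>x. c x i)"
      using N by auto
  qed
  then show "\<exists>c. (\<forall>i<length es. smooth_fun M (U \<inter> V) (c i)) \<and>
      (\<forall>x\<in>U \<inter> V. s x = (\<Sum>i<length es. c i x *\<^sub>R (es ! i) x))"
    using c by (intro exI[of _ "\<lambda>i x. c x i"]) auto
qed

lemma sections_cutoff:
  assumes "open U" "s \<in> local_sections M E U" "\<kappa> \<in> Cinf M" "closed C" "C \<subseteq> U" "\<And>x. x \<notin> C \<Longrightarrow> \<kappa> x = 0"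
  shows "smul \<kappa> s \<in> sections M E"
proof (rule local_sections_local)
  fix x
  show "\<exists>N. open N \<and> x \<in> N \<and> smul \<kappa> s \<in> local_sections M E (UNIV \<inter> N)"
  proof (cases "x \<in> U")
    case True
    have "smul \<kappa> s \<in> local_sections M E U"
      by (intro local_sections_smul assms(2) Cinf_smooth_fun[OF assms(3)])
    then show ?thesis using True assms(1) by (intro exI[of _ U]) auto
  next
    case False
    have "smul \<kappa> s \<in> local_sections M E (- C)"
      by (rule local_sections_cong[OF local_sections_zero]) (use assms(6) in \<open>simp add: smul_def\<close>)
    then show ?thesis using False assms(4,5) by (intro exI[of _ "- C"]) auto
  qed
qed

lemma sections_smul: "f \<in> Cinf M \<Longrightarrow> s \<in> sections M E \<Longrightarrow> smul f s \<in> sections M E"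
  by (intro local_sections_smul Cinf_smooth_fun)

lemma section_extension:
  assumes "open U" "p \<in> U" "s \<in> local_sections M E U"
  obtains t N where "t \<in> sections M E" "open N" "p \<in> N" "N \<subseteq> U" "\<And>x. x \<in> N \<Longrightarrow> t x = s x"
proof -
  obtain \<kappa> C N where \<kappa>: "\<kappa> \<in> Cinf M" "closed C" "C \<subseteq> U" "\<And>x. x \<notin> C \<Longrightarrow> \<kappa> x = 0"
    "open N" "p \<in> N" "N \<subseteq> U" "\<And>x. x \<in> N \<Longrightarrow> \<kappa> x = 1"
    using bump[OF assms(1,2)] by metis
  show ?thesis
    by (rule that[OF sections_cutoff[OF assms(1,3) \<kappa>(1-4)] \<kappa>(5-7)]) (simp_all add: smul_def \<kappa>(8))
qed

lemma section_through:
  assumes "a \<in> fib E p"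
  obtains s where "s \<in> sections M E" "s p = a"
proof -
  obtain V es where V: "(V, es) \<in> frames E" "p \<in> V" by (rule frame_ex)
  have "a \<in> span ((\<lambda>i. (es ! i) p) ` {..<length es})"
    using assms frame_frame_on[OF V(1)] V(2) unfolding frame_on_def set_frame_values by blast
  then obtain c where c: "a = (\<Sum>i<length es. c i *\<^sub>R (es ! i) p)"
    by (auto simp: span_finite sum.reindex[OF frame_on_inj_on[OF frame_frame_on[OF V(1)] V(2)]])
  have "(\<Sum>i<length es. c i *\<^sub>R es ! i) \<in> local_sections M E V"
    by (intro local_sections_sum local_sections_scaleR frame_local_sections[OF V(1)]) auto
  from section_extension[OF frame_open[OF V(1)] V(2) this]
  obtain t N where t: "t \<in> sections M E" "p \<in> N" "\<And>x. x \<in> N \<Longrightarrow> t x = (\<Sum>i<length es. c i *\<^sub>R es ! i) x"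
    by metis
  have "t p = a" unfolding c by (simp add: t(2,3) sum_fun_apply scaleR_fun_apply)
  then show ?thesis using that t(1) by blast
qed

text \<open>A local frame plays the role that coordinate fields play for the tangent bundle;
  uniqueness of coefficients makes them vanish at p.\<close>

lemma sections_tensorial:
  fixes T :: "('m \<Rightarrow> 'v) \<Rightarrow> 'm \<Rightarrow> 'w::real_vector"
  assumes add: "\<And>s t. s \<in> sections M E \<Longrightarrow> t \<in> sections M E \<Longrightarrow> T (s + t) = T s + T t"
    and smul: "\<And>f s. f \<in> Cinf M \<Longrightarrow> s \<in> sections M E \<Longrightarrow> T (smul f s) = smul f (T s)"
    and s: "s \<in> sections M E" "s p = 0"
  shows "T s p = 0"
proof -
  obtain V es where V: "(V, es) \<in> frames E" "p \<in> V" by (rule frame_ex)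
  obtain \<kappa> C N where \<kappa>: "\<kappa> \<in> Cinf M" "closed C" "C \<subseteq> V" "\<And>x. x \<notin> C \<Longrightarrow> \<kappa> x = 0"
    "p \<in> N" "\<And>x. x \<in> N \<Longrightarrow> \<kappa> x = 1"
    using bump[OF frame_open[OF V(1)] V(2)] by metis
  obtain c where c: "\<And>i. i < length es \<Longrightarrow> smooth_fun M (UNIV \<inter> V) (c i)"
    "\<And>x. x \<in> UNIV \<Longrightarrow> x \<in> V \<Longrightarrow> s x = (\<Sum>i<length es. c i x *\<^sub>R (es ! i) x)"
    by (rule local_sectionsD[OF s(1) V(1)]) blast
  have cp: "c i p = 0" if "i < length es" for i
    by (rule frame_on_unique[OF frame_frame_on[OF V(1)] V(2) _ that, of "\<lambda>i. c i p" "\<lambda>i. 0"])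
      (use c(2)[of p] V(2) s(2) in simp)
  define d where "d i = (\<lambda>x. \<kappa> x * c i x)" for i
  have d: "d i \<in> Cinf M" if "i < length es" for i
    unfolding d_def using c(1)[OF that] by (intro Cinf_cutoff[OF frame_open[OF V(1)] _ \<kappa>(1-4)]) auto
  have e: "smul \<kappa> (es ! i) \<in> sections M E" if "i < length es" for i
    by (rule sections_cutoff[OF frame_open[OF V(1)] frame_local_sections[OF V(1) that] \<kappa>(1-4)])
  \<comment> \<open>One factor \<open>\<kappa>\<close> makes the coefficients global, the other the
    frame sections; hence the square.\<close>
  have "smul \<kappa> (smul \<kappa> s) = (\<Sum>i<length es. smul (d i) (smul \<kappa> (es ! i)))"
  proof
    fix x
    show "smul \<kappa> (smul \<kappa> s) x = (\<Sum>i<length es. smul (d i) (smul \<kappa> (es ! i))) x"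
    proof (cases "x \<in> V")
      case True
      then show ?thesis
        using c(2)[of x] by (simp add: sum_fun_apply smul_def d_def scaleR_sum_right mult_ac)
    next
      case False
      then have "\<kappa> x = 0" using \<kappa>(3,4) by auto
      then show ?thesis by (simp add: sum_fun_apply smul_def)
    qed
  qed
  moreover have "T (\<Sum>i<length es. smul (d i) (smul \<kappa> (es ! i))) =
      (\<Sum>i<length es. smul (d i) (T (smul \<kappa> (es ! i))))"
    by (rule smul_linear_sum[where S = "sections M E"])
      (simp_all only: finite_lessThan local_sections_zero local_sections_add add sections_smul d e smul lessThan_iff)
  ultimately have "smul \<kappa> (smul \<kappa> (T s)) p = (\<Sum>i<length es. smul (d i) (T (smul \<kappa> (es ! i)))) p"
    by (simp only: smul[OF \<kappa>(1) sections_smul[OF \<kappa>(1) s(1)], symmetric] smul[OF \<kappa>(1) s(1), symmetric])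
  then show ?thesis using \<kappa>(5,6) by (simp add: smul_def sum_fun_apply d_def cp)
qed

end

section \<open>Bracket, anchor and splittings of the algebroid\<close>

section \<open>Abelian bundles of ideals\<close>

lemma act_apply: "act \<phi> s x = \<phi> x (s x)"
  by (simp add: act_def)

lemma smul_add: "smul f (s + t) = smul f s + smul f t"
  by (simp add: fun_eq_iff smul_def scaleR_right_distrib)

lemma smul_diff: "smul f (s - t) = smul f s - smul f t"
  by (simp add: fun_eq_iff smul_def scaleR_right_diff_distrib)

lemma vf_bracket_add_left:
  assumes "X \<in> vfields M" "X' \<in> vfields M" "Y \<in> vfields M"
  shows "vf_bracket (X + X') Y = vf_bracket X Y + vf_bracket X' Y"
proof (intro ext)
  fix p f
  have "(\<lambda>q. X q f + X' q f) = (\<lambda>q. X q f) + (\<lambda>q. X' q f)" by (simp add: plus_fun_def)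
  then have "Y p (\<lambda>q. X q f + X' q f) = Y p (\<lambda>q. X q f) + Y p (\<lambda>q. X' q f)"
    using vfields_rules(1)[OF assms(3) vfields_Cinf[OF assms(1)] vfields_Cinf[OF assms(2)]] by simp
  then show "vf_bracket (X + X') Y p f = (vf_bracket X Y + vf_bracket X' Y) p f"
    by (simp add: vf_bracket_def)
qed

lemma vf_bracket_zero_left: "Y \<in> vfields M \<Longrightarrow> vf_bracket 0 Y = 0"
  using vf_bracket_add_left[OF vfields_zero vfields_zero, of Y M] by simp

lemma vf_bracket_smul_left:
  assumes "f \<in> Cinf M" "X \<in> vfields M" "Y \<in> vfields M"
  shows "vf_bracket (smul f X) Y = smul f (vf_bracket X Y) - smul (\<lambda>x. Y x f) X"
proof (intro ext)
  fix p g
  have "(\<lambda>q. f q * X q g) = f * (\<lambda>q. X q g)" by (simp add: times_fun_def)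
  then have "Y p (\<lambda>q. f q * X q g) = f p * Y p (\<lambda>q. X q g) + X p g * Y p f"
    using vfields_rules(3)[OF assms(3,1) vfields_Cinf[OF assms(2)]] by simp
  then show "vf_bracket (smul f X) Y p g = (smul f (vf_bracket X Y) - smul (\<lambda>x. Y x f) X) p g"
    by (simp add: vf_bracket_def smul_def scaleR_fun_def algebra_simps)
qed

locale abelian_ideals = smooth_bundle M A
  for M :: "('m::{t2_space,second_countable_topology}, 'e::euclidean_space) manifold"
    and A :: "('m, 'v::real_vector) lie_algebroid" +
  fixes k :: "'m \<Rightarrow> 'v set"
  assumes lie_algebroid: "is_lie_algebroid M A"
    and ideals: "abelian_bundle_of_ideals M A k"
begin

abbreviation \<Gamma> where "\<Gamma> \<equiv> sections M A"
abbreviation K where "K \<equiv> sub_sections M A k"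
abbreviation \<rho> where "\<rho> \<equiv> act (anchor A)"
abbreviation br where "br \<equiv> bracket A"
abbreviation TF where "TF \<equiv> forms2 M (TM M) K"

lemmas \<Gamma>_add = local_sections_add[of _ UNIV] and \<Gamma>_diff = local_sections_diff[of _ UNIV]
  and \<Gamma>_zero = local_sections_zero[of UNIV] and \<Gamma>_smul = sections_smul
  and \<Gamma>_scaleR = local_sections_scaleR[of _ UNIV]

lemma bracket_rules:
  assumes "\<alpha> \<in> \<Gamma>" "\<beta> \<in> \<Gamma>"
  shows br_closed: "br \<alpha> \<beta> \<in> \<Gamma>" and br_antisym: "br \<alpha> \<beta> = - br \<beta> \<alpha>"
    and br_scaleR: "br (c *\<^sub>R \<alpha>) \<beta> = c *\<^sub>R br \<alpha> \<beta>"
    and rho_br: "\<rho> (br \<alpha> \<beta>) = vf_bracket (\<rho> \<alpha>) (\<rho> \<beta>)"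
  using lie_algebroid assms unfolding is_lie_algebroid_def act_def by blast+

lemma br_add_left:
  assumes "\<alpha> \<in> \<Gamma>" "\<beta> \<in> \<Gamma>" "\<gamma> \<in> \<Gamma>"
  shows "br (\<alpha> + \<beta>) \<gamma> = br \<alpha> \<gamma> + br \<beta> \<gamma>"
  using lie_algebroid assms unfolding is_lie_algebroid_def by blast

lemma br_diff_left:
  assumes "\<alpha> \<in> \<Gamma>" "\<beta> \<in> \<Gamma>" "\<gamma> \<in> \<Gamma>"
  shows "br (\<alpha> - \<beta>) \<gamma> = br \<alpha> \<gamma> - br \<beta> \<gamma>"
  using br_add_left[OF assms(1) \<Gamma>_scaleR[OF assms(2), of "- 1"] assms(3)]
    br_scaleR[OF assms(2,3), of "- 1"] by simp

lemma br_add_right: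
  assumes "\<alpha> \<in> \<Gamma>" "\<beta> \<in> \<Gamma>" "\<gamma> \<in> \<Gamma>"
  shows "br \<alpha> (\<beta> + \<gamma>) = br \<alpha> \<beta> + br \<alpha> \<gamma>"
  using br_add_left[OF assms(2,3,1)] br_antisym[OF assms(1) \<Gamma>_add[OF assms(2,3)]]
    br_antisym[OF assms(1,2)] br_antisym[OF assms(1,3)] by simp

lemma br_diff_right:
  assumes "\<alpha> \<in> \<Gamma>" "\<beta> \<in> \<Gamma>" "\<gamma> \<in> \<Gamma>"
  shows "br \<alpha> (\<beta> - \<gamma>) = br \<alpha> \<beta> - br \<alpha> \<gamma>"
  using br_diff_left[OF assms(2,3,1)] br_antisym[OF assms(1) \<Gamma>_diff[OF assms(2,3)]]
    br_antisym[OF assms(1,2)] br_antisym[OF assms(1,3)] by simp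

lemma subspace_k: "subspace (k x)" and k_fib: "a \<in> k x \<Longrightarrow> a \<in> fib A x"
  using ideals unfolding abelian_bundle_of_ideals_def bundle_of_ideals_def subbundle_def by auto

lemma anchor_k: "a \<in> k x \<Longrightarrow> anchor A x a = 0"
  using ideals unfolding abelian_bundle_of_ideals_def bundle_of_ideals_def by auto

lemma anchor_linear: "fibre_linear (fib A x) (anchor A x)"
  using lie_algebroid unfolding is_lie_algebroid_def anchor_bundle_map_def by auto

lemma K_\<Gamma>: "\<xi> \<in> K \<Longrightarrow> \<xi> \<in> \<Gamma>"
  unfolding sub_sections_def by auto

lemma K_add: "\<xi> \<in> K \<Longrightarrow> \<eta> \<in> K \<Longrightarrow> \<xi> + \<eta> \<in> K"
  unfolding sub_sections_def by (auto intro: \<Gamma>_add subspace_add[OF subspace_k])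

lemma K_diff: "\<xi> \<in> K \<Longrightarrow> \<eta> \<in> K \<Longrightarrow> \<xi> - \<eta> \<in> K"
  unfolding sub_sections_def by (auto intro: \<Gamma>_diff subspace_diff[OF subspace_k])

lemma K_smul: "f \<in> Cinf M \<Longrightarrow> \<xi> \<in> K \<Longrightarrow> smul f \<xi> \<in> K"
  unfolding sub_sections_def by (auto intro: \<Gamma>_smul simp: smul_apply subspace_scale[OF subspace_k])

lemma K_zero: "0 \<in> K"
  unfolding sub_sections_def by (auto intro: \<Gamma>_zero simp: subspace_0[OF subspace_k])

lemma K_uminus: "\<xi> \<in> K \<Longrightarrow> - \<xi> \<in> K"
  using K_diff[OF K_zero] by simp

lemma br_K: "\<alpha> \<in> \<Gamma> \<Longrightarrow> \<xi> \<in> K \<Longrightarrow> br \<alpha> \<xi> \<in> K"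
  using ideals unfolding abelian_bundle_of_ideals_def bundle_of_ideals_def by auto

lemma br_K_K: "\<xi> \<in> K \<Longrightarrow> \<eta> \<in> K \<Longrightarrow> br \<xi> \<eta> = 0"
  using ideals unfolding abelian_bundle_of_ideals_def by auto

lemma rho_vfields: "\<alpha> \<in> \<Gamma> \<Longrightarrow> \<rho> \<alpha> \<in> vfields M"
  using lie_algebroid local_sections_fib[of \<alpha> M A UNIV]
  unfolding is_lie_algebroid_def anchor_bundle_map_def vfields_def act_def Cinf_def
  by (auto simp: image_subset_iff)

lemma rho_add: "\<alpha> \<in> \<Gamma> \<Longrightarrow> \<beta> \<in> \<Gamma> \<Longrightarrow> \<rho> (\<alpha> + \<beta>) = \<rho> \<alpha> + \<rho> \<beta>"
  using anchor_linear local_sections_fib[of _ M A UNIV] unfolding fibre_linear_def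
  by (intro ext[of "\<rho> (\<alpha> + \<beta>)"]) (simp add: act_apply)

lemma rho_smul: "\<alpha> \<in> \<Gamma> \<Longrightarrow> \<rho> (smul f \<alpha>) = smul f (\<rho> \<alpha>)"
  using anchor_linear local_sections_fib[of _ M A UNIV] unfolding fibre_linear_def
  by (intro ext[of "\<rho> (smul f \<alpha>)"]) (simp add: act_apply smul_apply)

lemma rho_K: "\<xi> \<in> K \<Longrightarrow> \<rho> \<xi> = 0"
  unfolding sub_sections_def by (intro ext[of "\<rho> \<xi>"]) (simp add: act_apply anchor_k)

lemma rho_scaleR: "\<alpha> \<in> \<Gamma> \<Longrightarrow> \<rho> (c *\<^sub>R \<alpha>) = c *\<^sub>R \<rho> \<alpha>"
  using rho_smul[of \<alpha> "\<lambda>x. c"] by (simp add: smul_const)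

lemma rho_diff: "\<alpha> \<in> \<Gamma> \<Longrightarrow> \<beta> \<in> \<Gamma> \<Longrightarrow> \<rho> (\<alpha> - \<beta>) = \<rho> \<alpha> - \<rho> \<beta>"
  using rho_add[of \<alpha> "(- 1) *\<^sub>R \<beta>"] rho_scaleR[of \<beta> "- 1"] \<Gamma>_scaleR[of \<beta> "- 1"] by simp

subsection \<open>Splittings\<close>

lemma splitting_fib:
  assumes "splitting M A k v"
  shows "fibre_linear (fib A x) (v x)" and "a \<in> fib A x \<Longrightarrow> v x a \<in> k x" and "a \<in> k x \<Longrightarrow> v x a = a"
  using assms unfolding splitting_def by (blast, blast, simp)

lemma splitting_local_sections:
  "splitting M A k v \<Longrightarrow> open U \<Longrightarrow> s \<in> local_sections M A U \<Longrightarrow> act v s \<in> local_sections M A U"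
  unfolding splitting_def by blast

lemma split_K: "splitting M A k v \<Longrightarrow> \<alpha> \<in> \<Gamma> \<Longrightarrow> act v \<alpha> \<in> K"
  using splitting_local_sections[of v UNIV \<alpha>] splitting_fib(2)[of v] local_sections_fib[of \<alpha> M A UNIV]
  unfolding sub_sections_def by (auto simp: act_apply)

lemma split_id: "splitting M A k v \<Longrightarrow> \<xi> \<in> K \<Longrightarrow> act v \<xi> = \<xi>"
  unfolding sub_sections_def by (intro ext) (simp add: act_apply splitting_fib(3))

lemma split_add:
  assumes "splitting M A k v" "\<alpha> \<in> \<Gamma>" "\<beta> \<in> \<Gamma>"
  shows "act v (\<alpha> + \<beta>) = act v \<alpha> + act v \<beta>"
  using splitting_fib(1)[OF assms(1)] local_sections_fib[OF assms(2)] local_sections_fib[OF assms(3)]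
  unfolding fibre_linear_def by (intro ext) (simp add: act_apply)

lemma split_smul:
  assumes "splitting M A k v" "\<alpha> \<in> \<Gamma>"
  shows "act v (smul f \<alpha>) = smul f (act v \<alpha>)"
  using splitting_fib(1)[OF assms(1)] local_sections_fib[OF assms(2)]
  unfolding fibre_linear_def by (intro ext) (simp add: act_apply smul_apply)

lemma split_scaleR: "splitting M A k v \<Longrightarrow> \<alpha> \<in> \<Gamma> \<Longrightarrow> act v (c *\<^sub>R \<alpha>) = c *\<^sub>R act v \<alpha>"
  using split_smul[of v \<alpha> "\<lambda>x. c"] by (simp add: smul_const)

lemma split_diff:
  assumes "splitting M A k v" "\<alpha> \<in> \<Gamma>" "\<beta> \<in> \<Gamma>"
  shows "act v (\<alpha> - \<beta>) = act v \<alpha> - act v \<beta>"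
  using split_add[OF assms(1,2) \<Gamma>_scaleR[OF assms(3), of "- 1"]] split_scaleR[OF assms(1,3), of "- 1"]
  by simp

lemma act_hor: "act (hor v) \<alpha> = \<alpha> - act v \<alpha>"
  by (intro ext) (simp add: act_apply hor_def)

lemma hor_\<Gamma>: "splitting M A k v \<Longrightarrow> \<alpha> \<in> \<Gamma> \<Longrightarrow> act (hor v) \<alpha> \<in> \<Gamma>"
  unfolding act_hor by (simp add: \<Gamma>_diff K_\<Gamma> split_K)

lemma rho_hor: "splitting M A k v \<Longrightarrow> \<alpha> \<in> \<Gamma> \<Longrightarrow> \<rho> (act (hor v) \<alpha>) = \<rho> \<alpha>"
  unfolding act_hor by (simp add: rho_diff K_\<Gamma> split_K rho_K)

lemma split_hor: "splitting M A k v \<Longrightarrow> \<alpha> \<in> \<Gamma> \<Longrightarrow> act v (act (hor v) \<alpha>) = 0"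
  unfolding act_hor by (simp add: split_diff K_\<Gamma> split_K split_id)

section \<open>Calculus on the quotient B through lifts to A\<close>

subsection \<open>Sections of the quotient\<close>

lemma coset_eq_iff: "a +o k x = b +o k x \<longleftrightarrow> a - b \<in> k x"
proof
  assume eq: "a +o k x = b +o k x"
  have "a \<in> a +o k x" using subspace_0[OF subspace_k] by (auto simp: elt_set_plus_def intro!: bexI[of _ 0])
  then show "a - b \<in> k x" unfolding eq by (auto simp: elt_set_plus_def)
next
  have sub: "a +o k x \<subseteq> b +o k x" if "a - b \<in> k x" for a b
  proof
    fix c assume "c \<in> a +o k x"
    then obtain d where d: "d \<in> k x" "c = a + d" by (auto simp: elt_set_plus_def)
    then have "a - b + d \<in> k x" using that by (intro subspace_add[OF subspace_k])
    then show "c \<in> b +o k x" using d by (auto simp: elt_set_plus_def intro!: bexI[of _ "a - b + d"])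
  qed
  assume "a - b \<in> k x"
  moreover from this have "b - a \<in> k x" using subspace_neg[OF subspace_k] by fastforce
  ultimately show "a +o k x = b +o k x" using sub by blast
qed

lemma proj_eq_iff: "proj k \<alpha> = proj k \<beta> \<longleftrightarrow> (\<forall>x. \<alpha> x - \<beta> x \<in> k x)"
  by (simp add: proj_def fun_eq_iff coset_eq_iff)

lemma proj_eq_K: "\<alpha> \<in> \<Gamma> \<Longrightarrow> \<beta> \<in> \<Gamma> \<Longrightarrow> proj k \<alpha> = proj k \<beta> \<longleftrightarrow> \<alpha> - \<beta> \<in> K"
  by (auto simp: proj_eq_iff sub_sections_def \<Gamma>_diff)

lemma proj_B_sections: "\<alpha> \<in> \<Gamma> \<Longrightarrow> proj k \<alpha> \<in> B_sections M A k"
  unfolding B_sections_def by blast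

text \<open>Adding an element of \<open>k x\<close> changes the value of \<open>v\<close> by that
  element, since \<open>v\<close> is the identity there; hence exactly one member of the coset is
  killed by \<open>v\<close>.\<close>

lemma hlift_coset:
  assumes v: "splitting M A k v" and a: "a \<in> fib A x"
  shows "hlift v x (a +o k x) = a - v x a"
  unfolding hlift_def
proof (rule the_equality)
  note lin = splitting_fib(1)[OF v, of x, unfolded fibre_linear_def]
  have *: "v x (a + d) = v x a + d" if "d \<in> k x" for d
    using lin a k_fib[OF that] splitting_fib(3)[OF v that] by simp
  have neg: "- v x a \<in> k x" using splitting_fib(2)[OF v a] by (rule subspace_neg[OF subspace_k])
  show "a - v x a \<in> a +o k x \<and> v x (a - v x a) = 0"
    using *[OF neg] neg by (auto simp: elt_set_plus_def intro!: bexI[of _ "- v x a"])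
  fix b assume "b \<in> a +o k x \<and> v x b = 0"
  then obtain d where d: "d \<in> k x" "b = a + d" "v x (a + d) = 0" by (auto simp: elt_set_plus_def)
  then show "b = a - v x a" using *[OF d(1)] by (simp add: eq_neg_iff_add_eq_0[symmetric] add.commute)
qed

lemma hlift_proj: "splitting M A k v \<Longrightarrow> \<alpha> \<in> \<Gamma> \<Longrightarrow> act (hlift v) (proj k \<alpha>) = act (hor v) \<alpha>"
  using local_sections_fib[of \<alpha> M A UNIV] by (intro ext) (simp add: act_apply proj_def hlift_coset hor_def)

text \<open>A splitting replaces the partition of unity usually needed to lift sections of the quotient.\<close>

lemma B_sections_lift:
  assumes v: "splitting M A k v" and \<beta>: "\<beta> \<in> B_sections M A k"
  obtains \<alpha> where "\<alpha> \<in> \<Gamma>" "\<beta> = proj k \<alpha>"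
proof -
  have loc: "\<exists>U. open U \<and> x \<in> U \<and> (\<exists>\<alpha>\<in>local_sections M A U. \<forall>y\<in>U. \<beta> y = proj k \<alpha> y)" for x
    using \<beta> unfolding B_sections_def by auto
  have eq: "act (hlift v) \<beta> y = (\<alpha> - act v \<alpha>) y \<and> \<beta> y = proj k (act (hlift v) \<beta>) y"
    if "\<alpha> \<in> local_sections M A U" "y \<in> U" "\<beta> y = proj k \<alpha> y" for \<alpha> y U
  proof -
    have "\<alpha> y \<in> fib A y" using that by (auto intro: local_sections_fib)
    then have "act (hlift v) \<beta> y = \<alpha> y - v y (\<alpha> y)" "v y (\<alpha> y) \<in> k y"
      using that(3) splitting_fib(2)[OF v] by (auto simp: act_apply proj_def hlift_coset[OF v])
    then show ?thesis using that(3) by (auto simp: act_apply proj_def coset_eq_iff)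
  qed
  have "act (hlift v) \<beta> \<in> \<Gamma>"
  proof (rule local_sections_local)
    fix x
    obtain U \<alpha> where U: "open U" "x \<in> U" "\<alpha> \<in> local_sections M A U" "\<forall>y\<in>U. \<beta> y = proj k \<alpha> y"
      using loc by blast
    have "\<alpha> - act v \<alpha> \<in> local_sections M A U"
      by (intro local_sections_diff U(3) splitting_local_sections[OF v U(1)])
    then have "act (hlift v) \<beta> \<in> local_sections M A U"
      by (rule local_sections_cong) (use eq[OF U(3)] U(4) in simp)
    then show "\<exists>N. open N \<and> x \<in> N \<and> act (hlift v) \<beta> \<in> local_sections M A (UNIV \<inter> N)"
      using U by (intro exI[of _ U]) auto
  qed
  moreover have "\<beta> = proj k (act (hlift v) \<beta>)"
    using loc eq by (intro ext) blast
  ultimately show ?thesis using that by blast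
qed

text \<open>Sections of B are handled in the form \<open>proj k \<alpha>\<close>, so that
  \<open>\<alpha>\<close> itself witnesses the choice made in \<open>lift\<close>.\<close>

lemma lift_proj:
  assumes "\<alpha> \<in> \<Gamma>"
  shows "lift M A k (proj k \<alpha>) \<in> \<Gamma>" "proj k (lift M A k (proj k \<alpha>)) = proj k \<alpha>"
  unfolding lift_def using someI[of "\<lambda>\<alpha>'. \<alpha>' \<in> \<Gamma> \<and> proj k \<alpha>' = proj k \<alpha>" \<alpha>] assms by auto

text \<open>Two lifts differ by a section of \<open>k\<close>, whose bracket with
  \<open>\<xi>\<close> vanishes: commutativity makes the representation independent of the
  lift.\<close>

lemma B_rep_proj:
  assumes "\<alpha> \<in> \<Gamma>" "\<xi> \<in> K"
  shows "B_rep M A k (proj k \<alpha>) \<xi> = br \<alpha> \<xi>"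
proof -
  have d: "lift M A k (proj k \<alpha>) - \<alpha> \<in> K" using lift_proj[OF assms(1)] proj_eq_K assms(1) by blast
  have "br (lift M A k (proj k \<alpha>) - \<alpha>) \<xi> = 0" by (rule br_K_K[OF d assms(2)])
  then show ?thesis
    unfolding B_rep_def using br_diff_left[OF lift_proj(1)[OF assms(1)] assms(1) K_\<Gamma>[OF assms(2)]] by simp
qed

lemma B_bracket_proj:
  assumes "\<alpha> \<in> \<Gamma>" "\<beta> \<in> \<Gamma>"
  shows "B_bracket M A k (proj k \<alpha>) (proj k \<beta>) = proj k (br \<alpha> \<beta>)"
proof -
  let ?a = "lift M A k (proj k \<alpha>)" and ?b = "lift M A k (proj k \<beta>)"
  note l = lift_proj[OF assms(1)] lift_proj[OF assms(2)]
  have d: "?a - \<alpha> \<in> K" "?b - \<beta> \<in> K" using l proj_eq_K assms by blast+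
  \<comment> \<open>The difference is a combination of brackets with sections of \<open>k\<close>,
    hence lies in the ideal.\<close>
  have "br ?a ?b - br \<alpha> \<beta> = br ?a (?b - \<beta>) - br \<beta> (?a - \<alpha>)"
    using br_diff_right[OF l(1,3) assms(2)] br_diff_right[OF assms(2) l(1) assms(1)]
      br_antisym[OF assms(2) l(1)] br_antisym[OF assms(2,1)] by simp
  then have "br ?a ?b - br \<alpha> \<beta> \<in> K" using br_K[OF l(1) d(2)] br_K[OF assms(2) d(1)] K_diff by simp
  then show ?thesis unfolding B_bracket_def using l assms by (subst proj_eq_K) (auto intro: br_closed)
qed

lemma B_anchor_proj:
  assumes "\<alpha> \<in> \<Gamma>"
  shows "act (B_anchor A) (proj k \<alpha>) = \<rho> \<alpha>"
proof (rule ext)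
  fix x
  have "\<alpha> x \<in> \<alpha> x +o k x"
    using subspace_0[OF subspace_k] by (auto simp: elt_set_plus_def intro!: bexI[of _ 0])
  then have "(SOME a. a \<in> \<alpha> x +o k x) \<in> \<alpha> x +o k x" by (rule someI)
  then obtain d where d: "d \<in> k x" "(SOME a. a \<in> \<alpha> x +o k x) = \<alpha> x + d" by (auto simp: elt_set_plus_def)
  have "anchor A x (\<alpha> x + d) = anchor A x (\<alpha> x)"
    using anchor_linear[of x] local_sections_fib[OF assms] k_fib[OF d(1)] anchor_k[OF d(1)]
    unfolding fibre_linear_def by simp
  then show "act (B_anchor A) (proj k \<alpha>) x = \<rho> \<alpha> x"
    by (simp add: act_apply B_anchor_def proj_def d(2))
qed

lemma proj_add: "proj k \<alpha> + proj k \<beta> = proj k (\<alpha> + \<beta>)"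
proof (rule ext)
  fix x
  have "k x + k x = k x"
  proof (intro equalityI subsetI)
    show "c \<in> k x" if "c \<in> k x + k x" for c
      using that subspace_add[OF subspace_k[of x]] by (auto simp: set_plus_def)
    show "c \<in> k x + k x" if "c \<in> k x" for c
      using set_plus_intro[OF that subspace_0[OF subspace_k]] by simp
  qed
  then show "(proj k \<alpha> + proj k \<beta>) x = proj k (\<alpha> + \<beta>) x"
    by (simp add: proj_def set_plus_rearrange)
qed

text \<open>Where f vanishes, scaling collapses the coset to a point and the summand
  \<open>k x\<close> in \<open>B_smul\<close> restores it; elsewhere that summand changes
  nothing.\<close>

lemma proj_smul: "B_smul k f (proj k \<alpha>) = proj k (smul f \<alpha>)"
proof (rule ext)
  fix x
  show "B_smul k f (proj k \<alpha>) x = proj k (smul f \<alpha>) x"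
  proof
    show "B_smul k f (proj k \<alpha>) x \<subseteq> proj k (smul f \<alpha>) x"
    proof
      fix c assume "c \<in> B_smul k f (proj k \<alpha>) x"
      then obtain d e where "d \<in> k x" "e \<in> k x" "c = f x *\<^sub>R (\<alpha> x + d) + e"
        by (auto simp: B_smul_def proj_def elt_set_plus_def set_plus_def)
      then show "c \<in> proj k (smul f \<alpha>) x"
        using subspace_add[OF subspace_k subspace_scale[OF subspace_k, of d x "f x"], of e]
        by (auto simp: proj_def elt_set_plus_def smul_apply scaleR_right_distrib add.assoc
            intro!: bexI[of _ "f x *\<^sub>R d + e"])
    qed
    show "proj k (smul f \<alpha>) x \<subseteq> B_smul k f (proj k \<alpha>) x"
    proof
      fix c assume "c \<in> proj k (smul f \<alpha>) x"
      then obtain e where e: "e \<in> k x" "c = f x *\<^sub>R \<alpha> x + e"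
        by (auto simp: proj_def elt_set_plus_def smul_apply)
      have "\<alpha> x \<in> proj k \<alpha> x"
        using subspace_0[OF subspace_k] by (auto simp: proj_def elt_set_plus_def intro!: bexI[of _ 0])
      then show "c \<in> B_smul k f (proj k \<alpha>) x" using e by (auto simp: B_smul_def set_plus_def)
    qed
  qed
qed

text \<open>The bracket of the two vertical parts drops out because \<open>k\<close> is
  abelian.\<close>

lemma hor_bracket:
  assumes v: "splitting M A k v" and "\<alpha> \<in> \<Gamma>" "\<beta> \<in> \<Gamma>"
  shows "br (act (hor v) \<alpha>) (act (hor v) \<beta>) = br \<alpha> \<beta> - br \<alpha> (act v \<beta>) + br \<beta> (act v \<alpha>)"
proof -
  note K = split_K[OF v assms(2)] split_K[OF v assms(3)]
  note G = K_\<Gamma>[OF K(1)] K_\<Gamma>[OF K(2)]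
  have "br (act (hor v) \<alpha>) (act (hor v) \<beta>) = br \<alpha> \<beta> - br \<alpha> (act v \<beta>) - (br (act v \<alpha>) \<beta> - br (act v \<alpha>) (act v \<beta>))"
    unfolding act_hor br_diff_left[OF assms(2) G(1) \<Gamma>_diff[OF assms(3) G(2)]]
      br_diff_right[OF assms(2,3) G(2)] br_diff_right[OF G(1) assms(3) G(2)] ..
  then show ?thesis using br_K_K[OF K] br_antisym[OF assms(3) G(1)] by simp
qed

text \<open>Read on \<open>A\<close>, the form is the Koszul differential of \<open>v\<close>. Being
  linear in \<open>v\<close>, it changes by a coboundary when \<open>v\<close> changes by a form on
  B.\<close>

lemma split_form_proj:
  assumes v: "splitting M A k v" and "\<alpha> \<in> \<Gamma>" "\<beta> \<in> \<Gamma>"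
  shows "split_form M A k v (proj k \<alpha>) (proj k \<beta>) =
    br \<alpha> (act v \<beta>) - br \<beta> (act v \<alpha>) - act v (br \<alpha> \<beta>)"
proof -
  let ?h = "\<lambda>\<alpha>. act (hor v) \<alpha>"
  note G = hor_\<Gamma>[OF v assms(2)] hor_\<Gamma>[OF v assms(3)]
  note p = proj_B_sections[OF assms(2)] proj_B_sections[OF assms(3)]
  have "split_form M A k v (proj k \<alpha>) (proj k \<beta>) = ?h (br \<alpha> \<beta>) - br (?h \<alpha>) (?h \<beta>)"
    using p by (simp add: split_form_def B_bracket_proj assms hlift_proj[OF v] br_closed)
  then show ?thesis
    unfolding hor_bracket[OF assms] act_hor[of v "br \<alpha> \<beta>"] by simp
qed

end

section \<open>Forms with values in k, and tangential closedness\<close>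

section \<open>Forms and connections\<close>

lemma TM_simps [simp]: "carr (TM M) = vfields M" "fmult (TM M) = smul" "brk (TM M) = vf_bracket"
  by (simp_all add: TM_def)

lemma B_space_simps [simp]:
  "carr (B_space M A k) = B_sections M A k" "fmult (B_space M A k) = B_smul k"
  "brk (B_space M A k) = B_bracket M A k"
  by (simp_all add: B_space_def)

lemma forms1_rules:
  assumes "\<omega> \<in> forms1 M L K"
  shows forms1_closed: "X \<in> carr L \<Longrightarrow> \<omega> X \<in> K"
    and forms1_outside: "X \<notin> carr L \<Longrightarrow> \<omega> X = 0"
    and forms1_additive: "X \<in> carr L \<Longrightarrow> Y \<in> carr L \<Longrightarrow> \<omega> (X + Y) = \<omega> X + \<omega> Y"
    and forms1_fmult: "f \<in> Cinf M \<Longrightarrow> X \<in> carr L \<Longrightarrow> \<omega> (fmult L f X) = smul f (\<omega> X)"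
  using assms unfolding forms1_def by auto

lemma forms1I:
  assumes "\<And>X. X \<in> carr L \<Longrightarrow> \<omega> X \<in> K" "\<And>X. X \<notin> carr L \<Longrightarrow> \<omega> X = 0"
    and "\<And>X Y. X \<in> carr L \<Longrightarrow> Y \<in> carr L \<Longrightarrow> \<omega> (X + Y) = \<omega> X + \<omega> Y"
    and "\<And>f X. f \<in> Cinf M \<Longrightarrow> X \<in> carr L \<Longrightarrow> \<omega> (fmult L f X) = smul f (\<omega> X)"
  shows "\<omega> \<in> forms1 M L K"
  using assms unfolding forms1_def by auto

context abelian_ideals
begin

lemma forms1_add:
  assumes "\<omega> \<in> forms1 M L K" "\<eta> \<in> forms1 M L K"
  shows "\<omega> + \<eta> \<in> forms1 M L K"
  by (rule forms1I)
    (simp_all add: forms1_rules[OF assms(1)] forms1_rules[OF assms(2)] K_add smul_add)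

lemma forms1_zero: "0 \<in> forms1 M L K"
  by (rule forms1I) (simp_all add: K_zero smul_def fun_eq_iff)

lemma forms1_uminus:
  assumes "\<omega> \<in> forms1 M L K"
  shows "- \<omega> \<in> forms1 M L K"
  by (rule forms1I) (simp_all add: forms1_rules[OF assms] K_uminus smul_def fun_eq_iff)

lemma forms2_rules:
  assumes F: "F \<in> TF"
  shows F_forms1: "X \<in> vfields M \<Longrightarrow> F X \<in> forms1 M (TM M) K"
    and F_K: "X \<in> vfields M \<Longrightarrow> Y \<in> vfields M \<Longrightarrow> F X Y \<in> K"
    and F_add_left: "X \<in> vfields M \<Longrightarrow> X' \<in> vfields M \<Longrightarrow> F (X + X') = F X + F X'"
    and F_smul_left: "f \<in> Cinf M \<Longrightarrow> X \<in> vfields M \<Longrightarrow> Y \<in> vfields M \<Longrightarrow> F (smul f X) Y = smul f (F X Y)"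
    and F_add_right: "X \<in> vfields M \<Longrightarrow> Y \<in> vfields M \<Longrightarrow> Y' \<in> vfields M \<Longrightarrow> F X (Y + Y') = F X Y + F X Y'"
    and F_smul_right: "f \<in> Cinf M \<Longrightarrow> X \<in> vfields M \<Longrightarrow> Y \<in> vfields M \<Longrightarrow> F X (smul f Y) = smul f (F X Y)"
    and F_antisym: "X \<in> vfields M \<Longrightarrow> Y \<in> vfields M \<Longrightarrow> F X Y = - F Y X"
    and F_scaleR: "X \<in> vfields M \<Longrightarrow> F (c *\<^sub>R X) = c *\<^sub>R F X"
    and F_zero: "F 0 = 0"
proof -
  have right: "F X \<in> forms1 M (TM M) K" and left: "(\<lambda>Y. F Y X) \<in> forms1 M (TM M) K" and alt: "F X X = 0"
    if "X \<in> vfields M" for X using F that unfolding forms2_def by auto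
  \<comment> \<open>Off the vector fields a form is 0 by convention; this turns additivity in the
    first slot into an equation between functions on all arguments.\<close>
  have outside: "F X Y = 0" if "X \<in> vfields M" "Y \<notin> vfields M" for X Y
    using forms1_outside[OF right[OF that(1)]] that(2) by simp
  show "X \<in> vfields M \<Longrightarrow> F X \<in> forms1 M (TM M) K" by (rule right)
  show "X \<in> vfields M \<Longrightarrow> Y \<in> vfields M \<Longrightarrow> F X Y \<in> K" for X Y
    using forms1_closed[OF right] by simp
  show addl: "F (X + X') = F X + F X'" if "X \<in> vfields M" "X' \<in> vfields M" for X X'
  proof
    fix Y show "F (X + X') Y = (F X + F X') Y"
      using forms1_additive[OF left[of Y], of X X'] outside[of _ Y] vfields_add[OF that] that
      by (cases "Y \<in> vfields M") auto
  qed
  show smull: "F (smul f X) Y = smul f (F X Y)"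
    if "f \<in> Cinf M" "X \<in> vfields M" "Y \<in> vfields M" for f X Y
    using forms1_fmult[OF left[OF that(3)] that(1)] that(2) by simp
  show addr: "F X (Y + Y') = F X Y + F X Y'"
    if "X \<in> vfields M" "Y \<in> vfields M" "Y' \<in> vfields M" for X Y Y'
    using forms1_additive[OF right[OF that(1)]] that by simp
  show "F X (smul f Y) = smul f (F X Y)"
    if "f \<in> Cinf M" "X \<in> vfields M" "Y \<in> vfields M" for f X Y
    using forms1_fmult[OF right[OF that(2)] that(1)] that by simp
  show "F X Y = - F Y X" if "X \<in> vfields M" "Y \<in> vfields M" for X Y
    using alt[OF vfields_add[OF that]] addl[OF that] addr[OF that(1) that]
      addr[OF that(2) that] alt[OF that(1)] alt[OF that(2)]
    by (simp add: eq_neg_iff_add_eq_0)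
  show "F (c *\<^sub>R X) = c *\<^sub>R F X" if "X \<in> vfields M" for X c
  proof
    fix Y show "F (c *\<^sub>R X) Y = (c *\<^sub>R F X) Y"
      using smull[OF Cinf_const that, of Y c] outside[of _ Y] vfields_scaleR[OF that, of c] that
      by (cases "Y \<in> vfields M") (auto simp: smul_const scaleR_fun_apply)
  qed
  show "F 0 = 0" using addl[OF vfields_zero vfields_zero] by simp
qed

lemma connection_rules:
  assumes D: "connection M A k D"
  shows D_forms1: "\<xi> \<in> K \<Longrightarrow> D \<xi> \<in> forms1 M (TM M) K"
    and D_outside: "\<xi> \<notin> K \<Longrightarrow> D \<xi> = 0"
    and D_add: "\<xi> \<in> K \<Longrightarrow> \<eta> \<in> K \<Longrightarrow> D (\<xi> + \<eta>) = D \<xi> + D \<eta>"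
    and D_scaleR: "\<xi> \<in> K \<Longrightarrow> D (c *\<^sub>R \<xi>) = c *\<^sub>R D \<xi>"
    and D_smul: "f \<in> Cinf M \<Longrightarrow> \<xi> \<in> K \<Longrightarrow> X \<in> vfields M \<Longrightarrow>
      D (smul f \<xi>) X = smul f (D \<xi> X) + smul (\<lambda>x. X x f) \<xi>"
    and D_K: "\<xi> \<in> K \<Longrightarrow> X \<in> vfields M \<Longrightarrow> D \<xi> X \<in> K"
    and D_diff: "\<xi> \<in> K \<Longrightarrow> \<eta> \<in> K \<Longrightarrow> D (\<xi> - \<eta>) = D \<xi> - D \<eta>"
    and D_zero: "D 0 = 0"
proof -
  show forms1: "\<xi> \<in> K \<Longrightarrow> D \<xi> \<in> forms1 M (TM M) K"
    and "\<xi> \<notin> K \<Longrightarrow> D \<xi> = 0"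
    and add: "\<xi> \<in> K \<Longrightarrow> \<eta> \<in> K \<Longrightarrow> D (\<xi> + \<eta>) = D \<xi> + D \<eta>"
    and "\<xi> \<in> K \<Longrightarrow> D (c *\<^sub>R \<xi>) = c *\<^sub>R D \<xi>"
    and "f \<in> Cinf M \<Longrightarrow> \<xi> \<in> K \<Longrightarrow> X \<in> vfields M \<Longrightarrow>
      D (smul f \<xi>) X = smul f (D \<xi> X) + smul (\<lambda>x. X x f) \<xi>" for \<xi> \<eta> c f X
    using D unfolding connection_def by auto
  show "\<xi> \<in> K \<Longrightarrow> X \<in> vfields M \<Longrightarrow> D \<xi> X \<in> K"
    using forms1_closed[OF forms1] by simp
  show "D (\<xi> - \<eta>) = D \<xi> - D \<eta>" if "\<xi> \<in> K" "\<eta> \<in> K"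
    using add[OF K_diff[OF that] that(2)] by simp
  show "D 0 = 0" using add[OF K_zero K_zero] by simp
qed

abbreviation dform where "dform D F \<equiv> diff2 (TM M) (\<lambda>X \<xi>. D \<xi> X) F"

lemma dform_eq:
  assumes "X \<in> vfields M" "Y \<in> vfields M" "Z \<in> vfields M"
  shows "dform D F X Y Z = D (F Y Z) X - D (F X Z) Y + D (F X Y) Z
    - F (vf_bracket X Y) Z + F (vf_bracket X Z) Y - F (vf_bracket Y Z) X"
  using assms by (simp add: diff2_def)

text \<open>The derivatives of f produced by the connection cancel in pairs against those produced
  by the brackets of \<open>smul f X\<close> with Y and Z. Only the slot to be contracted with the
  anchor is treated.\<close>

lemma dform_tensorial:
  assumes D: "connection M A k D" and F: "F \<in> TF" and YZ: "Y \<in> vfields M" "Z \<in> vfields M"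
  shows "X \<in> vfields M \<Longrightarrow> X' \<in> vfields M \<Longrightarrow> dform D F (X + X') Y Z = dform D F X Y Z + dform D F X' Y Z"
    and "f \<in> Cinf M \<Longrightarrow> X \<in> vfields M \<Longrightarrow> dform D F (smul f X) Y Z = smul f (dform D F X Y Z)"
proof -
  note FK = F_K[OF F] and br = vf_bracket_vfields
  note D1 = forms1_rules[OF D_forms1[OF D FK[OF YZ]], simplified]
  assume X: "X \<in> vfields M"
  {
    assume X': "X' \<in> vfields M"
    have "D (F (X + X') Z) = D (F X Z) + D (F X' Z)" "D (F (X + X') Y) = D (F X Y) + D (F X' Y)"
      using F_add_left[OF F X X'] D_add[OF D FK[OF X YZ(2)] FK[OF X' YZ(2)]]
        D_add[OF D FK[OF X YZ(1)] FK[OF X' YZ(1)]] by simp_all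
    moreover have "F (vf_bracket (X + X') W) W' = F (vf_bracket X W) W' + F (vf_bracket X' W) W'"
      if "W \<in> vfields M" for W W'
      using F_add_left[OF F br[OF X that] br[OF X' that]] by (simp add: vf_bracket_add_left[OF X X' that])
    ultimately show "dform D F (X + X') Y Z = dform D F X Y Z + dform D F X' Y Z"
      unfolding dform_eq[OF X YZ] dform_eq[OF X' YZ] dform_eq[OF vfields_add[OF X X'] YZ]
      using D1(3)[OF X X'] F_add_right[OF F br[OF YZ] X X'] YZ by simp
  }
  assume f: "f \<in> Cinf M"
  have DF: "D (F (smul f X) W) W' = smul f (D (F X W) W') + smul (\<lambda>x. W' x f) (F X W)"
    if "W \<in> vfields M" "W' \<in> vfields M" for W W'
    unfolding F_smul_left[OF F f X that(1)] by (rule D_smul[OF D f FK[OF X that(1)] that(2)])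
  have Fbr: "F (vf_bracket (smul f X) W) W' = smul f (F (vf_bracket X W) W') - smul (\<lambda>x. W x f) (F X W')"
    if W: "W \<in> vfields M" "W' \<in> vfields M" for W W'
  proof -
    have Wf: "(\<lambda>x. W x f) \<in> Cinf M" by (rule vfields_Cinf[OF W(1)])
    have "F (smul f (vf_bracket X W)) W' =
        F (vf_bracket (smul f X) W) W' + F (smul (\<lambda>x. W x f) X) W'"
      using F_add_left[OF F br[OF vfields_smul[OF f X] W(1)] vfields_smul[OF Wf X]]
      by (simp add: vf_bracket_smul_left[OF f X W(1)])
    then show ?thesis using F_smul_left[OF F f br[OF X W(1)] W(2)] F_smul_left[OF F Wf X W(2)] by simp
  qed
  show "dform D F (smul f X) Y Z = smul f (dform D F X Y Z)"
    unfolding dform_eq[OF X YZ] dform_eq[OF vfields_smul[OF f X] YZ] D1(4)[OF f X]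
      DF[OF YZ] DF[OF YZ(2,1)] Fbr[OF YZ] Fbr[OF YZ(2,1)] F_smul_right[OF F f br[OF YZ] X]
    by (simp add: smul_add smul_diff)
qed

text \<open>A field whose value at p lies in the image of the anchor need not be an anchor image
  near p. It does differ from some \<open>\<rho> \<alpha>\<close> by a field vanishing at p, and
  there tensoriality applies.\<close>

lemma forms2_tc_iff:
  assumes D: "connection M A k D" and F: "F \<in> TF"
  shows "F \<in> forms2_tc M A k D \<longleftrightarrow>
    (\<forall>\<alpha>\<in>\<Gamma>. \<forall>Y\<in>vfields M. \<forall>Z\<in>vfields M. dform D F (\<rho> \<alpha>) Y Z = 0)"
proof
  assume tc: "F \<in> forms2_tc M A k D"
  show "\<forall>\<alpha>\<in>\<Gamma>. \<forall>Y\<in>vfields M. \<forall>Z\<in>vfields M. dform D F (\<rho> \<alpha>) Y Z = 0"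
  proof (intro ballI ext)
    fix \<alpha> Y Z p assume "\<alpha> \<in> \<Gamma>" "Y \<in> vfields M" "Z \<in> vfields M"
    moreover from this have "\<rho> \<alpha> p \<in> anchor A p ` fib A p"
      by (auto simp: act_apply intro: local_sections_fib)
    ultimately show "dform D F (\<rho> \<alpha>) Y Z p = 0 p"
      using tc rho_vfields unfolding forms2_tc_def by auto
  qed
next
  assume closed: "\<forall>\<alpha>\<in>\<Gamma>. \<forall>Y\<in>vfields M. \<forall>Z\<in>vfields M. dform D F (\<rho> \<alpha>) Y Z = 0"
  have "dform D F X Y Z p = 0"
    if X: "X \<in> vfields M" and YZ: "Y \<in> vfields M" "Z \<in> vfields M"
      and p: "X p \<in> anchor A p ` fib A p" for p X Y Z
  proof -
    obtain a where "a \<in> fib A p" "X p = anchor A p a" using p by auto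
    then obtain \<alpha> where \<alpha>: "\<alpha> \<in> \<Gamma>" "X p = \<rho> \<alpha> p"
      using section_through[of a p] by (metis act_apply)
    note tensor = dform_tensorial[OF D F YZ]
    have d: "X - \<rho> \<alpha> \<in> vfields M" by (intro vfields_diff X rho_vfields \<alpha>(1))
    have "dform D F (X - \<rho> \<alpha>) Y Z p = 0"
      by (rule vfields_tensorial[where T = "\<lambda>X. dform D F X Y Z", OF tensor d]) (simp_all add: \<alpha>(2))
    moreover have "dform D F X Y Z = dform D F (X - \<rho> \<alpha>) Y Z + dform D F (\<rho> \<alpha>) Y Z"
      using tensor(1)[OF d rho_vfields[OF \<alpha>(1)]] by simp
    ultimately show ?thesis using closed \<alpha>(1) YZ by simp
  qed
  then show "F \<in> forms2_tc M A k D" using F unfolding forms2_tc_def by blast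
qed

lemma induces_B_rep_iff:
  assumes v: "splitting M A k v"
  shows "induces_B_rep M A k D \<longleftrightarrow> (\<forall>\<alpha>\<in>\<Gamma>. \<forall>\<xi>\<in>K. br \<alpha> \<xi> = D \<xi> (\<rho> \<alpha>))"
proof
  assume "induces_B_rep M A k D"
  then show "\<forall>\<alpha>\<in>\<Gamma>. \<forall>\<xi>\<in>K. br \<alpha> \<xi> = D \<xi> (\<rho> \<alpha>)"
    unfolding induces_B_rep_def using proj_B_sections B_rep_proj B_anchor_proj by metis
next
  assume *: "\<forall>\<alpha>\<in>\<Gamma>. \<forall>\<xi>\<in>K. br \<alpha> \<xi> = D \<xi> (\<rho> \<alpha>)"
  show "induces_B_rep M A k D"
    unfolding induces_B_rep_def
  proof (intro ballI)
    fix \<beta> \<xi> assume "\<beta> \<in> B_sections M A k" and \<xi>: "\<xi> \<in> K"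
    then obtain \<alpha> where "\<alpha> \<in> \<Gamma>" "\<beta> = proj k \<alpha>" using B_sections_lift[OF v] by blast
    then show "B_rep M A k \<beta> \<xi> = D \<xi> (act (B_anchor A) \<beta>)"
      using * \<xi> by (simp add: B_rep_proj B_anchor_proj)
  qed
qed

text \<open>Equality may be tested on projected sections, because a splitting presents every section
  of B as one.\<close>

lemma B_forms_eqI:
  assumes v: "splitting M A k v"
    and "\<And>\<beta> \<gamma>. \<beta> \<notin> B_sections M A k \<or> \<gamma> \<notin> B_sections M A k \<Longrightarrow> \<omega> \<beta> \<gamma> = \<omega>' \<beta> \<gamma>"
    and "\<And>\<alpha> \<beta>. \<alpha> \<in> \<Gamma> \<Longrightarrow> \<beta> \<in> \<Gamma> \<Longrightarrow> \<omega> (proj k \<alpha>) (proj k \<beta>) = \<omega>' (proj k \<alpha>) (proj k \<beta>)"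
  shows "\<omega> = \<omega>'"
proof (rule ext, rule ext)
  fix \<beta> \<gamma>
  show "\<omega> \<beta> \<gamma> = \<omega>' \<beta> \<gamma>"
  proof (cases "\<beta> \<in> B_sections M A k \<and> \<gamma> \<in> B_sections M A k")
    case True
    then obtain a b where "a \<in> \<Gamma>" "\<beta> = proj k a" "b \<in> \<Gamma>" "\<gamma> = proj k b"
      using B_sections_lift[OF v] by metis
    then show ?thesis using assms(3) by simp
  qed (use assms(2) in blast)
qed

lemma split_form_eq_pullback_iff:
  assumes v: "splitting M A k v"
  shows "split_form M A k v = pullback_B M A k F \<longleftrightarrow>
    (\<forall>\<alpha>\<in>\<Gamma>. \<forall>\<beta>\<in>\<Gamma>. F (\<rho> \<alpha>) (\<rho> \<beta>) = br \<alpha> (act v \<beta>) - br \<beta> (act v \<alpha>) - act v (br \<alpha> \<beta>))"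
proof -
  have pb: "pullback_B M A k F (proj k \<alpha>) (proj k \<beta>) = F (\<rho> \<alpha>) (\<rho> \<beta>)" if "\<alpha> \<in> \<Gamma>" "\<beta> \<in> \<Gamma>" for \<alpha> \<beta>
    using that by (simp add: pullback_B_def proj_B_sections B_anchor_proj)
  show ?thesis
  proof
    assume "split_form M A k v = pullback_B M A k F"
    then show "\<forall>\<alpha>\<in>\<Gamma>. \<forall>\<beta>\<in>\<Gamma>. F (\<rho> \<alpha>) (\<rho> \<beta>) = br \<alpha> (act v \<beta>) - br \<beta> (act v \<alpha>) - act v (br \<alpha> \<beta>)"
      using pb split_form_proj[OF v] by metis
  next
    assume "\<forall>\<alpha>\<in>\<Gamma>. \<forall>\<beta>\<in>\<Gamma>. F (\<rho> \<alpha>) (\<rho> \<beta>) = br \<alpha> (act v \<beta>) - br \<beta> (act v \<alpha>) - act v (br \<alpha> \<beta>)"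
    then show "split_form M A k v = pullback_B M A k F"
      by (intro B_forms_eqI[OF v])
        (auto simp: pb split_form_proj[OF v], auto simp: split_form_def pullback_B_def)
  qed
qed

section \<open>Translation between IM connections with curving and triples\<close>

section \<open>IM connections and triples\<close>

definition IM_of :: "('m \<Rightarrow> 'v \<Rightarrow> 'v) \<Rightarrow> ('m, 'v) form_op \<Rightarrow> ('m vfield \<Rightarrow> 'm vfield \<Rightarrow> 'm \<Rightarrow> 'v)
    \<Rightarrow> ('m, 'v) form_op" where
  "IM_of v D F = (\<lambda>\<alpha>. if \<alpha> \<in> \<Gamma> then D (act v \<alpha>) + F (\<rho> \<alpha>) else 0)"

definition triple where
  "triple v D F \<longleftrightarrow> splitting M A k v \<and> connection M A k D \<and> flat M A k D \<and>
    induces_B_rep M A k D \<and> F \<in> forms2_tc M A k D \<and> split_form M A k v = pullback_B M A k F"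

lemma flatD:
  assumes "flat M A k D" "X \<in> vfields M" "Y \<in> vfields M" "\<xi> \<in> K"
  shows "D (D \<xi> Y) X = D (D \<xi> X) Y + D \<xi> (vf_bracket X Y)"
proof -
  have "D (D \<xi> Y) X - D (D \<xi> X) Y - D \<xi> (vf_bracket X Y) = 0"
    using assms unfolding flat_def by blast
  then show ?thesis by (simp add: algebra_simps)
qed

lemma triple_of_IM:
  assumes IM: "IM_connection M A k (C, v)" and cur: "curving M A k (C, v) F"
  shows "triple v (restr M A k C) F" and "C = IM_of v (restr M A k C) F"
proof -
  let ?D = "restr M A k C"
  have v: "splitting M A k v"
    and C_forms1: "\<And>\<alpha>. \<alpha> \<in> \<Gamma> \<Longrightarrow> C \<alpha> \<in> forms1 M (TM M) K"
    and C_out: "\<And>\<alpha>. \<alpha> \<notin> \<Gamma> \<Longrightarrow> C \<alpha> = 0"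
    and C_add: "\<And>\<alpha> \<beta>. \<alpha> \<in> \<Gamma> \<Longrightarrow> \<beta> \<in> \<Gamma> \<Longrightarrow> C (\<alpha> + \<beta>) = C \<alpha> + C \<beta>"
    and C_scaleR: "\<And>c \<alpha>. \<alpha> \<in> \<Gamma> \<Longrightarrow> C (c *\<^sub>R \<alpha>) = c *\<^sub>R C \<alpha>"
    and C_smul: "\<And>f \<alpha> X. f \<in> Cinf M \<Longrightarrow> \<alpha> \<in> \<Gamma> \<Longrightarrow> X \<in> vfields M \<Longrightarrow>
      C (smul f \<alpha>) X = smul f (C \<alpha> X) + smul (\<lambda>x. X x f) (act v \<alpha>)"
    and C_v: "\<And>\<alpha> \<beta>. \<alpha> \<in> \<Gamma> \<Longrightarrow> \<beta> \<in> \<Gamma> \<Longrightarrow> act v (br \<alpha> \<beta>) = br \<alpha> (act v \<beta>) - C \<alpha> (\<rho> \<beta>)"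
    using IM unfolding IM_connection_def by auto
  have F: "F \<in> TF"
    and cur1: "\<And>\<alpha>. \<alpha> \<in> \<Gamma> \<Longrightarrow> diff1 (TM M) (\<lambda>X \<xi>. ?D \<xi> X) (C \<alpha>) = Lie2 M A \<alpha> F"
    and cur2: "\<And>\<alpha>. \<alpha> \<in> \<Gamma> \<Longrightarrow> C (act (hor v) \<alpha>) = F (\<rho> \<alpha>)"
    using cur unfolding curving_def IM_curvature_def by auto
  have D_eq: "?D \<xi> = C \<xi>" if "\<xi> \<in> K" for \<xi> using that by (simp add: restr_def)
  have D_out: "?D \<xi> = 0" if "\<xi> \<notin> K" for \<xi> using that by (simp add: restr_def)
  have D: "connection M A k ?D"
    unfolding connection_def
  proof (intro conjI ballI allI impI)
    fix c \<xi> assume \<xi>: "\<xi> \<in> K"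
    then have "c *\<^sub>R \<xi> \<in> K" using K_smul[OF Cinf_const \<xi>, of c] by (simp add: smul_const)
    then show "?D (c *\<^sub>R \<xi>) = c *\<^sub>R ?D \<xi>" using \<xi> by (simp add: D_eq C_scaleR K_\<Gamma>)
  qed (simp_all add: D_eq D_out K_add K_smul C_forms1 C_add C_smul K_\<Gamma> split_id[OF v])
  \<comment> \<open>The bracket axiom for \<open>v\<close> with a section of \<open>k\<close> in the
    first place: \<open>v\<close> fixes the bracket, which lies in \<open>k\<close>, and the term
    with \<open>act v \<alpha>\<close> vanishes by commutativity.\<close>
  have ind: "br \<alpha> \<xi> = ?D \<xi> (\<rho> \<alpha>)" if "\<alpha> \<in> \<Gamma>" "\<xi> \<in> K" for \<alpha> \<xi>
  proof -
    note \<xi> = K_\<Gamma>[OF that(2)]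
    have "br \<xi> \<alpha> \<in> K" using br_K[OF that] br_antisym[OF \<xi> that(1)] K_uminus by simp
    then have "br \<xi> \<alpha> = br \<xi> (act v \<alpha>) - C \<xi> (\<rho> \<alpha>)"
      using C_v[OF \<xi> that(1)] split_id[OF v] by simp
    then show ?thesis
      using br_K_K[OF that(2) split_K[OF v that(1)]] br_antisym[OF that(1) \<xi>] D_eq[OF that(2)] by simp
  qed
  have C_dec: "C \<alpha> = ?D (act v \<alpha>) + F (\<rho> \<alpha>)" if "\<alpha> \<in> \<Gamma>" for \<alpha>
    using C_add[OF K_\<Gamma>[OF split_K[OF v that]] hor_\<Gamma>[OF v that]] cur2[OF that]
    by (simp add: act_hor D_eq split_K[OF v that])
  have flat: "flat M A k ?D"
    unfolding flat_def
  proof (intro ballI)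
    fix X Y \<xi> assume X: "X \<in> vfields M" and Y: "Y \<in> vfields M" and \<xi>: "\<xi> \<in> K"
    \<comment> \<open>A section of \<open>k\<close> has zero anchor and commutes with the values of
      \<open>F\<close>, so on it the first curvature condition reads as flatness.\<close>
    have "Lie2 M A \<xi> F X Y = 0"
      using X Y br_K_K[OF \<xi> F_K[OF F X Y]] F_zero[OF F] F_antisym[OF F X vfields_zero]
      by (simp add: Lie2_def rho_K[OF \<xi>] vf_bracket_zero_left[OF X] vf_bracket_zero_left[OF Y])
    then have "diff1 (TM M) (\<lambda>X \<xi>. ?D \<xi> X) (C \<xi>) X Y = 0"
      using cur1[OF K_\<Gamma>[OF \<xi>]] by simp
    then show "?D (?D \<xi> Y) X - ?D (?D \<xi> X) Y - ?D \<xi> (vf_bracket X Y) = 0"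
      using X Y by (simp add: diff1_def D_eq[OF \<xi>])
  qed
  have "F (\<rho> \<alpha>) (\<rho> \<beta>) = br \<alpha> (act v \<beta>) - br \<beta> (act v \<alpha>) - act v (br \<alpha> \<beta>)"
    if "\<alpha> \<in> \<Gamma>" "\<beta> \<in> \<Gamma>" for \<alpha> \<beta>
    using C_v[OF that] C_dec[OF that(1)] ind[OF that(2) split_K[OF v that(1)]] by simp
  then have pb: "split_form M A k v = pullback_B M A k F"
    unfolding split_form_eq_pullback_iff[OF v] by blast
  have "dform ?D F (\<rho> \<alpha>) Y Z = 0" if \<alpha>: "\<alpha> \<in> \<Gamma>" and Y: "Y \<in> vfields M" and Z: "Z \<in> vfields M" for \<alpha> Y Z
  proof -
    note a = rho_vfields[OF \<alpha>] and \<xi> = split_K[OF v \<alpha>]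
    note DK = D_K[OF D \<xi>] and FK = F_K[OF F a]
    \<comment> \<open>Flatness removes the contribution of \<open>act v \<alpha>\<close>; only the
      covariant differential of the 1-form \<open>F (\<rho> \<alpha>)\<close> is left.\<close>
    have "diff1 (TM M) (\<lambda>X \<xi>. ?D \<xi> X) (C \<alpha>) Y Z =
        ?D (F (\<rho> \<alpha>) Z) Y - ?D (F (\<rho> \<alpha>) Y) Z - F (\<rho> \<alpha>) (vf_bracket Y Z)"
      using flatD[OF flat Y Z \<xi>] Y Z D_add[OF D DK[OF Z] FK[OF Z]] D_add[OF D DK[OF Y] FK[OF Y]]
      by (simp add: diff1_def C_dec[OF \<alpha>])
    moreover have "Lie2 M A \<alpha> F Y Z =
        ?D (F Y Z) (\<rho> \<alpha>) - F (vf_bracket (\<rho> \<alpha>) Y) Z - F Y (vf_bracket (\<rho> \<alpha>) Z)"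
      using Y Z by (simp add: Lie2_def ind[OF \<alpha> F_K[OF F Y Z]])
    ultimately show ?thesis
      using cur1[OF \<alpha>] F_antisym[OF F Y vf_bracket_vfields[OF a Z]]
        F_antisym[OF F a vf_bracket_vfields[OF Y Z]]
      unfolding dform_eq[OF a Y Z] by (simp add: algebra_simps)
  qed
  then have "F \<in> forms2_tc M A k ?D" unfolding forms2_tc_iff[OF D F] by blast
  then show "triple v ?D F"
    unfolding triple_def induces_B_rep_iff[OF v] using v D flat ind pb by blast
  show "C = IM_of v ?D F" using C_dec C_out by (auto simp: IM_of_def)
qed

lemma IM_of_triple:
  assumes T: "triple v D F"
  shows "IM_connection M A k (IM_of v D F, v)" and "curving M A k (IM_of v D F, v) F"
    and "restr M A k (IM_of v D F) = D"
proof -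
  let ?C = "IM_of v D F"
  have v: "splitting M A k v" and D: "connection M A k D" and fl: "flat M A k D"
    and tc: "F \<in> forms2_tc M A k D" using T unfolding triple_def by auto
  have F: "F \<in> TF" using tc unfolding forms2_tc_def by blast
  have ind: "br \<alpha> \<xi> = D \<xi> (\<rho> \<alpha>)" if "\<alpha> \<in> \<Gamma>" "\<xi> \<in> K" for \<alpha> \<xi>
    using T that unfolding triple_def induces_B_rep_iff[OF v] by blast
  have closed: "dform D F (\<rho> \<alpha>) Y Z = 0" if "\<alpha> \<in> \<Gamma>" "Y \<in> vfields M" "Z \<in> vfields M" for \<alpha> Y Z
    using tc that unfolding forms2_tc_iff[OF D F] by blast
  \<comment> \<open>The equation for the splitting form, with brackets against sections of
    \<open>k\<close> rewritten as derivatives along the anchor. It expresses \<open>v\<close> on a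
    bracket through \<open>D\<close> and \<open>F\<close> alone.\<close>
  have v_br: "act v (br \<alpha> \<beta>) = D (act v \<beta>) (\<rho> \<alpha>) - D (act v \<alpha>) (\<rho> \<beta>) - F (\<rho> \<alpha>) (\<rho> \<beta>)"
    if "\<alpha> \<in> \<Gamma>" "\<beta> \<in> \<Gamma>" for \<alpha> \<beta>
  proof -
    have "F (\<rho> \<alpha>) (\<rho> \<beta>) = br \<alpha> (act v \<beta>) - br \<beta> (act v \<alpha>) - act v (br \<alpha> \<beta>)"
      using T that unfolding triple_def split_form_eq_pullback_iff[OF v] by blast
    then show ?thesis
      unfolding ind[OF that(1) split_K[OF v that(2)]] ind[OF that(2) split_K[OF v that(1)]] by simp
  qed
  have C: "?C \<alpha> = D (act v \<alpha>) + F (\<rho> \<alpha>)" if "\<alpha> \<in> \<Gamma>" for \<alpha> using that by (simp add: IM_of_def)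
  have C_forms1: "?C \<alpha> \<in> forms1 M (TM M) K" if "\<alpha> \<in> \<Gamma>" for \<alpha>
    unfolding C[OF that] by (intro forms1_add D_forms1[OF D] F_forms1[OF F] split_K[OF v that] rho_vfields that)
  have restr: "restr M A k ?C = D"
  proof
    fix \<xi> show "restr M A k ?C \<xi> = D \<xi>"
      using D_outside[OF D] F_zero[OF F]
      by (cases "\<xi> \<in> K") (auto simp: restr_def C K_\<Gamma> rho_K split_id[OF v])
  qed
  have C_br: "?C (br \<alpha> \<beta>) = Lie1 M A \<alpha> (?C \<beta>) - Lie1 M A \<beta> (?C \<alpha>)" if \<alpha>: "\<alpha> \<in> \<Gamma>" and \<beta>: "\<beta> \<in> \<Gamma>" for \<alpha> \<beta>
  proof
    fix X
    show "?C (br \<alpha> \<beta>) X = (Lie1 M A \<alpha> (?C \<beta>) - Lie1 M A \<beta> (?C \<alpha>)) X"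
    proof (cases "X \<in> vfields M")
      case False
      then show ?thesis
        using forms1_outside[OF C_forms1[OF br_closed[OF \<alpha> \<beta>]]] by (simp add: Lie1_def)
    next
      case X: True
      note a = rho_vfields[OF \<alpha>] and b = rho_vfields[OF \<beta>]
        and \<xi> = split_K[OF v \<alpha>] and \<eta> = split_K[OF v \<beta>]
      note DK = D_K[OF D \<xi>] D_K[OF D \<eta>] and FK = F_K[OF F]
      have Lie: "Lie1 M A \<alpha> (?C \<beta>) X = D (D (act v \<beta>) X) (\<rho> \<alpha>) + D (F (\<rho> \<beta>) X) (\<rho> \<alpha>)
          - D (act v \<beta>) (vf_bracket (\<rho> \<alpha>) X) - F (\<rho> \<beta>) (vf_bracket (\<rho> \<alpha>) X)"
        if \<alpha>: "\<alpha> \<in> \<Gamma>" and \<beta>: "\<beta> \<in> \<Gamma>" for \<alpha> \<beta>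
      proof -
        note \<eta> = D_K[OF D split_K[OF v \<beta>] X] F_K[OF F rho_vfields[OF \<beta>] X]
        show ?thesis using X ind[OF \<alpha> K_add[OF \<eta>]] D_add[OF D \<eta>] by (simp add: Lie1_def C[OF \<beta>])
      qed
      have lhs: "?C (br \<alpha> \<beta>) X = D (D (act v \<beta>) (\<rho> \<alpha>)) X - D (D (act v \<alpha>) (\<rho> \<beta>)) X
          - D (F (\<rho> \<alpha>) (\<rho> \<beta>)) X + F (vf_bracket (\<rho> \<alpha>) (\<rho> \<beta>)) X"
        using D_diff[OF D K_diff[OF DK(2)[OF a] DK(1)[OF b]] FK[OF a b]] D_diff[OF D DK(2)[OF a] DK(1)[OF b]]
        by (simp add: C[OF br_closed[OF \<alpha> \<beta>]] v_br[OF \<alpha> \<beta>] rho_br[OF \<alpha> \<beta>])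
      \<comment> \<open>Flatness applied to \<open>act v \<alpha>\<close> and
        \<open>act v \<beta>\<close> cancels the terms that contain only \<open>D\<close>; what
        remains is the exterior derivative of \<open>F\<close> on \<open>\<rho> \<alpha>\<close>,
        \<open>\<rho> \<beta>\<close> and X.\<close>
      show ?thesis
        using closed[OF \<alpha> b X] F_antisym[OF F b vf_bracket_vfields[OF a X]]
          F_antisym[OF F a vf_bracket_vfields[OF b X]]
        unfolding lhs minus_apply[of "Lie1 M A \<alpha> (?C \<beta>)" "Lie1 M A \<beta> (?C \<alpha>)" X]
          Lie[OF \<alpha> \<beta>] Lie[OF \<beta> \<alpha>] flatD[OF fl a X \<eta>] flatD[OF fl b X \<xi>]
          dform_eq[OF a b X]
        by (simp add: algebra_simps)
    qed
  qed
  show "IM_connection M A k (?C, v)"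
    unfolding IM_connection_def split_conv
  proof (intro conjI ballI allI impI)
    fix \<alpha> assume \<alpha>: "\<alpha> \<in> \<Gamma>"
    note \<xi> = split_K[OF v \<alpha>] and a = rho_vfields[OF \<alpha>]
    show "?C \<alpha> \<in> forms1 M (TM M) K" by (rule C_forms1[OF \<alpha>])
    show "?C (c *\<^sub>R \<alpha>) = c *\<^sub>R ?C \<alpha>" for c
      unfolding C[OF \<Gamma>_scaleR[OF \<alpha>]] C[OF \<alpha>] split_scaleR[OF v \<alpha>] rho_scaleR[OF \<alpha>]
        D_scaleR[OF D \<xi>] F_scaleR[OF F a] by (rule scaleR_right_distrib[symmetric])
    show "?C (smul f \<alpha>) X = smul f (?C \<alpha> X) + smul (\<lambda>x. X x f) (act v \<alpha>)"
      if f: "f \<in> Cinf M" and X: "X \<in> vfields M" for f X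
    proof -
      have "?C (smul f \<alpha>) X = D (smul f (act v \<alpha>)) X + F (smul f (\<rho> \<alpha>)) X"
        by (simp add: C \<Gamma>_smul f \<alpha> split_smul[OF v] rho_smul)
      moreover have "?C \<alpha> X = D (act v \<alpha>) X + F (\<rho> \<alpha>) X" by (simp add: C[OF \<alpha>])
      ultimately show ?thesis
        by (simp only: D_smul[OF D f \<xi> X] F_smul_left[OF F f a X] smul_add add_ac)
    qed
    fix \<beta> assume \<beta>: "\<beta> \<in> \<Gamma>"
    show "?C (\<alpha> + \<beta>) = ?C \<alpha> + ?C \<beta>"
      unfolding C[OF \<Gamma>_add[OF \<alpha> \<beta>]] C[OF \<alpha>] C[OF \<beta>] split_add[OF v \<alpha> \<beta>] rho_add[OF \<alpha> \<beta>]
        D_add[OF D \<xi> split_K[OF v \<beta>]] F_add_left[OF F a rho_vfields[OF \<beta>]] by (simp add: add_ac)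
    show "?C (br \<alpha> \<beta>) = Lie1 M A \<alpha> (?C \<beta>) - Lie1 M A \<beta> (?C \<alpha>)" by (rule C_br[OF \<alpha> \<beta>])
    show "act v (br \<alpha> \<beta>) = br \<alpha> (act v \<beta>) - ?C \<alpha> (\<rho> \<beta>)"
      unfolding v_br[OF \<alpha> \<beta>] C[OF \<alpha>] ind[OF \<alpha> split_K[OF v \<beta>]] by simp
  qed (simp_all add: v IM_of_def)
  show "curving M A k (?C, v) F"
    unfolding curving_def IM_curvature_def split_conv restr
  proof (intro conjI ballI)
    fix \<alpha> assume \<alpha>: "\<alpha> \<in> \<Gamma>"
    note \<xi> = split_K[OF v \<alpha>] and a = rho_vfields[OF \<alpha>]
    note DK = D_K[OF D \<xi>] and FK = F_K[OF F a]
    have "?C (act (hor v) \<alpha>) = F (\<rho> \<alpha>)"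
      unfolding C[OF hor_\<Gamma>[OF v \<alpha>]] split_hor[OF v \<alpha>] rho_hor[OF v \<alpha>] D_zero[OF D] by simp
    moreover have "diff1 (TM M) (\<lambda>X \<xi>. D \<xi> X) (?C \<alpha>) = Lie2 M A \<alpha> F"
    proof (rule ext, rule ext)
      fix Y Z
      show "diff1 (TM M) (\<lambda>X \<xi>. D \<xi> X) (?C \<alpha>) Y Z = Lie2 M A \<alpha> F Y Z"
      proof (cases "Y \<in> vfields M \<and> Z \<in> vfields M")
        case True
        then have Y: "Y \<in> vfields M" and Z: "Z \<in> vfields M" by auto
        have "diff1 (TM M) (\<lambda>X \<xi>. D \<xi> X) (?C \<alpha>) Y Z =
            D (F (\<rho> \<alpha>) Z) Y - D (F (\<rho> \<alpha>) Y) Z - F (\<rho> \<alpha>) (vf_bracket Y Z)"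
          using flatD[OF fl Y Z \<xi>] Y Z D_add[OF D DK[OF Z] FK[OF Z]] D_add[OF D DK[OF Y] FK[OF Y]]
          by (simp add: diff1_def C[OF \<alpha>])
        moreover have "Lie2 M A \<alpha> F Y Z =
            D (F Y Z) (\<rho> \<alpha>) - F (vf_bracket (\<rho> \<alpha>) Y) Z - F Y (vf_bracket (\<rho> \<alpha>) Z)"
          using Y Z by (simp add: Lie2_def ind[OF \<alpha> F_K[OF F Y Z]])
        \<comment> \<open>Tangential closedness in the shape of Cartan's formula: the Lie derivative
          of \<open>F\<close> along \<open>\<rho> \<alpha>\<close> is the covariant differential of
          the contraction.\<close>
        moreover have "D (F Y Z) (\<rho> \<alpha>) - F (vf_bracket (\<rho> \<alpha>) Y) Z + F (vf_bracket (\<rho> \<alpha>) Z) Y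
            = D (F (\<rho> \<alpha>) Z) Y - D (F (\<rho> \<alpha>) Y) Z + F (vf_bracket Y Z) (\<rho> \<alpha>)"
          using closed[OF \<alpha> Y Z] unfolding dform_eq[OF a Y Z] by (simp add: algebra_simps)
        ultimately show ?thesis
          using F_antisym[OF F Y vf_bracket_vfields[OF a Z]] F_antisym[OF F a vf_bracket_vfields[OF Y Z]]
          by simp
      qed (auto simp: diff1_def Lie2_def)
    qed
    ultimately show "(diff1 (TM M) (\<lambda>X \<xi>. D \<xi> X) (?C \<alpha>), ?C (act (hor v) \<alpha>)) =
        (Lie2 M A \<alpha> F, F (\<rho> \<alpha>))" by simp
  qed (rule F)
  show "restr M A k ?C = D" by (rule restr)
qed

lemma bij_betw_IM_triples:
  "bij_betw (\<lambda>((C, v), F). (v, restr M A k C, F))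
    {(Cv, F). IM_connection M A k Cv \<and> curving M A k Cv F} {(v, D, F). triple v D F}"
  by (rule bij_betw_byWitness[where f' = "\<lambda>(v, D, F). ((IM_of v D F, v), F)"])
    (auto simp: IM_of_triple triple_of_IM(1) triple_of_IM(2)[symmetric])

section \<open>Dependence of the splitting form on the splitting\<close>

section \<open>The extension class\<close>

abbreviation dB where "dB \<equiv> diff1 (B_space M A k) (B_rep M A k)"
abbreviation B1 where "B1 \<equiv> forms1 M (B_space M A k) K"

lemma dB_proj:
  assumes "\<alpha> \<in> \<Gamma>" "\<beta> \<in> \<Gamma>" "\<eta> \<in> B1"
  shows "dB \<eta> (proj k \<alpha>) (proj k \<beta>) =
    br \<alpha> (\<eta> (proj k \<beta>)) - br \<beta> (\<eta> (proj k \<alpha>)) - \<eta> (proj k (br \<alpha> \<beta>))"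
  using forms1_closed[OF assms(3)] proj_B_sections[OF assms(1)] proj_B_sections[OF assms(2)] assms(1,2)
  by (simp add: diff1_def B_rep_proj B_bracket_proj)

lemma dB_outside: "\<beta> \<notin> B_sections M A k \<or> \<gamma> \<notin> B_sections M A k \<Longrightarrow> dB \<eta> \<beta> \<gamma> = 0"
  by (auto simp: diff1_def)

lemma B1_\<Gamma>: "\<eta> \<in> B1 \<Longrightarrow> \<alpha> \<in> \<Gamma> \<Longrightarrow> \<eta> (proj k \<alpha>) \<in> K"
  using forms1_closed[of \<eta> M "B_space M A k" K] proj_B_sections by simp

lemma dB_add:
  assumes v: "splitting M A k v" and \<eta>: "\<eta> \<in> B1" "\<theta> \<in> B1"
  shows "dB (\<eta> + \<theta>) = dB \<eta> + dB \<theta>"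
proof (rule B_forms_eqI[OF v])
  fix \<alpha> \<beta> assume \<alpha>: "\<alpha> \<in> \<Gamma>" and \<beta>: "\<beta> \<in> \<Gamma>"
  note K = B1_\<Gamma>[OF \<eta>(1) \<alpha>, THEN K_\<Gamma>] B1_\<Gamma>[OF \<eta>(2) \<alpha>, THEN K_\<Gamma>]
    B1_\<Gamma>[OF \<eta>(1) \<beta>, THEN K_\<Gamma>] B1_\<Gamma>[OF \<eta>(2) \<beta>, THEN K_\<Gamma>]
  show "dB (\<eta> + \<theta>) (proj k \<alpha>) (proj k \<beta>) = (dB \<eta> + dB \<theta>) (proj k \<alpha>) (proj k \<beta>)"
    by (simp add: dB_proj[OF \<alpha> \<beta>] forms1_add \<eta> br_add_right[OF \<alpha> K(3,4)] br_add_right[OF \<beta> K(1,2)])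
qed (simp add: dB_outside)

lemma dB_uminus:
  assumes v: "splitting M A k v" and \<eta>: "\<eta> \<in> B1"
  shows "dB (- \<eta>) = - dB \<eta>"
proof -
  have "dB 0 + dB 0 = dB 0" using dB_add[OF v forms1_zero forms1_zero] by simp
  then have "dB 0 = 0" by simp
  then have "dB \<eta> + dB (- \<eta>) = 0" using dB_add[OF v \<eta> forms1_uminus[OF \<eta>]] by simp
  then show ?thesis by (simp add: eq_neg_iff_add_eq_0 add.commute)
qed

lemma class2_cong:
  assumes v: "splitting M A k v" and \<eta>: "\<eta> \<in> B1"
  shows "class2 M (B_space M A k) K (B_rep M A k) (\<omega> + dB \<eta>) = class2 M (B_space M A k) K (B_rep M A k) \<omega>"
proof -
  have sub: "class2 M (B_space M A k) K (B_rep M A k) (\<omega> + dB \<eta>)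
      \<subseteq> class2 M (B_space M A k) K (B_rep M A k) \<omega>" if \<eta>: "\<eta> \<in> B1" for \<omega> \<eta>
    unfolding class2_def using dB_add[OF v \<eta>, symmetric] forms1_add[OF \<eta>]
    by (auto simp: add.assoc)
  \<comment> \<open>The second inclusion is the first one applied to
    \<open>\<omega> + dB \<eta>\<close> and \<open>- \<eta>\<close>.\<close>
  show ?thesis
    using sub[OF \<eta>, of \<omega>] sub[OF forms1_uminus[OF \<eta>], of "\<omega> + dB \<eta>"]
    by (simp add: dB_uminus[OF v \<eta>] add.assoc)
qed

lemma split_form_change:
  assumes v: "splitting M A k v" and v': "splitting M A k v'" and \<eta>: "\<eta> \<in> B1"
    and eq: "\<And>\<alpha>. \<alpha> \<in> \<Gamma> \<Longrightarrow> act v' \<alpha> = act v \<alpha> + \<eta> (proj k \<alpha>)"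
  shows "split_form M A k v' = split_form M A k v + dB \<eta>"
proof (rule B_forms_eqI[OF v])
  fix \<alpha> \<beta> assume \<alpha>: "\<alpha> \<in> \<Gamma>" and \<beta>: "\<beta> \<in> \<Gamma>"
  note K = B1_\<Gamma>[OF \<eta> \<alpha>, THEN K_\<Gamma>] B1_\<Gamma>[OF \<eta> \<beta>, THEN K_\<Gamma>] split_K[OF v \<alpha>, THEN K_\<Gamma>] split_K[OF v \<beta>, THEN K_\<Gamma>]
  show "split_form M A k v' (proj k \<alpha>) (proj k \<beta>) = (split_form M A k v + dB \<eta>) (proj k \<alpha>) (proj k \<beta>)"
    unfolding plus_fun_apply[of _ _ "proj k \<alpha>"] plus_fun_apply[of _ _ "proj k \<beta>"]
      split_form_proj[OF v' \<alpha> \<beta>] split_form_proj[OF v \<alpha> \<beta>] dB_proj[OF \<alpha> \<beta> \<eta>]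
      eq[OF \<alpha>] eq[OF \<beta>] eq[OF br_closed[OF \<alpha> \<beta>]] br_add_right[OF \<alpha> K(4,2)] br_add_right[OF \<beta> K(3,1)]
    by (simp add: algebra_simps)
qed (auto simp: dB_outside split_form_def)

text \<open>Two splittings agree on \<open>k\<close>, so their difference is constant on cosets and
  descends to B; the chosen lift drops out for the same reason.\<close>

lemma split_difference_form:
  assumes v: "splitting M A k v" and v': "splitting M A k v'"
  obtains \<eta> where "\<eta> \<in> B1" "\<And>\<alpha>. \<alpha> \<in> \<Gamma> \<Longrightarrow> act v' \<alpha> = act v \<alpha> + \<eta> (proj k \<alpha>)"
proof -
  define \<eta> where "\<eta> \<beta> = (if \<beta> \<in> B_sections M A k
    then act v' (lift M A k \<beta>) - act v (lift M A k \<beta>) else 0)" for \<beta>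
  have \<eta>: "\<eta> (proj k \<alpha>) = act v' \<alpha> - act v \<alpha>" if "\<alpha> \<in> \<Gamma>" for \<alpha>
  proof -
    note l = lift_proj[OF that]
    have d: "lift M A k (proj k \<alpha>) - \<alpha> \<in> K" using l proj_eq_K that by blast
    then have "act v (lift M A k (proj k \<alpha>)) - act v \<alpha> = act v' (lift M A k (proj k \<alpha>)) - act v' \<alpha>"
      using split_diff[OF v l(1) that] split_diff[OF v' l(1) that] split_id[OF v d] split_id[OF v' d]
      by simp
    then show ?thesis using proj_B_sections[OF that] by (simp add: \<eta>_def algebra_simps)
  qed
  have "\<eta> \<in> B1"
  proof (rule forms1I; (unfold B_space_simps)?)
    fix \<beta> \<gamma> f assume "\<beta> \<in> B_sections M A k"
    then obtain a where a: "a \<in> \<Gamma>" "\<beta> = proj k a" using B_sections_lift[OF v] by metis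
    show "\<eta> \<beta> \<in> K" using a by (simp add: \<eta> K_diff split_K[OF v] split_K[OF v'])
    show "f \<in> Cinf M \<Longrightarrow> \<eta> (B_smul k f \<beta>) = smul f (\<eta> \<beta>)"
      using a by (simp add: proj_smul \<eta> \<Gamma>_smul split_smul[OF v] split_smul[OF v'] smul_diff)
    assume "\<gamma> \<in> B_sections M A k"
    then obtain b where b: "b \<in> \<Gamma>" "\<gamma> = proj k b" using B_sections_lift[OF v] by metis
    show "\<eta> (\<beta> + \<gamma>) = \<eta> \<beta> + \<eta> \<gamma>"
      using a b by (simp add: proj_add \<eta> \<Gamma>_add split_add[OF v] split_add[OF v'])
  qed (simp add: \<eta>_def)
  then show ?thesis using that \<eta> by simp
qed

text \<open>Converse to \<open>split_difference_form\<close>. The form \<open>\<eta>\<close> is only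
  a map on global sections and has to be realised fibrewise before it can be added to
  \<open>v\<close>.\<close>

lemma split_translate:
  assumes v: "splitting M A k v" and \<eta>: "\<eta> \<in> B1"
  obtains v' where "splitting M A k v'" "\<And>\<alpha>. \<alpha> \<in> \<Gamma> \<Longrightarrow> act v' \<alpha> = act v \<alpha> + \<eta> (proj k \<alpha>)"
proof -
  have add: "\<eta> (proj k (s + t)) = \<eta> (proj k s) + \<eta> (proj k t)" if "s \<in> \<Gamma>" "t \<in> \<Gamma>" for s t
    using forms1_additive[OF \<eta>] that by (simp add: proj_add[symmetric] proj_B_sections)
  have smul: "\<eta> (proj k (smul f s)) = smul f (\<eta> (proj k s))" if "f \<in> Cinf M" "s \<in> \<Gamma>" for f s
    using forms1_fmult[OF \<eta> that(1)] that(2) by (simp add: proj_smul[symmetric] proj_B_sections)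
  \<comment> \<open>Tensoriality gives 0 where \<open>s x = 0\<close>. If merely
    \<open>s x \<in> k x\<close>, the horizontal part of \<open>s\<close> has the same projection
    and does vanish at \<open>x\<close>.\<close>
  have vanish: "\<eta> (proj k s) x = 0" if s: "s \<in> \<Gamma>" "s x \<in> k x" for s x
  proof -
    have "proj k s = proj k (act (hor v) s)"
      using s(1) by (subst proj_eq_K) (auto simp: hor_\<Gamma>[OF v], simp add: act_hor split_K[OF v])
    moreover have "act (hor v) s x = 0" using splitting_fib(3)[OF v s(2)] by (simp add: act_apply hor_def)
    then have "\<eta> (proj k (act (hor v) s)) x = 0"
      by (intro sections_tensorial[where T = "\<lambda>s. \<eta> (proj k s)", OF add smul hor_\<Gamma>[OF v s(1)]])
    ultimately show ?thesis by simp
  qed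
  \<comment> \<open>A global section through each fibre element; \<open>val\<close> shows that the
    value of \<open>\<eta>\<close> at \<open>x\<close> does not depend on which one is
    chosen.\<close>
  define s where "s x a = (SOME s. s \<in> \<Gamma> \<and> s x = a)" for x a
  have s: "s x a \<in> \<Gamma>" "s x a x = a" if "a \<in> fib A x" for x a
    using section_through[OF that] someI_ex[of "\<lambda>s. s \<in> \<Gamma> \<and> s x = a"] unfolding s_def by metis+
  have val: "\<eta> (proj k (s x (\<alpha> x))) x = \<eta> (proj k \<alpha>) x" if \<alpha>: "\<alpha> \<in> \<Gamma>" for \<alpha> x
  proof -
    note s\<alpha> = s[OF local_sections_fib[OF \<alpha> UNIV_I], of x]
    have "\<eta> (proj k (s x (\<alpha> x) - \<alpha>)) x = 0"
      using s\<alpha> \<alpha> by (intro vanish \<Gamma>_diff) (simp_all add: subspace_0[OF subspace_k])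
    moreover have "\<eta> (proj k (s x (\<alpha> x))) = \<eta> (proj k (s x (\<alpha> x) - \<alpha>)) + \<eta> (proj k \<alpha>)"
      using add[OF \<Gamma>_diff[OF s\<alpha>(1) \<alpha>] \<alpha>] by simp
    ultimately show ?thesis by simp
  qed
  define v' where "v' x a = (if a \<in> fib A x then v x a + \<eta> (proj k (s x a)) x else 0)" for x a
  have act: "act v' \<alpha> = act v \<alpha> + \<eta> (proj k \<alpha>)" if "\<alpha> \<in> \<Gamma>" for \<alpha>
    using local_sections_fib[OF that] val[OF that] by (intro ext) (simp add: act_apply v'_def)
  have act': "v' x (\<alpha> x) = v x (\<alpha> x) + \<eta> (proj k \<alpha>) x" if "\<alpha> \<in> \<Gamma>" for \<alpha> x
    using fun_cong[OF act[OF that], of x] by (simp add: act_apply)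
  have "splitting M A k v'"
    unfolding splitting_def
  proof (intro conjI allI impI ballI image_subsetI)
    fix x
    note lin = splitting_fib(1)[OF v, of x, unfolded fibre_linear_def]
    show "fibre_linear (fib A x) (v' x)"
      unfolding fibre_linear_def
    proof (intro conjI allI ballI)
      fix a b c assume a: "a \<in> fib A x"
      show "v' x (c *\<^sub>R a) = c *\<^sub>R v' x a"
        using act'[OF \<Gamma>_scaleR[OF s(1)[OF a], of c], of x] act'[OF s(1)[OF a], of x]
          smul[OF Cinf_const s(1)[OF a], of c] s(2)[OF a] lin a
        by (simp add: smul_const scaleR_fun_apply scaleR_right_distrib)
      assume b: "b \<in> fib A x"
      show "v' x (a + b) = v' x a + v' x b"
        using act'[OF \<Gamma>_add[OF s(1)[OF a] s(1)[OF b]], of x] act'[OF s(1)[OF a], of x]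
          act'[OF s(1)[OF b], of x] add[OF s(1)[OF a] s(1)[OF b]] s(2)[OF a] s(2)[OF b] lin a b
        by simp
    qed
    show "v' x a \<in> k x" if a: "a \<in> fib A x" for a
      using B1_\<Gamma>[OF \<eta> s(1)[OF a]] splitting_fib(2)[OF v a] a
      by (auto simp: v'_def sub_sections_def intro: subspace_add[OF subspace_k])
    show "v' x a = 0" if "a \<notin> fib A x" for a using that by (simp add: v'_def)
    show "v' x a = a" if a: "a \<in> k x" for a
      using vanish[OF s(1)[OF k_fib[OF a]], of x] s(2)[OF k_fib[OF a]] a k_fib[OF a] splitting_fib(3)[OF v a]
      by (simp add: v'_def)
  next
    \<comment> \<open>Only global sections can be fed to \<open>\<eta>\<close>, so a local section
      is replaced near each point by a global one that agrees with it there.\<close>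
    fix U :: "'m set" and t assume U: "open U" and t: "t \<in> local_sections M A U"
    show "act v' t \<in> local_sections M A U"
    proof (rule local_sections_local)
      fix x assume x: "x \<in> U"
      obtain t' N where t': "t' \<in> \<Gamma>" "open N" "x \<in> N" "N \<subseteq> U" "\<And>y. y \<in> N \<Longrightarrow> t' y = t y"
        using section_extension[OF U x t] by metis
      have "act v' t' \<in> \<Gamma>"
        unfolding act[OF t'(1)] by (intro \<Gamma>_add K_\<Gamma> split_K[OF v] B1_\<Gamma>[OF \<eta>] t'(1))
      then have "act v' t' \<in> local_sections M A (U \<inter> N)" by (rule local_sections_subset) simp
      then have "act v' t \<in> local_sections M A (U \<inter> N)"
        by (rule local_sections_cong) (simp add: act_apply t'(5))
      then show "\<exists>N. open N \<and> x \<in> N \<and> act v' t \<in> local_sections M A (U \<inter> N)" using t' by blast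
    qed
  qed
  then show ?thesis using that act by blast
qed

text \<open>Since all splittings give the same class, the union collapses; \<open>v\<close> ensures
  that it is not empty.\<close>

lemma ext_class_eq:
  assumes v: "splitting M A k v"
  shows "ext_class M A k = class2 M (B_space M A k) K (B_rep M A k) (split_form M A k v)"
proof -
  have "class2 M (B_space M A k) K (B_rep M A k) (split_form M A k v') =
      class2 M (B_space M A k) K (B_rep M A k) (split_form M A k v)" if v': "splitting M A k v'" for v'
    using split_difference_form[OF v v'] split_form_change[OF v v'] class2_cong[OF v] by metis
  then show ?thesis using v unfolding ext_class_def by blast
qed

lemma ext_class_pullback_iff:
  "ext_class M A k \<in> pullback_tc M A k ` forms2_tc M A k D \<longleftrightarrow>
    (\<exists>v F. splitting M A k v \<and> F \<in> forms2_tc M A k D \<and> split_form M A k v = pullback_B M A k F)"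
proof
  assume "ext_class M A k \<in> pullback_tc M A k ` forms2_tc M A k D"
  then obtain F where F: "F \<in> forms2_tc M A k D" "ext_class M A k = pullback_tc M A k F" by blast
  text \<open>A class is inhabited, so a splitting exists.\<close>
  have "pullback_B M A k F + dB 0 \<in> ext_class M A k"
    unfolding F(2) pullback_tc_def class2_def using forms1_zero by blast
  then obtain v where v: "splitting M A k v" unfolding ext_class_def by blast
  \<comment> \<open>Dropping the summand \<open>dB 0\<close> relies on \<open>dB_add\<close>, hence
    on lifting sections of B along the splitting just found.\<close>
  have "pullback_B M A k F \<in> pullback_tc M A k F"
  proof -
    have "dB 0 = 0" using dB_add[OF v forms1_zero forms1_zero] by simp
    then show ?thesis unfolding pullback_tc_def class2_def using forms1_zero
      by (intro CollectI exI[of _ 0]) simp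
  qed
  then have "pullback_B M A k F \<in> class2 M (B_space M A k) K (B_rep M A k) (split_form M A k v)"
    using F(2) ext_class_eq[OF v] by simp
  then obtain \<eta> where \<eta>: "\<eta> \<in> B1" "pullback_B M A k F = split_form M A k v + dB \<eta>"
    unfolding class2_def by blast
  obtain v' where v': "splitting M A k v'" "\<And>\<alpha>. \<alpha> \<in> \<Gamma> \<Longrightarrow> act v' \<alpha> = act v \<alpha> + \<eta> (proj k \<alpha>)"
    using split_translate[OF v \<eta>(1)] by metis
  have "split_form M A k v' = pullback_B M A k F"
    unfolding \<eta>(2) by (rule split_form_change[OF v v'(1) \<eta>(1) v'(2)])
  then show "\<exists>v F. splitting M A k v \<and> F \<in> forms2_tc M A k D \<and> split_form M A k v = pullback_B M A k F"
    using v'(1) F(1) by blast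
next
  assume "\<exists>v F. splitting M A k v \<and> F \<in> forms2_tc M A k D \<and> split_form M A k v = pullback_B M A k F"
  then obtain v F where "splitting M A k v" "F \<in> forms2_tc M A k D" "split_form M A k v = pullback_B M A k F"
    by blast
  then show "ext_class M A k \<in> pullback_tc M A k ` forms2_tc M A k D"
    using ext_class_eq unfolding pullback_tc_def by auto
qed

lemma primitive_IM_iff_triple:
  "(\<exists>Cv. IM_connection M A k Cv \<and> primitive M A k Cv) \<longleftrightarrow> (\<exists>v D F. triple v D F)"
  unfolding primitive_def using triple_of_IM(1) IM_of_triple(1,2) by (metis surj_pair)

end

theorem proposition5p36:
  fixes M :: "('m::{t2_space,second_countable_topology}, 'e::euclidean_space) manifold"
    and A :: "('m, 'v::real_vector) lie_algebroid"
    and k :: "'m \<Rightarrow> 'v set"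
  assumes "smooth_manifold M"
    and "is_lie_algebroid M A"
    and "abelian_bundle_of_ideals M A k"
  shows "((\<exists>Cv. IM_connection M A k Cv \<and> primitive M A k Cv) \<longleftrightarrow>
          (\<exists>D. connection M A k D \<and> flat M A k D \<and> induces_B_rep M A k D \<and>
             ext_class M A k \<in> pullback_tc M A k ` forms2_tc M A k D)) \<and>
         bij_betw (\<lambda>((C, v), F). (v, restr M A k C, F))
           {(Cv, F). IM_connection M A k Cv \<and> curving M A k Cv F}
           {(v, D, F). splitting M A k v \<and>
              connection M A k D \<and> flat M A k D \<and> induces_B_rep M A k D \<and>
              F \<in> forms2_tc M A k D \<and> split_form M A k v = pullback_B M A k F}"
proof -
  have "vector_bundle M A" using assms(2) unfolding is_lie_algebroid_def by (rule conjunct1)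
  then interpret abelian_ideals M A k using assms by unfold_locales
  \<comment> \<open>The connection is pulled out in front, so that the remaining quantifiers over
    \<open>v\<close> and \<open>F\<close> match \<open>ext_class_pullback_iff\<close>.\<close>
  have "(\<exists>v D F. triple v D F) \<longleftrightarrow> (\<exists>D. connection M A k D \<and> flat M A k D \<and> induces_B_rep M A k D \<and>
      (\<exists>v F. splitting M A k v \<and> F \<in> forms2_tc M A k D \<and> split_form M A k v = pullback_B M A k F))"
    unfolding triple_def by metis
  then show ?thesis
    unfolding primitive_IM_iff_triple ext_class_pullback_iff
    using bij_betw_IM_triples[unfolded triple_def] by (rule conjI)
qed

end
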